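(* Let $0<s<1$, $n\in\mathbb{N}$ with $n>\max\{1,2s\}$, $1<p<\frac{n+s}{n-s}$, and let $\Omega\subset\mathbb{R}^n$ be a bounded domain of class $C^{1,1}$. Then there exists $d_0>0$ and, for every $r\in(0,\infty)$, constants $0<b(r)<B(r)$ independent of $d$, such that for every $d\in(0,d_0)$ and every least energy solution $u_d$ of the problem $$d(-\Delta)^s u+u=|u|^{p-1}u \ \text{ in } \Omega,\qquad \mathcal{N}_s u=0\ \text{ in } \mathbb{R}^n\setminus\overline{\Omega},\qquad u>0\ \text{ in }\Omega,$$ one has $$b(r)\,d^{\frac{n}{2s}}\le\int_\Omega u_d^r\,dx\le B(r)\,d^{\frac{n}{2s}}\qquad\text{if } 1\le r<\infty,$$ $$b(r)\,d^{\frac{n}{2s}}\le\int_\Omega u_d^r\,dx\le B(r)\,d^{\frac{nr}{2s}}\qquad\text{if } 0<r<1.$$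
   Context: Here $(-\Delta)^s u(x)=c_{n,s}\,\mathrm{P.V.}\int_{\mathbb{R}^n}\frac{u(x)-u(y)}{|x-y|^{n+2s}}dy$ with $c_{n,s}=\left(\int_{\mathbb{R}^n}\frac{1-\cos x_1}{|x|^{n+2s}}dx\right)^{-1}$, and $\mathcal{N}_s u(x)=c_{n,s}\int_\Omega\frac{u(x)-u(y)}{|x-y|^{n+2s}}dy$ for $x\in\mathbb{R}^n\setminus\overline{\Omega}$ (nonlocal Neumann derivative). Put $T(\Omega)=\mathbb{R}^{2n}\setminus(\mathbb{R}^n\setminus\Omega)^2$. The Hilbert space $H^s_\Omega$ consists of measurable $u:\mathbb{R}^n\to\mathbb{R}$ with $$\|u\|_{H^s_\Omega}=\Big(\|u\|_{L^2(\Omega)}^2+\int_{T(\Omega)}\frac{|u(x)-u(y)|^2}{|x-y|^{n+2s}}dx\,dy\Big)^{1/2}<\infty.$$ The problem is understood in the weak sense: $u\in H^s_\Omega$ and, for all $\psi\in H^s_\Omega$, $$\frac{d c_{n,s}}{2}\int_{T(\Omega)}\frac{(u(x)-u(y))(\psi(x)-\psi(y))}{|x-y|^{n+2s}}dx\,dy+\int_\Omega u\psi\,dx=\int_\Omega|u|^{p-1}u\psi\,dx .$$ Weak solutions are the critical points of the $C^2$ functional on $H^s_\Omega$ $$J_d(u)=\frac12\Big[\frac{d c_{n,s}}{2}\int_{T(\Omega)}\frac{|u(x)-u(y)|^2}{|x-y|^{n+2s}}dx\,dy+\int_\Omega u^2dx\Big]-\frac1{p+1}\int_\Omega|u|^{p+1}dx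 .$$ The mountain-pass value is $c_d=\inf_{\gamma\in\Gamma}\max_{t\in[0,1]}J_d(\gamma(t))$, where $\Gamma=\{\gamma\in C([0,1];H^s_\Omega):\gamma(0)=0,\ \gamma(1)=u\}$ and $u\in H^s_\Omega$ is a fixed function with $u>0$ and $J_d(u)=0$ (the value does not depend on the choice of such $u$). A least energy solution is a critical point $u_d$ of $J_d$ with $J_d(u_d)=c_d$ and $u_d>0$ in $\Omega$. *)

theory Defs
  imports "HOL-Analysis.Analysis"
begin

text \<open>
  The ambient space is \<open>real ^ 'n\<close>, so \<open>n = CARD('n)\<close>.  Functions are measurable with respect to
  the completed Lebesgue measure, and \<open>lebesgue\<close> on pairs is Lebesgue measure on
  \<open>\<real>\<^sup>n \<times> \<real>\<^sup>n\<close>.  Elements of the function space are representatives of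
  classes modulo null sets; accordingly, positivity is stated almost everywhere.
\<close>

text \<open>
  The coordinate called \<open>x\<^sub>1\<close> is an arbitrary but fixed one; the value of the integral
  does not depend on it.
\<close>

definition frac_const :: "'n::finite itself \<Rightarrow> real \<Rightarrow> real" where
  "frac_const _ s =
     inverse (LINT x|(lebesgue :: (real ^ 'n) measure).
       (1 - cos (x $ (SOME i. True))) / norm x powr (real CARD('n) + 2 * s))"

definition cross_domain :: "(real ^ 'n) set \<Rightarrow> ((real ^ 'n) \<times> (real ^ 'n)) set" where
  "cross_domain \<Omega> = UNIV - (UNIV - \<Omega>) \<times> (UNIV - \<Omega>)"

definition gagliardo_integrand ::
    "real \<Rightarrow> (real ^ 'n \<Rightarrow> real) \<Rightarrow> (real ^ 'n \<Rightarrow> real) \<Rightarrow> (real ^ 'n) \<times> (real ^ 'n) \<Rightarrow> real" where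
  "gagliardo_integrand s u v = (\<lambda>(x, y).
     (u x - u y) * (v x - v y) / norm (x - y) powr (real CARD('n) + 2 * s))"

definition gagliardo_form ::
    "real \<Rightarrow> (real ^ 'n) set \<Rightarrow> (real ^ 'n \<Rightarrow> real) \<Rightarrow> (real ^ 'n \<Rightarrow> real) \<Rightarrow> real" where
  "gagliardo_form s \<Omega> u v = (LINT z:cross_domain \<Omega>|lebesgue. gagliardo_integrand s u v z)"

text \<open>The two integrability conditions say that the norm \<open>Hs_norm\<close> is finite.\<close>

definition Hs_space :: "real \<Rightarrow> (real ^ 'n) set \<Rightarrow> (real ^ 'n \<Rightarrow> real) set" where
  "Hs_space s \<Omega> = {u. u \<in> borel_measurable lebesgue \<and>
     set_integrable lebesgue \<Omega> (\<lambda>x. (u x)\<^sup>2) \<and>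
     set_integrable lebesgue (cross_domain \<Omega>) (gagliardo_integrand s u u)}"

definition Hs_norm :: "real \<Rightarrow> (real ^ 'n) set \<Rightarrow> (real ^ 'n \<Rightarrow> real) \<Rightarrow> real" where
  "Hs_norm s \<Omega> u = sqrt ((LINT x:\<Omega>|lebesgue. (u x)\<^sup>2) + gagliardo_form s \<Omega> u u)"

definition weak_solution ::
    "real \<Rightarrow> real \<Rightarrow> (real ^ 'n) set \<Rightarrow> real \<Rightarrow> (real ^ 'n \<Rightarrow> real) \<Rightarrow> bool" where
  "weak_solution s p \<Omega> d u \<longleftrightarrow> u \<in> Hs_space s \<Omega> \<and>
     (\<forall>\<psi>\<in>Hs_space s \<Omega>.
        d * frac_const TYPE('n) s / 2 * gagliardo_form s \<Omega> u \<psi> + (LINT x:\<Omega>|lebesgue. u x * \<psi> x)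
        = (LINT x:\<Omega>|lebesgue. \<bar>u x\<bar> powr (p - 1) * u x * \<psi> x))"

definition energy ::
    "real \<Rightarrow> real \<Rightarrow> (real ^ 'n) set \<Rightarrow> real \<Rightarrow> (real ^ 'n \<Rightarrow> real) \<Rightarrow> real" where
  "energy s p \<Omega> d u =
     1 / 2 * (d * frac_const TYPE('n) s / 2 * gagliardo_form s \<Omega> u u + (LINT x:\<Omega>|lebesgue. (u x)\<^sup>2))
     - 1 / (p + 1) * (LINT x:\<Omega>|lebesgue. \<bar>u x\<bar> powr (p + 1))"

text \<open>
  The Frechet derivative of the energy on the normed space \<open>Hs_space\<close> exists and vanishes at \<open>u\<close>.
  Since \<open>Hs_space\<close> is a set of functions and not a type, \<open>has_derivative\<close> is written out.
\<close>

definition critical_point ::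
    "real \<Rightarrow> real \<Rightarrow> (real ^ 'n) set \<Rightarrow> real \<Rightarrow> (real ^ 'n \<Rightarrow> real) \<Rightarrow> bool" where
  "critical_point s p \<Omega> d u \<longleftrightarrow> u \<in> Hs_space s \<Omega> \<and>
     (\<forall>\<epsilon>>0. \<exists>\<delta>>0. \<forall>\<psi>\<in>Hs_space s \<Omega>. Hs_norm s \<Omega> \<psi> < \<delta> \<longrightarrow>
        \<bar>energy s p \<Omega> d (\<lambda>x. u x + \<psi> x) - energy s p \<Omega> d u\<bar> \<le> \<epsilon> * Hs_norm s \<Omega> \<psi>)"

definition Hs_paths ::
    "real \<Rightarrow> (real ^ 'n) set \<Rightarrow> (real ^ 'n \<Rightarrow> real) \<Rightarrow> (real \<Rightarrow> real ^ 'n \<Rightarrow> real) set" where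
  "Hs_paths s \<Omega> e = {\<gamma>. (\<forall>t\<in>{0..1}. \<gamma> t \<in> Hs_space s \<Omega>) \<and>
     (\<forall>t\<in>{0..1}. ((\<lambda>t'. Hs_norm s \<Omega> (\<lambda>x. \<gamma> t' x - \<gamma> t x)) \<longlongrightarrow> 0) (at t within {0..1})) \<and>
     \<gamma> 0 = (\<lambda>x. 0) \<and> \<gamma> 1 = e}"

text \<open>The inner supremum is a maximum, as the energy is continuous along a path.\<close>

definition mountain_pass_value ::
    "real \<Rightarrow> real \<Rightarrow> (real ^ 'n) set \<Rightarrow> real \<Rightarrow> (real ^ 'n \<Rightarrow> real) \<Rightarrow> real" where
  "mountain_pass_value s p \<Omega> d e =
     (INF \<gamma>\<in>Hs_paths s \<Omega> e. SUP t\<in>{0..1}. energy s p \<Omega> d (\<gamma> t))"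

definition mountain_pass_endpoint ::
    "real \<Rightarrow> real \<Rightarrow> (real ^ 'n) set \<Rightarrow> real \<Rightarrow> (real ^ 'n \<Rightarrow> real) \<Rightarrow> bool" where
  "mountain_pass_endpoint s p \<Omega> d e \<longleftrightarrow> e \<in> Hs_space s \<Omega> \<and>
     (AE x in lebesgue. 0 < e x) \<and> energy s p \<Omega> d e = 0"

text \<open>
  The mountain-pass value is the same for all admissible endpoints \<open>e\<close>, so it does not matter
  that the endpoint is quantified existentially.
\<close>

definition least_energy_solution ::
    "real \<Rightarrow> real \<Rightarrow> (real ^ 'n) set \<Rightarrow> real \<Rightarrow> (real ^ 'n \<Rightarrow> real) \<Rightarrow> bool" where
  "least_energy_solution s p \<Omega> d u \<longleftrightarrow> critical_point s p \<Omega> d u \<and>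
     (\<exists>e. mountain_pass_endpoint s p \<Omega> d e \<and> energy s p \<Omega> d u = mountain_pass_value s p \<Omega> d e) \<and>
     (AE x in lebesgue. x \<in> \<Omega> \<longrightarrow> 0 < u x)"

text \<open>
  An open set is of class $C^{1,1}$ if near each boundary point it is, in some orthonormal frame
  with last axis \<open>\<nu>\<close>, the region above the graph of a function with Lipschitz gradient on the
  hyperplane orthogonal to \<open>\<nu>\<close>.  The function \<open>\<phi>\<close> lives on the whole space, but only its values
  on that hyperplane, at the orthogonal projection of \<open>x\<close>, are used.
\<close>

definition C11_boundary :: "(real ^ 'n) set \<Rightarrow> bool" where
  "C11_boundary \<Omega> \<longleftrightarrow> (\<forall>x0\<in>frontier \<Omega>. \<exists>\<rho>>0. \<exists>\<nu> \<phi> g L.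
     norm \<nu> = 1 \<and>
     (\<forall>x. (\<phi> has_derivative (\<lambda>h. g x \<bullet> h)) (at x)) \<and> L-lipschitz_on UNIV g \<and>
     \<Omega> \<inter> ball x0 \<rho> = {x \<in> ball x0 \<rho>. \<phi> (x - (x \<bullet> \<nu>) *\<^sub>R \<nu>) < x \<bullet> \<nu>})"

definition bounded_C11_domain :: "(real ^ 'n) set \<Rightarrow> bool" where
  "bounded_C11_domain \<Omega> \<longleftrightarrow>
     \<Omega> \<noteq> {} \<and> open \<Omega> \<and> connected \<Omega> \<and> bounded \<Omega> \<and> C11_boundary \<Omega>"

end

theory Submission
  imports Defs
begin

text \<open>
  Put \<open>l = d powr (1 / (2 * s))\<close> and normalise the moments of \<open>u\<close> by \<open>l\<^sup>n\<close>.

  Since \<open>p\<close> lies below \<open>(n + s) / (n - s)\<close>, the exponent \<open>q = 2 + 4 s / n\<close> exceeds \<open>p + 1\<close>, so the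
  Sobolev embedding is only needed for \<open>q\<close>.  There it is the Nash inequality
  \<open>\<integral> \<bar>v\<bar>\<^sup>q \<le> C N powr (2 s / n) * ([v]\<^sup>2 + l powr (-2 s) * N)\<close> with \<open>N = \<integral> v\<^sup>2\<close>, which follows by
  integrating a pointwise estimate that uses only the measure density of \<open>\<Omega>\<close>.

  A rescaled tent function shows that the mountain-pass value is \<open>O(l\<^sup>n)\<close>; testing the equation
  with \<open>u\<close> then bounds the moment of order \<open>p + 1\<close> from above, and together with the Nash
  inequality from below.  Testing with \<open>1\<close> bounds the first moment.  Testing with powers
  of truncations of \<open>u\<close> (Moser iteration) raises a bounded moment of order \<open>m \<ge> p + 1\<close> to one of order at
  least \<open>m + (q - p - 1)\<close>; no uniform bound on \<open>u\<close> is needed, since each \<open>r\<close> is reached after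
  finitely many steps.  All remaining moments, and the lower bounds, follow from
  \<open>x powr r \<le> R powr (r - a) * x powr a + R powr (r - b) * x powr b\<close> for \<open>a \<le> r \<le> b\<close>.
\<close>

subsection \<open>Measurability and the energy space\<close>

text \<open>The substitution \<open>x = l y\<close> turns the coefficient \<open>d\<close> into 1
  and \<Omega> into a domain that grows as \<open>d\<close> tends to 0, so the estimates must be
  uniform over this family. Measure density survives the scaling: a bound for radii up to
  \<open>l0\<close> becomes one for radii up to \<open>l0 / l \<ge> 1\<close>, with the same
  constant \<open>c\<close>. The Nash inequality can be proved from this without extending functions
  across the boundary. The price is that \<open>q\<close> stays below the critical exponent
  \<open>2 n / (n - 2 s)\<close>; it still suffices because \<open>n > 2 s\<close> gives
  \<open>n - s \<ge> n / 2\<close>, hence \<open>(n + s) / (n - s) \<le> 1 + 4 s / n\<close>. The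
  form over \<open>cross_domain\<close> is estimated from both sides: the Nash inequality uses its
  part over pairs of points of \<Omega>, while for the tent function it is bounded by the integral
  over all pairs of points. The estimate that breaks the scaling is the upper bound for
  \<open>0 < r < 1\<close>: it involves the measure of \<Omega>, whence the different power of
  \<open>d\<close>.\<close>

lemma null_sets_Times_UNIV:
  assumes "N \<in> null_sets lborel"
  shows "N \<times> UNIV \<in> null_sets (lborel :: ('a::euclidean_space \<times> 'b::euclidean_space) measure)"
    and "UNIV \<times> N \<in> null_sets (lborel :: ('b \<times> 'a) measure)"
proof -
  have "N \<times> (UNIV :: 'b set) \<in> null_sets (lborel \<Otimes>\<^sub>M lborel)"
    using assms by (auto simp: null_sets_def lborel.emeasure_pair_measure_Times)
  then show "N \<times> UNIV \<in> null_sets (lborel :: ('a \<times> 'b) measure)" by (simp add: lborel_prod)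
  have "(UNIV :: 'b set) \<times> N \<in> null_sets (lborel \<Otimes>\<^sub>M lborel)"
    using assms by (auto simp: null_sets_def lborel.emeasure_pair_measure_Times)
  then show "UNIV \<times> N \<in> null_sets (lborel :: ('b \<times> 'a) measure)" by (simp add: lborel_prod)
qed

text \<open>Lets a function be replaced by a Borel representative inside a double integral: the
  exceptional pairs lie in two cylinders over a null set.\<close>

lemma AE_lborel_pair:
  assumes "AE x in lborel. P (x :: 'a::euclidean_space)"
  shows "AE z in lborel. P (fst z) \<and> P (snd z)"
proof -
  obtain N where N0: "{x \<in> space lborel. \<not> P x} \<subseteq> N" "emeasure lborel N = 0" "N \<in> sets lborel"
    using assms by (rule AE_E)
  then have N: "N \<in> null_sets lborel" "{x. \<not> P x} \<subseteq> N" by auto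
  have "N \<times> UNIV \<union> UNIV \<times> N \<in> null_sets (lborel :: ('a \<times> 'a) measure)"
    using null_sets_Times_UNIV[OF N(1)] by auto
  then show ?thesis by (rule AE_I') (use N(2) in auto)
qed

text \<open>The target carries the completed sigma-algebra, so continuity is not enough: preimages
  of null sets have to be null as well. This is what makes \<open>u (fst z)\<close> measurable for a
  Lebesgue measurable \<open>u\<close>.\<close>

lemma measurable_fst_lebesgue:
  "(fst :: 'a::euclidean_space \<times> 'b::euclidean_space \<Rightarrow> 'a) \<in> lebesgue \<rightarrow>\<^sub>M lebesgue"
proof (rule completion.measurable_completion2)
  show m: "(fst :: 'a \<times> 'b \<Rightarrow> 'a) \<in> lebesgue \<rightarrow>\<^sub>M lborel"
    by (rule measurable_completion) (simp add: borel_measurable_continuous_onI continuous_on_fst)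
  show "null_sets lborel \<subseteq> null_sets (distr lebesgue lborel (fst :: 'a \<times> 'b \<Rightarrow> 'a))"
  proof
    fix N :: "'a set" assume N: "N \<in> null_sets lborel"
    then have "fst -` N \<inter> space lebesgue \<in> null_sets (lebesgue :: ('a \<times> 'b) measure)"
      using null_sets_completionI[OF null_sets_Times_UNIV(1)[OF N, where 'b='b]] by (simp add: vimage_fst)
    moreover have "N \<in> sets lborel" using N by (rule null_setsD2)
    ultimately show "N \<in> null_sets (distr lebesgue lborel (fst :: 'a \<times> 'b \<Rightarrow> 'a))"
      by (simp only: null_sets_distr_iff[OF m])
  qed
qed

lemma measurable_snd_lebesgue:
  "(snd :: 'a::euclidean_space \<times> 'b::euclidean_space \<Rightarrow> 'b) \<in> lebesgue \<rightarrow>\<^sub>M lebesgue"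
proof (rule completion.measurable_completion2)
  show m: "(snd :: 'a \<times> 'b \<Rightarrow> 'b) \<in> lebesgue \<rightarrow>\<^sub>M lborel"
    by (rule measurable_completion) (simp add: borel_measurable_continuous_onI continuous_on_snd)
  show "null_sets lborel \<subseteq> null_sets (distr lebesgue lborel (snd :: 'a \<times> 'b \<Rightarrow> 'b))"
  proof
    fix N :: "'b set" assume N: "N \<in> null_sets lborel"
    then have "snd -` N \<inter> space lebesgue \<in> null_sets (lebesgue :: ('a \<times> 'b) measure)"
      using null_sets_completionI[OF null_sets_Times_UNIV(2)[OF N, where 'b='a]] by (simp add: vimage_snd)
    moreover have "N \<in> sets lborel" using N by (rule null_setsD2)
    ultimately show "N \<in> null_sets (distr lebesgue lborel (snd :: 'a \<times> 'b \<Rightarrow> 'b))"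
      by (simp only: null_sets_distr_iff[OF m])
  qed
qed

lemma cross_domain_measurable:
  assumes "\<Omega> \<in> sets lebesgue"
  shows "cross_domain \<Omega> \<in> sets lebesgue"
proof -
  have "cross_domain \<Omega> = (fst -` \<Omega> \<inter> space lebesgue) \<union> (snd -` \<Omega> \<inter> space lebesgue)"
    by (auto simp: cross_domain_def)
  also have "\<dots> \<in> sets lebesgue"
    using assms measurable_fst_lebesgue measurable_snd_lebesgue
    by (intro sets.Un measurable_sets) auto
  finally show ?thesis .
qed

lemma gagliardo_integrand_measurable:
  fixes u v :: "real ^ 'n \<Rightarrow> real"
  assumes "u \<in> borel_measurable lebesgue" "v \<in> borel_measurable lebesgue"
  shows "gagliardo_integrand s u v \<in> borel_measurable lebesgue"
proof -
  have *: "(\<lambda>z::(real^'n)\<times>(real^'n). w (fst z)) \<in> borel_measurable lebesgue"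
    "(\<lambda>z::(real^'n)\<times>(real^'n). w (snd z)) \<in> borel_measurable lebesgue"
    if "w \<in> borel_measurable lebesgue" for w :: "real ^ 'n \<Rightarrow> real"
    using measurable_compose[OF measurable_fst_lebesgue that]
      measurable_compose[OF measurable_snd_lebesgue that] by auto
  have "(\<lambda>z::(real^'n)\<times>(real^'n). norm (fst z - snd z)) \<in> borel_measurable lborel"
    by (simp add: borel_measurable_continuous_onI continuous_on_norm continuous_on_diff continuous_on_fst continuous_on_snd)
  then have [measurable]: "(\<lambda>z::(real^'n)\<times>(real^'n). norm (fst z - snd z)) \<in> borel_measurable lebesgue"
    by (rule measurable_completion)
  show ?thesis
    unfolding gagliardo_integrand_def case_prod_beta
    by (intro borel_measurable_divide borel_measurable_times borel_measurable_diff
        powr_real_measurable * assms) auto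
qed

lemma gagliardo_integrand_nonneg: "0 \<le> gagliardo_integrand s u u z"
  by (auto simp: gagliardo_integrand_def split_beta)

lemma abs_mult_le_squares: "\<bar>a * b\<bar> \<le> a\<^sup>2 + b\<^sup>2" for a b :: real
proof -
  have "0 \<le> (\<bar>a\<bar> - \<bar>b\<bar>)\<^sup>2" by simp
  then have "2 * \<bar>a * b\<bar> \<le> a\<^sup>2 + b\<^sup>2"
    by (simp add: power2_diff abs_mult)
  then show ?thesis using abs_ge_zero[of "a * b"] by linarith
qed

lemma gagliardo_integrand_bound:
  "\<bar>gagliardo_integrand s u v z\<bar> \<le> gagliardo_integrand s u u z + gagliardo_integrand s v v z"
proof -
  have *: "\<bar>a * b\<bar> \<le> a * a + b * b" for a b :: real
    using abs_mult_le_squares[of a b] by (simp add: power2_eq_square)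
  show ?thesis
    using divide_right_mono[OF *, of "norm (fst z - snd z) powr _"]
    by (auto simp: gagliardo_integrand_def split_beta add_divide_distrib[symmetric])
qed

lemma gagliardo_form_nonneg: "0 \<le> gagliardo_form s \<Omega> u u"
  unfolding gagliardo_form_def set_lebesgue_integral_def
  by (intro Bochner_Integration.integral_nonneg) (auto simp: gagliardo_integrand_nonneg)

lemma Hs_spaceD:
  assumes "u \<in> Hs_space s \<Omega>"
  shows "u \<in> borel_measurable lebesgue" "set_integrable lebesgue \<Omega> (\<lambda>x. (u x)\<^sup>2)"
    "set_integrable lebesgue (cross_domain \<Omega>) (gagliardo_integrand s u u)"
  using assms by (auto simp: Hs_space_def)

lemma set_borel_measurableI:
  fixes f :: "'a \<Rightarrow> real"
  shows "A \<in> sets M \<Longrightarrow> f \<in> borel_measurable M \<Longrightarrow> set_borel_measurable M A f"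
  unfolding set_borel_measurable_def by (intro borel_measurable_scaleR borel_measurable_indicator)

lemma Hs_form_integrable:
  assumes O: "\<Omega> \<in> sets lebesgue" and u: "u \<in> Hs_space s \<Omega>" and v: "v \<in> Hs_space s \<Omega>"
  shows "set_integrable lebesgue (cross_domain \<Omega>) (gagliardo_integrand s u v)"
proof (rule set_integrable_bound)
  show "set_integrable lebesgue (cross_domain \<Omega>)
      (\<lambda>z. gagliardo_integrand s u u z + gagliardo_integrand s v v z)"
    using Hs_spaceD[OF u] Hs_spaceD[OF v] by (intro set_integral_add) auto
  show "set_borel_measurable lebesgue (cross_domain \<Omega>) (gagliardo_integrand s u v)"
    by (intro set_borel_measurableI cross_domain_measurable O gagliardo_integrand_measurable
        Hs_spaceD[OF u] Hs_spaceD[OF v])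
qed (use gagliardo_integrand_bound[of s u v] gagliardo_integrand_nonneg[of s u] gagliardo_integrand_nonneg[of s v] in \<open>auto intro!: AE_I2 simp: abs_of_nonneg\<close>)

lemma Hs_product_integrable:
  assumes O: "\<Omega> \<in> sets lebesgue" and u: "u \<in> Hs_space s \<Omega>" and v: "v \<in> Hs_space s \<Omega>"
  shows "set_integrable lebesgue \<Omega> (\<lambda>x. u x * v x)"
proof (rule set_integrable_bound)
  show "set_integrable lebesgue \<Omega> (\<lambda>x. (u x)\<^sup>2 + (v x)\<^sup>2)"
    using Hs_spaceD[OF u] Hs_spaceD[OF v] by (intro set_integral_add) auto
  show "set_borel_measurable lebesgue \<Omega> (\<lambda>x. u x * v x)"
    by (intro set_borel_measurableI O borel_measurable_times Hs_spaceD[OF u] Hs_spaceD[OF v])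
  show "AE x in lebesgue. x \<in> \<Omega> \<longrightarrow> norm (u x * v x) \<le> norm ((u x)\<^sup>2 + (v x)\<^sup>2)"
    using abs_mult_le_squares by auto
qed

text \<open>One comparison principle for two purposes: linear combinations, controlled by two
  functions, and Lipschitz truncations, where \<open>b = 0\<close>. Pointwise control of values and
  of increments carries over to the two terms of the norm.\<close>

lemma Hs_space_dominated:
  assumes O: "\<Omega> \<in> sets lebesgue" and u: "u \<in> Hs_space s \<Omega>" and v: "v \<in> Hs_space s \<Omega>"
    and w: "w \<in> borel_measurable lebesgue"
    and sq: "\<And>x. (w x)\<^sup>2 \<le> a * (u x)\<^sup>2 + b * (v x)\<^sup>2"
    and df: "\<And>x y. (w x - w y)\<^sup>2 \<le> a * (u x - u y)\<^sup>2 + b * (v x - v y)\<^sup>2"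
  shows "w \<in> Hs_space s \<Omega>"
    and "(LINT x:\<Omega>|lebesgue. (w x)\<^sup>2) \<le> a * (LINT x:\<Omega>|lebesgue. (u x)\<^sup>2) + b * (LINT x:\<Omega>|lebesgue. (v x)\<^sup>2)"
    and "gagliardo_form s \<Omega> w w \<le> a * gagliardo_form s \<Omega> u u + b * gagliardo_form s \<Omega> v v"
proof -
  let ?g = "gagliardo_integrand s"
  have gle: "?g w w z \<le> a * ?g u u z + b * ?g v v z" for z
  proof -
    have "(w (fst z) - w (snd z))\<^sup>2 / norm (fst z - snd z) powr (real CARD('a) + 2 * s)
      \<le> (a * (u (fst z) - u (snd z))\<^sup>2 + b * (v (fst z) - v (snd z))\<^sup>2) / norm (fst z - snd z) powr (real CARD('a) + 2 * s)"
      by (intro divide_right_mono df) auto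
    then show ?thesis
      by (simp add: gagliardo_integrand_def split_beta power2_eq_square add_divide_distrib mult.assoc)
  qed
  have i1: "set_integrable lebesgue \<Omega> (\<lambda>x. a * (u x)\<^sup>2 + b * (v x)\<^sup>2)"
    using Hs_spaceD[OF u] Hs_spaceD[OF v] by (intro set_integral_add) auto
  have i2: "set_integrable lebesgue (cross_domain \<Omega>) (\<lambda>z. a * ?g u u z + b * ?g v v z)"
    using Hs_spaceD[OF u] Hs_spaceD[OF v] by (intro set_integral_add) auto
  have j1: "set_integrable lebesgue \<Omega> (\<lambda>x. (w x)\<^sup>2)"
  proof (rule set_integrable_bound[OF i1])
    show "set_borel_measurable lebesgue \<Omega> (\<lambda>x. (w x)\<^sup>2)"
      by (intro set_borel_measurableI O borel_measurable_power w)
    show "AE x in lebesgue. x \<in> \<Omega> \<longrightarrow> norm ((w x)\<^sup>2) \<le> norm (a * (u x)\<^sup>2 + b * (v x)\<^sup>2)"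
      using sq by (auto intro!: AE_I2 order.trans[OF _ abs_ge_self])
  qed
  have j2: "set_integrable lebesgue (cross_domain \<Omega>) (?g w w)"
  proof (rule set_integrable_bound[OF i2])
    show "set_borel_measurable lebesgue (cross_domain \<Omega>) (?g w w)"
      by (intro set_borel_measurableI cross_domain_measurable O gagliardo_integrand_measurable w)
    show "AE z in lebesgue. z \<in> cross_domain \<Omega> \<longrightarrow> norm (?g w w z) \<le> norm (a * ?g u u z + b * ?g v v z)"
      using gle gagliardo_integrand_nonneg[of s w] by (auto intro!: AE_I2 order.trans[OF _ abs_ge_self] simp: abs_of_nonneg)
  qed
  show "w \<in> Hs_space s \<Omega>"
    using w j1 j2 by (simp add: Hs_space_def)
  have "(LINT x:\<Omega>|lebesgue. (w x)\<^sup>2) \<le> (LINT x:\<Omega>|lebesgue. a * (u x)\<^sup>2 + b * (v x)\<^sup>2)"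
    using sq by (intro set_integral_mono j1 i1)
  also have "\<dots> = a * (LINT x:\<Omega>|lebesgue. (u x)\<^sup>2) + b * (LINT x:\<Omega>|lebesgue. (v x)\<^sup>2)"
    using Hs_spaceD[OF u] Hs_spaceD[OF v] by (subst set_integral_add) auto
  finally show "(LINT x:\<Omega>|lebesgue. (w x)\<^sup>2) \<le> a * (LINT x:\<Omega>|lebesgue. (u x)\<^sup>2) + b * (LINT x:\<Omega>|lebesgue. (v x)\<^sup>2)" .
  have "gagliardo_form s \<Omega> w w \<le> (LINT z:cross_domain \<Omega>|lebesgue. a * ?g u u z + b * ?g v v z)"
    unfolding gagliardo_form_def using gle by (intro set_integral_mono j2 i2)
  also have "\<dots> = a * gagliardo_form s \<Omega> u u + b * gagliardo_form s \<Omega> v v"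
    unfolding gagliardo_form_def
    using Hs_spaceD[OF u] Hs_spaceD[OF v] by (subst set_integral_add) auto
  finally show "gagliardo_form s \<Omega> w w \<le> a * gagliardo_form s \<Omega> u u + b * gagliardo_form s \<Omega> v v" .
qed

lemma square_sum_le: "(a + b)\<^sup>2 \<le> 2 * a\<^sup>2 + 2 * b\<^sup>2" for a b :: real
proof -
  have "0 \<le> (a - b)\<^sup>2" by simp
  then show ?thesis by (simp add: power2_eq_square algebra_simps)
qed

lemma Hs_lincomb:
  assumes O: "\<Omega> \<in> sets lebesgue" and u: "u \<in> Hs_space s \<Omega>" and v: "v \<in> Hs_space s \<Omega>"
  shows "(\<lambda>x. a * u x + b * v x) \<in> Hs_space s \<Omega>"
    and "(LINT x:\<Omega>|lebesgue. (a * u x + b * v x)\<^sup>2)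
      \<le> 2 * a\<^sup>2 * (LINT x:\<Omega>|lebesgue. (u x)\<^sup>2) + 2 * b\<^sup>2 * (LINT x:\<Omega>|lebesgue. (v x)\<^sup>2)"
    and "gagliardo_form s \<Omega> (\<lambda>x. a * u x + b * v x) (\<lambda>x. a * u x + b * v x)
      \<le> 2 * a\<^sup>2 * gagliardo_form s \<Omega> u u + 2 * b\<^sup>2 * gagliardo_form s \<Omega> v v"
proof -
  have m: "(\<lambda>x. a * u x + b * v x) \<in> borel_measurable lebesgue"
    using Hs_spaceD(1)[OF u] Hs_spaceD(1)[OF v] by auto
  have sq: "(a * u x + b * v x)\<^sup>2 \<le> 2 * a\<^sup>2 * (u x)\<^sup>2 + 2 * b\<^sup>2 * (v x)\<^sup>2" for x
    using square_sum_le[of "a * u x" "b * v x"] by (simp add: power_mult_distrib)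
  have df: "(a * u x + b * v x - (a * u y + b * v y))\<^sup>2
      \<le> 2 * a\<^sup>2 * (u x - u y)\<^sup>2 + 2 * b\<^sup>2 * (v x - v y)\<^sup>2" for x y
  proof -
    have "a * u x + b * v x - (a * u y + b * v y) = a * (u x - u y) + b * (v x - v y)"
      by (simp add: algebra_simps)
    then show ?thesis
      using square_sum_le[of "a * (u x - u y)" "b * (v x - v y)"] by (simp add: power_mult_distrib)
  qed
  note * = Hs_space_dominated[OF O u v m sq df]
  show "(\<lambda>x. a * u x + b * v x) \<in> Hs_space s \<Omega>"
    "(LINT x:\<Omega>|lebesgue. (a * u x + b * v x)\<^sup>2)
      \<le> 2 * a\<^sup>2 * (LINT x:\<Omega>|lebesgue. (u x)\<^sup>2) + 2 * b\<^sup>2 * (LINT x:\<Omega>|lebesgue. (v x)\<^sup>2)"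
    "gagliardo_form s \<Omega> (\<lambda>x. a * u x + b * v x) (\<lambda>x. a * u x + b * v x)
      \<le> 2 * a\<^sup>2 * gagliardo_form s \<Omega> u u + 2 * b\<^sup>2 * gagliardo_form s \<Omega> v v"
    using * by auto
qed

lemma Hs_space_const:
  fixes \<Omega> :: "(real ^ 'n) set"
  assumes "\<Omega> \<in> lmeasurable"
  shows "(\<lambda>x. c) \<in> Hs_space s \<Omega>"
proof -
  have "gagliardo_integrand s (\<lambda>x::real^'n. c) (\<lambda>x. c) = (\<lambda>z. 0)"
    by (auto simp: gagliardo_integrand_def)
  moreover have "set_integrable lebesgue \<Omega> (\<lambda>x. c\<^sup>2)"
    unfolding set_integrable_def
    using assms by (intro integrable_scaleR_left) (auto simp: fmeasurable_def intro!: integrable_real_indicator)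
  ultimately show ?thesis
    by (simp add: Hs_space_def set_integrable_def)
qed

text \<open>Because constants have no increments, testing the weak equation with 1 leaves only the
  two integrals over \<Omega>; the Neumann condition appears here in its weak form.\<close>

lemma gagliardo_form_const: "gagliardo_form s \<Omega> u (\<lambda>x. c) = 0"
  by (simp add: gagliardo_form_def gagliardo_integrand_def split_beta set_lebesgue_integral_def)

subsection \<open>The kernel and the tent function\<close>

lemma dyadic_upper:
  fixes r :: real
  assumes "1 \<le> r"
  obtains k where "2 ^ k \<le> r" "r < 2 ^ Suc k"
proof -
  obtain m where m: "r < 2 ^ m" using real_arch_pow[of 2 r] by auto
  define j where "j = (LEAST m. r < 2 ^ m)"
  have j: "r < 2 ^ j" unfolding j_def by (rule LeastI, rule m)
  then have "j \<noteq> 0" using assms by (intro notI) simp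
  then obtain k where k: "j = Suc k" by (cases j) auto
  have "\<not> r < 2 ^ k" using not_less_Least[of k "\<lambda>m. r < 2 ^ m"] k by (simp add: j_def)
  then show ?thesis using that[of k] j k by simp
qed

lemma dyadic_lower:
  fixes r :: real
  assumes "0 < r" "r < 1"
  obtains k where "(1 / 2) ^ Suc k \<le> r" "r < (1 / 2) ^ k"
proof -
  obtain k where k: "2 ^ k \<le> 1 / r" "1 / r < 2 ^ Suc k"
    using dyadic_upper[of "1 / r"] assms by auto
  show ?thesis
  \<comment> \<open>Inversion reverses the half-open interval: \<open>2 ^ k \<le> 1 / r\<close>
    yields \<open>r \<le> (1 / 2) ^ k\<close>, whereas membership in an open ball will need the
    strict inequality. An exact power of 1/2 is therefore assigned to the previous index.\<close>
  proof (cases "2 ^ k = 1 / r")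
    case False
    then have "2 ^ k < 1 / r" using k by simp
    then show ?thesis using k that[of k] assms by (simp add: field_simps power_divide)
  next
    case True
    then have r: "r = (1 / 2) ^ k" using assms by (simp add: field_simps power_divide)
    then have "k \<noteq> 0" using assms by (intro notI) simp
    then obtain j where "k = Suc j" by (cases k) auto
    then show ?thesis using that[of j] r by simp
  qed
qed

lemma emeasure_ball_scale:
  assumes "0 \<le> r"
  shows "emeasure lborel (ball (x :: real ^ 'n) r) = ennreal (measure lborel (ball (0 :: real ^ 'n) 1) * r ^ CARD('n))"
  using assms emeasure_lborel_ball_finite[of x r] content_ball_conv_unit_ball[of r x]
  by (subst emeasure_eq_ennreal_measure) (auto simp: mult.commute)

text \<open>Dyadic shells about \<open>x\<close> in units of \<open>l\<close>. The far shells give a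
  geometric series of ratio \<open>2 powr (- 2 * s)\<close>; in the near ones the quadratic factor
  improves the kernel and the ratio is \<open>2 powr (2 * s - 2)\<close>. So \<open>s > 0\<close>
  handles infinity and \<open>s < 1\<close> the diagonal. Each shell is enlarged to a ball, whose
  volume scales explicitly.\<close>

lemma kernel_nn_integral_bound:
  fixes s :: real
  assumes "0 < s" "s < 1"
  shows "\<exists>K>0. \<forall>(x :: real ^ 'n) l. 0 < l \<longrightarrow>
    (\<integral>\<^sup>+ y. ennreal (min 1 ((norm (x - y) / l)\<^sup>2) / norm (x - y) powr (real CARD('n) + 2 * s)) \<partial>lborel)
      \<le> ennreal (K * l powr (- 2 * s))"
proof -
  let ?n = "CARD('n)" and ?a = "real CARD('n) + 2 * s"
  define \<omega> where "\<omega> = measure lborel (ball (0 :: real ^ 'n) 1)"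
  have \<omega>: "\<omega> > 0" unfolding \<omega>_def by (simp add: content_ball_pos)
  have ball: "emeasure lborel (ball (x :: real ^ 'n) r) = ennreal (\<omega> * r ^ ?n)" if "r \<ge> 0" for x r
    using that by (simp add: emeasure_ball_scale \<omega>_def)
  \<comment> \<open>Far and near contribution of index \<open>k\<close> with
    \<open>l powr (- 2 * s)\<close> factored out. \<open>2 ^ CARD('n)\<close> comes from the outer
    radius of a far shell, twice the one at which the kernel is evaluated;
    \<open>2 powr (n + 2 s)\<close> comes from evaluating the kernel at the inner radius of a near
    shell, half the radius of its ball.\<close>
  define G where "G k = \<omega> * (2 ^ ?n * (2 powr (- 2 * s)) ^ k + 2 powr ?a * (2 powr (2 * s - 2)) ^ k)" for k
  have G0: "G k \<ge> 0" for k using \<omega> by (simp add: G_def)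
  have lt1: "2 powr (- 2 * s) < (1::real)" "2 powr (2 * s - 2) < (1::real)"
    using assms powr_less_mono[of "- 2 * s" 0 2] powr_less_mono[of "2 * s - 2" 0 2] by auto
  have sG: "summable G"
    unfolding G_def using lt1 by (intro summable_mult summable_add summable_geometric) auto
  define K where "K = suminf G"
  have "G 0 > 0" using \<omega> by (simp add: G_def add_pos_pos)
  then have K: "K > 0" unfolding K_def using sG G0 by (intro suminf_pos2[of _ 0]) auto
  have "(\<integral>\<^sup>+ y. ennreal (min 1 ((norm (x - y) / l)\<^sup>2) / norm (x - y) powr ?a) \<partial>lborel)
      \<le> ennreal (K * l powr (- 2 * s))" if l: "0 < l" for x :: "real ^ 'n" and l
  proof -
    define A where "A k = (l * 2 ^ k) powr (- ?a)" for k
    define B where "B k = ((1 / 2) ^ k)\<^sup>2 * (l * (1 / 2) ^ Suc k) powr (- ?a)" for k :: nat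
    define f where "f k y = ennreal (A k) * indicator (ball x (l * 2 ^ Suc k)) y
        + ennreal (B k) * indicator (ball x (l * (1 / 2) ^ k)) y" for k y
    have AB: "A k \<ge> 0" "B k \<ge> 0" for k by (auto simp: A_def B_def)
    have [measurable]: "f k \<in> borel_measurable lborel" for k
      unfolding f_def measurable_lborel1
      by (intro borel_measurable_add borel_measurable_times_ennreal borel_measurable_indicator) auto
    have pw: "ennreal (min 1 ((norm (x - y) / l)\<^sup>2) / norm (x - y) powr ?a) \<le> (\<Sum>k. f k y)" for y
    proof -
      define r where "r = norm (x - y) / l"
      have nr: "norm (x - y) = l * r" using l by (simp add: r_def)
      have le_f: "f k y \<le> (\<Sum>k. f k y)" for k
        using sum_le_suminf[of "\<lambda>k. f k y" "{k}"] by simp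
      consider "r = 0" | "0 < r" "r < 1" | "1 \<le> r"
        using l by (fastforce simp: r_def not_less)
      then show ?thesis
      proof cases
        \<comment> \<open>On the diagonal the quotient is \<open>0 / 0\<close>, which has the value
          0.\<close>
        case 1 then show ?thesis by (simp add: nr)
      next
        case 2
        then obtain k where k: "(1 / 2) ^ Suc k \<le> r" "r < (1 / 2) ^ k" by (rule dyadic_lower)
        have "min 1 (r\<^sup>2) / norm (x - y) powr ?a \<le> r\<^sup>2 * (l * r) powr (- ?a)"
          unfolding nr powr_minus_divide by (simp add: divide_right_mono)
        also have "\<dots> \<le> B k"
          unfolding B_def using 2 k l assms
          by (intro mult_mono power_mono powr_mono2' mult_left_mono) auto
        finally have "min 1 ((norm (x - y) / l)\<^sup>2) / norm (x - y) powr ?a \<le> B k" by (simp add: r_def)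
        moreover have "y \<in> ball x (l * (1 / 2) ^ k)"
          using k l by (simp add: dist_norm nr)
        ultimately have "ennreal (min 1 ((norm (x - y) / l)\<^sup>2) / norm (x - y) powr ?a) \<le> f k y"
          unfolding f_def by (intro order.trans[OF _ add_increasing[OF zero_le order.refl]]) (simp add: ennreal_leI)
        then show ?thesis using le_f[of k] by (rule order.trans)
      next
        case 3
        then obtain k where k: "2 ^ k \<le> r" "r < 2 ^ Suc k" by (rule dyadic_upper)
        have "min 1 (r\<^sup>2) / norm (x - y) powr ?a \<le> (l * r) powr (- ?a)"
          unfolding nr powr_minus_divide by (simp add: divide_right_mono)
        also have "\<dots> \<le> A k"
          unfolding A_def using 3 k l assms by (intro powr_mono2' mult_left_mono) auto
        finally have "min 1 ((norm (x - y) / l)\<^sup>2) / norm (x - y) powr ?a \<le> A k" by (simp add: r_def)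
        moreover have "y \<in> ball x (l * 2 ^ Suc k)"
          using k l by (simp add: dist_norm nr)
        ultimately have "ennreal (min 1 ((norm (x - y) / l)\<^sup>2) / norm (x - y) powr ?a) \<le> f k y"
          unfolding f_def by (intro order.trans[OF _ add_increasing2[OF zero_le order.refl]]) (simp add: ennreal_leI)
        then show ?thesis using le_f[of k] by (rule order.trans)
      qed
    qed
    have lpow: "(l * t) powr (- ?a) * (l * t) ^ ?n = l powr (- 2 * s) * t powr (- 2 * s)" if "t > 0" for t
    proof -
      have "(l * t) powr (- ?a) * (l * t) ^ ?n = (l * t) powr (- ?a) * (l * t) powr (real ?n)"
        using l that by (simp add: powr_realpow)
      also have "\<dots> = (l * t) powr (- 2 * s)"
        by (simp add: powr_add[symmetric])
      finally show ?thesis using l that by (simp add: powr_mult)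
    qed
    have int_f: "(\<integral>\<^sup>+ y. f k y \<partial>lborel) = ennreal (l powr (- 2 * s) * G k)" for k
    proof -
      have "(\<integral>\<^sup>+ y. f k y \<partial>lborel) = ennreal (A k) * ennreal (\<omega> * (l * 2 ^ Suc k) ^ ?n)
          + ennreal (B k) * ennreal (\<omega> * (l * (1 / 2) ^ k) ^ ?n)"
        unfolding f_def using l by (subst nn_integral_add) (auto simp: nn_integral_cmult_indicator ball simp del: power_Suc
            intro!: borel_measurable_times_ennreal borel_measurable_indicator)
      also have "\<dots> = ennreal (A k * (\<omega> * (l * 2 ^ Suc k) ^ ?n) + B k * (\<omega> * (l * (1 / 2) ^ k) ^ ?n))"
        using AB \<omega> l by (simp add: ennreal_mult[symmetric] flip: ennreal_plus)
      also have "A k * (\<omega> * (l * 2 ^ Suc k) ^ ?n) = \<omega> * 2 ^ ?n * ((l * 2 ^ k) powr (- ?a) * (l * 2 ^ k) ^ ?n)"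
        by (simp add: A_def power_mult_distrib)
      also have "\<dots> = \<omega> * 2 ^ ?n * (l powr (- 2 * s) * (2 powr (- 2 * s)) ^ k)"
        by (subst lpow) (auto simp: powr_power powr_realpow[symmetric] powr_powr mult.commute)
      also have "B k * (\<omega> * (l * (1 / 2) ^ k) ^ ?n)
          = \<omega> * ((1 / 2) powr (- ?a) * ((1 / 2) ^ k)\<^sup>2 * ((l * (1 / 2) ^ k) powr (- ?a) * (l * (1 / 2) ^ k) ^ ?n))"
      proof -
        have "(l * (1 / 2) ^ Suc k) powr (- ?a) = (1 / 2) powr (- ?a) * (l * (1 / 2) ^ k) powr (- ?a)"
          using l by (subst powr_mult[symmetric]) (auto simp: mult_ac)
        then show ?thesis by (simp add: B_def)
      qed
      also have "\<dots> = \<omega> * ((1 / 2) powr (- ?a) * (((1 / 2) ^ k)\<^sup>2 * (l powr (- 2 * s) * ((1 / 2) ^ k) powr (- 2 * s))))"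
        by (subst lpow) auto
      also have "((1 / 2) ^ k)\<^sup>2 * (l powr (- 2 * s) * ((1 / 2) ^ k) powr (- 2 * s))
          = l powr (- 2 * s) * (((1 / 2) powr real k) powr 2 * ((1 / 2) powr real k) powr (- 2 * s))"
        by (simp add: powr_realpow)
      also have "((1 / 2) powr real k) powr 2 * ((1 / 2) powr real k) powr (- 2 * s) = (2 powr (2 * s - 2)) ^ k"
      proof -
        have "((1 / 2) powr real k) powr 2 * ((1 / 2) powr real k) powr (- 2 * s)
            = (1 / 2 :: real) powr ((2 - 2 * s) * real k)"
          by (simp add: powr_powr powr_add[symmetric] algebra_simps)
        also have "\<dots> = 2 powr ((2 * s - 2) * real k)"
          by (simp add: powr_divide powr_minus_divide[symmetric] algebra_simps)
        also have "\<dots> = (2 powr (2 * s - 2)) ^ k"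
          by (simp add: powr_powr[symmetric] powr_realpow)
        finally show ?thesis .
      qed
      also have "(1 / 2 :: real) powr (- ?a) = 2 powr ?a"
        by (simp only: powr_minus) (simp add: powr_divide)
      finally show ?thesis by (simp add: G_def algebra_simps)
    qed
    have "(\<integral>\<^sup>+ y. ennreal (min 1 ((norm (x - y) / l)\<^sup>2) / norm (x - y) powr ?a) \<partial>lborel)
        \<le> (\<integral>\<^sup>+ y. (\<Sum>k. f k y) \<partial>lborel)"
      by (intro nn_integral_mono pw)
    also have "\<dots> = (\<Sum>k. ennreal (l powr (- 2 * s) * G k))"
      by (subst nn_integral_suminf) (auto simp: int_f)
    also have "\<dots> = ennreal (\<Sum>k. l powr (- 2 * s) * G k)"
      using G0 sG by (intro suminf_ennreal2) (auto intro: summable_mult)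
    also have "(\<Sum>k. l powr (- 2 * s) * G k) = K * l powr (- 2 * s)"
      using suminf_mult[OF sG] by (simp add: K_def)
    finally show ?thesis .
  qed
  then show ?thesis using K by blast
qed

text \<open>Finiteness of the defining integral matters as much as its positivity: a divergent
  integral would have the value 0, and so would its inverse. Finiteness follows from the kernel
  bound with \<open>l = 1\<close>, since \<open>1 - cos t\<close> is at most twice
  \<open>min 1 (t\<^sup>2)\<close>.\<close>

lemma frac_const_pos:
  assumes s: "0 < s" "s < 1"
  shows "frac_const TYPE('n::finite) s > 0"
proof -
  let ?a = "real CARD('n) + 2 * s"
  define i :: 'n where "i = (SOME i. True)"
  define h where "h x = (1 - cos (x $ i)) / norm x powr ?a" for x :: "real ^ 'n"
  have h0: "h x \<ge> 0" for x by (simp add: h_def)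
  have cos_eq: "1 - cos t = 2 * (sin (t / 2))\<^sup>2" for t :: real
    using cos_double_sin[of "t / 2"] by simp
  have cos_le: "1 - cos t \<le> 2 * min 1 (t\<^sup>2)" for t :: real
  proof -
    have "\<bar>sin (t / 2)\<bar> \<le> \<bar>t\<bar>" using abs_sin_x_le_abs_x[of "t / 2"] by simp
    then have "(sin (t / 2))\<^sup>2 \<le> t\<^sup>2" by (simp add: abs_le_square_iff)
    moreover have "(sin (t / 2))\<^sup>2 \<le> 1" by (simp add: abs_square_le_1)
    ultimately show ?thesis unfolding cos_eq by simp
  qed
  obtain K where K: "\<forall>(x :: real ^ 'n) l. 0 < l \<longrightarrow>
    (\<integral>\<^sup>+ y. ennreal (min 1 ((norm (x - y) / l)\<^sup>2) / norm (x - y) powr ?a) \<partial>lborel)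
      \<le> ennreal (K * l powr (- 2 * s))"
    using kernel_nn_integral_bound[OF s, where 'n='n] by (elim exE conjE) (rule that; assumption)
  have hle: "h x \<le> 2 * (min 1 ((norm (0 - x) / 1)\<^sup>2) / norm (0 - x) powr ?a)" for x
  proof -
    have "(x $ i)\<^sup>2 \<le> (norm x)\<^sup>2" using component_le_norm_cart[of x i] by (simp flip: abs_le_square_iff)
    then have "1 - cos (x $ i) \<le> 2 * min 1 ((norm x)\<^sup>2)"
      using cos_le[of "x $ i"] by simp
    from divide_right_mono[OF this, of "norm x powr ?a"] show ?thesis by (simp add: h_def)
  qed
  have hm: "h \<in> borel_measurable borel"
  proof -
    have "(\<lambda>x::real^'n. cos (x $ i)) \<in> borel_measurable borel"
      by (intro borel_measurable_continuous_onI continuous_intros)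
    then show ?thesis unfolding h_def by measurable
  qed
  have "(\<integral>\<^sup>+ x. ennreal (h x) \<partial>lborel)
      \<le> (\<integral>\<^sup>+ x. ennreal 2 * ennreal (min 1 ((norm (0 - x) / 1)\<^sup>2) / norm (0 - x :: real ^ 'n) powr ?a) \<partial>lborel)"
  proof (rule nn_integral_mono)
    fix x :: "real ^ 'n"
    show "ennreal (h x) \<le> ennreal 2 * ennreal (min 1 ((norm (0 - x) / 1)\<^sup>2) / norm (0 - x) powr ?a)"
      by (subst ennreal_mult'[symmetric], simp, rule ennreal_leI, rule hle)
  qed
  also have "\<dots> = ennreal 2 * (\<integral>\<^sup>+ x. ennreal (min 1 ((norm (0 - x) / 1)\<^sup>2) / norm (0 - x :: real ^ 'n) powr ?a) \<partial>lborel)"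
    by (rule nn_integral_cmult) measurable
  also have "\<dots> < \<infinity>"
    using K[rule_format, of 1 0] by (auto simp: ennreal_mult_less_top intro: le_less_trans)
  finally have "integrable lborel h"
    using hm h0 by (intro integrableI_nonneg) auto
  then have ih: "integrable lebesgue h" using hm by (simp add: integrable_completion)
  have "integral\<^sup>L lebesgue h \<noteq> 0"
  proof
    assume "integral\<^sup>L lebesgue h = 0"
    then have "AE x in lebesgue. h x = 0"
      using integral_nonneg_eq_0_iff_AE[OF ih] h0 by auto
    \<comment> \<open>Within distance 1/2 of the all-ones vector every coordinate lies between 1/2
      and 3/2, away from the origin and from the zeros of \<open>1 - cos\<close>.\<close>
    moreover define x0 where "x0 = ((\<chi> j. 1) :: real ^ 'n)"
    have "h x \<noteq> 0" if "x \<in> ball x0 (1 / 2)" for x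
    proof -
      have "\<bar>(x0 - x) $ i\<bar> < 1 / 2"
        using that component_le_norm_cart[of "x0 - x" i] by (simp add: dist_norm)
      then have "\<bar>1 - x $ i\<bar> < 1 / 2" by (simp add: x0_def)
      then have xi: "1 / 2 < x $ i" "x $ i < 3 / 2" unfolding abs_less_iff by linarith+
      then have "sin (x $ i / 2) > 0"
        using pi_gt3 by (intro sin_gt_zero) auto
      then have "1 - cos (x $ i) \<noteq> 0" by (simp only: cos_eq) simp
      moreover have "x \<noteq> 0" using xi by auto
      ultimately show ?thesis by (simp add: h_def)
    qed
    ultimately have "AE x in lebesgue. x \<notin> ball x0 (1 / 2)"
      by (auto elim: eventually_mono)
    then have "ball x0 (1 / 2) \<in> null_sets lebesgue"
      by (subst AE_iff_null_sets) auto
    then have "measure lebesgue (ball x0 (1 / 2)) = 0" by (simp add: measure_eq_0_null_sets)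
    then show False using content_ball_pos[of "1 / 2" x0] by simp
  qed
  moreover have "integral\<^sup>L lebesgue h \<ge> 0" using h0 by (intro Bochner_Integration.integral_nonneg) auto
  ultimately have "integral\<^sup>L lebesgue h > 0" by simp
  then show ?thesis by (simp add: frac_const_def h_def[abs_def] i_def)
qed

section \<open>Tent functions\<close>

definition tent :: "'a::metric_space \<Rightarrow> real \<Rightarrow> 'a \<Rightarrow> real" where
  "tent x0 l x = max 0 (1 - dist x0 x / l)"

lemma tent_bounds: "l > 0 \<Longrightarrow> 0 \<le> tent x0 l x" "l > 0 \<Longrightarrow> tent x0 l x \<le> 1"
  by (auto simp: tent_def)

lemma tent_outside: "l > 0 \<Longrightarrow> x \<notin> ball x0 l \<Longrightarrow> tent x0 l x = 0"
  by (auto simp: tent_def field_simps)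

lemma tent_diff_square_le:
  assumes l: "l > 0"
  shows "(tent x0 l x - tent x0 l y)\<^sup>2 \<le> min 1 ((dist x y / l)\<^sup>2)"
proof -
  have "\<bar>tent x0 l x - tent x0 l y\<bar> \<le> \<bar>(1 - dist x0 x / l) - (1 - dist x0 y / l)\<bar>"
    by (auto simp: tent_def max_def)
  also have "\<dots> = \<bar>dist x0 y - dist x0 x\<bar> / l"
    using l by (simp add: diff_divide_distrib[symmetric])
  also have "\<dots> \<le> dist x y / l"
    using l abs_dist_diff_le[of y x0 x] by (intro divide_right_mono) (auto simp: dist_commute)
  finally have "(tent x0 l x - tent x0 l y)\<^sup>2 \<le> (dist x y / l)\<^sup>2"
    using power_mono[of "\<bar>tent x0 l x - tent x0 l y\<bar>" _ 2] by simp
  moreover have "\<bar>tent x0 l x - tent x0 l y\<bar> \<le> 1"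
    using tent_bounds[OF l, of x0 x] tent_bounds[OF l, of x0 y] by linarith
  then have "(tent x0 l x - tent x0 l y)\<^sup>2 \<le> 1" by (simp add: abs_square_le_1)
  ultimately show ?thesis by simp
qed

lemma tent_measurable: "l > 0 \<Longrightarrow> tent x0 l \<in> borel_measurable (borel :: 'a::euclidean_space measure)"
  unfolding tent_def[abs_def] by (intro borel_measurable_continuous_onI continuous_intros) simp_all

text \<open>The integrand vanishes unless one of the two points lies in the ball, and it never
  exceeds the kernel of \<open>kernel_nn_integral_bound\<close>. Integrating the kernel over the
  free point and then the other point over the ball gives the bound, twice. Since all pairs of
  points are counted, \<open>C\<close> depends neither on \<Omega> nor on the centre.\<close>

lemma tent_Hs_space:
  assumes s: "0 < s" "s < 1"
  shows "\<exists>C>0. \<forall>\<Omega>\<in>sets lebesgue. \<forall>(x0 :: real ^ 'n) l. 0 < l \<longrightarrow> tent x0 l \<in> Hs_space s \<Omega> \<and>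
    gagliardo_form s \<Omega> (tent x0 l) (tent x0 l) \<le> C * l powr (- 2 * s) * l ^ CARD('n) \<and>
    (LINT x:\<Omega>|lebesgue. (tent x0 l x)\<^sup>2) \<le> C * l ^ CARD('n)"
proof -
  let ?a = "real CARD('n) + 2 * s"
  obtain K where K0: "K > 0" and K: "\<forall>(x :: real ^ 'n) l. 0 < l \<longrightarrow>
    (\<integral>\<^sup>+ y. ennreal (min 1 ((norm (x - y) / l)\<^sup>2) / norm (x - y) powr ?a) \<partial>lborel)
      \<le> ennreal (K * l powr (- 2 * s))"
    using kernel_nn_integral_bound[OF s, where 'n='n] by (elim exE conjE) (rule that; assumption)
  define \<omega> where "\<omega> = measure lborel (ball (0 :: real ^ 'n) 1)"
  have \<omega>: "\<omega> > 0" unfolding \<omega>_def by (simp add: content_ball_pos)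
  define C where "C = max (2 * K * \<omega>) \<omega>"
  have C: "C > 0" "2 * K * \<omega> \<le> C" "\<omega> \<le> C" using \<omega> by (auto simp: C_def)
  have "tent x0 l \<in> Hs_space s \<Omega> \<and>
    gagliardo_form s \<Omega> (tent x0 l) (tent x0 l) \<le> C * l powr (- 2 * s) * l ^ CARD('n) \<and>
    (LINT x:\<Omega>|lebesgue. (tent x0 l x)\<^sup>2) \<le> C * l ^ CARD('n)"
    if O: "\<Omega> \<in> sets lebesgue" and l: "0 < l" for \<Omega> and x0 :: "real ^ 'n" and l
  proof -
    let ?\<phi> = "tent x0 l"
    let ?B = "ball x0 l"
    define k where "k x y = ennreal (min 1 ((norm (x - y) / l)\<^sup>2) / norm (x - y) powr ?a)" for x y :: "real ^ 'n"
    have k_commute: "k x y = k y x" for x y by (simp add: k_def norm_minus_commute)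
    have k_int: "(\<integral>\<^sup>+ y. k x y \<partial>lborel) \<le> ennreal (K * l powr (- 2 * s))" for x
      using K l by (simp add: k_def)
    have k_meas: "(\<lambda>z. k (fst z) (snd z)) \<in> borel_measurable (lborel \<Otimes>\<^sub>M lborel)"
      unfolding k_def by measurable
    have k_meas1: "k x \<in> borel_measurable lborel" for x
      unfolding k_def[abs_def] by measurable
    have m1: "?\<phi> \<in> borel_measurable lborel" using tent_measurable[OF l] by simp
    then have m: "?\<phi> \<in> borel_measurable lebesgue" by (rule measurable_completion)
    have \<omega>l: "emeasure lborel ?B = ennreal (\<omega> * l ^ CARD('n))"
      using l by (simp add: emeasure_ball_scale \<omega>_def)
    have half: "(\<integral>\<^sup>+ x. (\<integral>\<^sup>+ y. k x y * indicator ?B x \<partial>lborel) \<partial>lborel) \<le> ennreal (K * l powr (- 2 * s) * (\<omega> * l ^ CARD('n)))"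
    proof -
      have "(\<integral>\<^sup>+ x. (\<integral>\<^sup>+ y. k x y * indicator ?B x \<partial>lborel) \<partial>lborel)
          \<le> (\<integral>\<^sup>+ x. ennreal (K * l powr (- 2 * s)) * indicator ?B x \<partial>lborel)"
      proof (rule nn_integral_mono)
        fix x
        show "(\<integral>\<^sup>+ y. k x y * indicator ?B x \<partial>lborel) \<le> ennreal (K * l powr (- 2 * s)) * indicator ?B x"
          using k_int[of x] by (cases "x \<in> ?B") simp_all
      qed
      also have "\<dots> = ennreal (K * l powr (- 2 * s)) * ennreal (\<omega> * l ^ CARD('n))"
        by (simp add: nn_integral_cmult_indicator \<omega>l)
      finally show ?thesis using K0 l \<omega> by (simp add: ennreal_mult)
    qed
    let ?f = "\<lambda>z. k (fst z) (snd z) * indicator ?B (fst z)"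
    let ?g = "\<lambda>z. k (fst z) (snd z) * indicator ?B (snd z)"
    have mf: "?f \<in> borel_measurable (lborel \<Otimes>\<^sub>M lborel)" "?g \<in> borel_measurable (lborel \<Otimes>\<^sub>M lborel)"
      by (intro borel_measurable_times_ennreal k_meas measurable_compose[OF measurable_fst borel_measurable_indicator]
          measurable_compose[OF measurable_snd borel_measurable_indicator]; simp)+
    have "(\<integral>\<^sup>+ z. ennreal (gagliardo_integrand s ?\<phi> ?\<phi> z) \<partial>lborel) \<le> (\<integral>\<^sup>+ z. ?f z + ?g z \<partial>lborel)"
    proof (rule nn_integral_mono)
      fix z :: "(real ^ 'n) \<times> (real ^ 'n)"
      obtain x y where z: "z = (x, y)" by (cases z)
      have le: "ennreal (gagliardo_integrand s ?\<phi> ?\<phi> z) \<le> k x y"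
        using tent_diff_square_le[OF l, of x0 x y]
        unfolding z k_def gagliardo_integrand_def dist_norm
        by (auto intro!: ennreal_leI divide_right_mono simp: power2_eq_square)
      show "ennreal (gagliardo_integrand s ?\<phi> ?\<phi> z) \<le> ?f z + ?g z"
      proof (cases "x \<in> ?B \<or> y \<in> ?B")
        case True
        then have "k x y \<le> ?f z + ?g z"
          by (auto simp: z indicator_def intro: add_increasing add_increasing2)
        with le show ?thesis by (rule order.trans)
      next
        case False
        then show ?thesis using l by (simp add: z gagliardo_integrand_def tent_outside)
      qed
    qed
    also have "\<dots> = (\<integral>\<^sup>+ z. ?f z + ?g z \<partial>(lborel \<Otimes>\<^sub>M lborel))" by (simp add: lborel_prod)
    also have "\<dots> = (\<integral>\<^sup>+ z. ?f z \<partial>(lborel \<Otimes>\<^sub>M lborel)) + (\<integral>\<^sup>+ z. ?g z \<partial>(lborel \<Otimes>\<^sub>M lborel))"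
      using mf by (rule nn_integral_add)
    also have "(\<integral>\<^sup>+ z. ?f z \<partial>(lborel \<Otimes>\<^sub>M lborel)) = (\<integral>\<^sup>+ x. (\<integral>\<^sup>+ y. k x y * indicator ?B x \<partial>lborel) \<partial>lborel)"
      using lborel.nn_integral_fst[OF mf(1)] by simp
    also have "(\<integral>\<^sup>+ z. ?g z \<partial>(lborel \<Otimes>\<^sub>M lborel)) = (\<integral>\<^sup>+ y. (\<integral>\<^sup>+ x. k y x * indicator ?B y \<partial>lborel) \<partial>lborel)"
      using lborel_pair.nn_integral_snd[OF mf(2)] by (simp add: k_commute)
    also have "(\<integral>\<^sup>+ x. (\<integral>\<^sup>+ y. k x y * indicator ?B x \<partial>lborel) \<partial>lborel) + (\<integral>\<^sup>+ y. (\<integral>\<^sup>+ x. k y x * indicator ?B y \<partial>lborel) \<partial>lborel)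
        \<le> ennreal (K * l powr (- 2 * s) * (\<omega> * l ^ CARD('n))) + ennreal (K * l powr (- 2 * s) * (\<omega> * l ^ CARD('n)))"
      using half by (intro add_mono) auto
    also have "\<dots> = ennreal (2 * K * \<omega> * (l powr (- 2 * s) * l ^ CARD('n)))"
      using K0 \<omega> l by (simp add: ennreal_plus[symmetric] del: ennreal_plus)
    also have "\<dots> \<le> ennreal (C * (l powr (- 2 * s) * l ^ CARD('n)))"
      using C l by (intro ennreal_leI mult_right_mono) auto
    finally have G: "(\<integral>\<^sup>+ z. ennreal (gagliardo_integrand s ?\<phi> ?\<phi> z) \<partial>lborel) \<le> ennreal (C * (l powr (- 2 * s) * l ^ CARD('n)))" .
    let ?h = "\<lambda>z. indicator (cross_domain \<Omega>) z *\<^sub>R gagliardo_integrand s ?\<phi> ?\<phi> z"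
    have G': "(\<integral>\<^sup>+ z. ennreal (?h z) \<partial>lebesgue) \<le> ennreal (C * (l powr (- 2 * s) * l ^ CARD('n)))"
    proof -
      have "(\<integral>\<^sup>+ z. ennreal (?h z) \<partial>lebesgue) \<le> (\<integral>\<^sup>+ z. ennreal (gagliardo_integrand s ?\<phi> ?\<phi> z) \<partial>lebesgue)"
        by (intro nn_integral_mono) (auto simp: indicator_def)
      with G show ?thesis by (simp add: nn_integral_completion)
    qed
    have mh: "?h \<in> borel_measurable lebesgue"
      by (intro borel_measurable_scaleR borel_measurable_indicator cross_domain_measurable O gagliardo_integrand_measurable m)
    have ih: "integrable lebesgue ?h"
      using mh G' by (intro integrableI_nonneg) (auto simp: gagliardo_integrand_nonneg intro: le_less_trans)
    have "ennreal (gagliardo_form s \<Omega> ?\<phi> ?\<phi>) = (\<integral>\<^sup>+ z. ennreal (?h z) \<partial>lebesgue)"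
      unfolding gagliardo_form_def set_lebesgue_integral_def using ih
      by (subst nn_integral_eq_integral) (auto simp: gagliardo_integrand_nonneg)
    then have "ennreal (gagliardo_form s \<Omega> ?\<phi> ?\<phi>) \<le> ennreal (C * (l powr (- 2 * s) * l ^ CARD('n)))"
      using G' by simp
    moreover have "0 \<le> C * (l powr (- 2 * s) * l ^ CARD('n))" using C l by simp
    ultimately have form_le: "gagliardo_form s \<Omega> ?\<phi> ?\<phi> \<le> C * (l powr (- 2 * s) * l ^ CARD('n))"
      by (simp only: ennreal_le_iff)
    let ?q = "\<lambda>x. indicator \<Omega> x *\<^sub>R (?\<phi> x)\<^sup>2"
    have Q: "(\<integral>\<^sup>+ x. ennreal (?q x) \<partial>lebesgue) \<le> ennreal (C * l ^ CARD('n))"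
    proof -
      have "(\<integral>\<^sup>+ x. ennreal (?q x) \<partial>lebesgue) \<le> (\<integral>\<^sup>+ x. indicator ?B x \<partial>lebesgue)"
      proof (rule nn_integral_mono)
        fix x
        have "(?\<phi> x)\<^sup>2 \<le> 1" using tent_bounds[OF l, of x0 x] by (simp add: power_le_one)
        then show "ennreal (?q x) \<le> indicator ?B x"
          using tent_outside[OF l, of x x0] by (auto simp: indicator_def)
      qed
      also have "\<dots> = ennreal (\<omega> * l ^ CARD('n))" by (simp add: nn_integral_completion \<omega>l)
      also have "\<dots> \<le> ennreal (C * l ^ CARD('n))"
        using C l by (intro ennreal_leI mult_right_mono) auto
      finally show ?thesis .
    qed
    have mq: "?q \<in> borel_measurable lebesgue"
      by (intro borel_measurable_scaleR borel_measurable_indicator O borel_measurable_power m)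
    have iq: "integrable lebesgue ?q"
      using mq Q by (intro integrableI_nonneg) (auto intro: le_less_trans)
    have "ennreal (LINT x:\<Omega>|lebesgue. (?\<phi> x)\<^sup>2) = (\<integral>\<^sup>+ x. ennreal (?q x) \<partial>lebesgue)"
      unfolding set_lebesgue_integral_def using iq by (subst nn_integral_eq_integral) auto
    then have "ennreal (LINT x:\<Omega>|lebesgue. (?\<phi> x)\<^sup>2) \<le> ennreal (C * l ^ CARD('n))"
      using Q by simp
    moreover have "0 \<le> C * l ^ CARD('n)" using C l by simp
    ultimately have q_le: "(LINT x:\<Omega>|lebesgue. (?\<phi> x)\<^sup>2) \<le> C * l ^ CARD('n)"
      by (simp only: ennreal_le_iff)
    have "?\<phi> \<in> Hs_space s \<Omega>"
      using m iq ih by (simp add: Hs_space_def set_integrable_def)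
    with form_le q_le show ?thesis by simp
  qed
  then show ?thesis using C(1) by blast
qed

text \<open>On the concentric ball of half the radius the tent is at least 1/2; this accounts for
  both powers of 1/2.\<close>

lemma tent_powr_integral_ge:
  fixes x0 :: "real ^ 'n"
  assumes l: "0 < l" and O: "\<Omega> \<in> sets lebesgue" and B: "ball x0 l \<subseteq> \<Omega>" and r: "0 \<le> r"
    and i: "set_integrable lebesgue \<Omega> (\<lambda>x. \<bar>tent x0 l x\<bar> powr r)"
  shows "(1 / 2) powr r * (measure lborel (ball (0 :: real ^ 'n) 1) * (1 / 2) ^ CARD('n)) * l ^ CARD('n)
    \<le> (LINT x:\<Omega>|lebesgue. \<bar>tent x0 l x\<bar> powr r)"
proof -
  let ?B = "ball x0 (l / 2)"
  have "(1 / 2) powr r * (measure lborel (ball (0 :: real ^ 'n) 1) * (1 / 2) ^ CARD('n)) * l ^ CARD('n)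
      = (1 / 2) powr r * measure lebesgue ?B"
    using l by (simp add: content_ball_conv_unit_ball[of "l / 2" x0] power_divide)
  also have "\<dots> = (LINT x|lebesgue. (1 / 2) powr r * indicator ?B x)"
    by simp
  also have "\<dots> \<le> (LINT x:\<Omega>|lebesgue. \<bar>tent x0 l x\<bar> powr r)"
    unfolding set_lebesgue_integral_def
  proof (rule integral_mono)
    show "integrable lebesgue (\<lambda>x. (1 / 2) powr r * indicator ?B x)"
      using emeasure_lborel_ball_finite[of x0 "l / 2"]
      by (intro integrable_mult_right integrable_real_indicator) auto
    show "integrable lebesgue (\<lambda>x. indicator \<Omega> x *\<^sub>R \<bar>tent x0 l x\<bar> powr r)"
      using i by (simp add: set_integrable_def)
    fix x
    have "x \<in> \<Omega>" "1 / 2 \<le> tent x0 l x" if "x \<in> ?B"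
      using that B l by (auto simp: tent_def field_simps subset_iff)
    then show "(1 / 2) powr r * indicator ?B x \<le> indicator \<Omega> x *\<^sub>R \<bar>tent x0 l x\<bar> powr r"
      using r by (auto simp: indicator_def intro!: powr_mono2)
  qed
  finally show ?thesis .
qed

subsection \<open>Measure density of the domain\<close>

text \<open>The ball of radius \<open>\<eta> \<rho>\<close> about \<open>x + (\<rho> / 2) \<nu>\<close> stays above the graph, which is Lipschitz near \<open>x0\<close>.\<close>

lemma C11_inner_ball_at_boundary:
  fixes \<Omega> :: "(real ^ 'n) set"
  assumes C: "C11_boundary \<Omega>" and x0: "x0 \<in> frontier \<Omega>"
  shows "\<exists>R>0. \<exists>\<eta>>0. \<forall>x\<in>\<Omega> \<inter> ball x0 R. \<forall>\<rho>. 0 < \<rho> \<longrightarrow> \<rho> \<le> R \<longrightarrow> (\<exists>z. ball z (\<eta> * \<rho>) \<subseteq> \<Omega> \<inter> ball x \<rho>)"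
proof -
  from bspec[OF C[unfolded C11_boundary_def] x0] obtain \<rho>0 \<nu> \<phi> g L where \<rho>0: "\<rho>0 > 0" and \<nu>: "norm \<nu> = 1"
    and d\<phi>: "\<forall>x. (\<phi> has_derivative (\<lambda>h. g x \<bullet> h)) (at x)" and g: "L-lipschitz_on UNIV g"
    and eq: "\<Omega> \<inter> ball x0 \<rho>0 = {x \<in> ball x0 \<rho>0. \<phi> (x - (x \<bullet> \<nu>) *\<^sub>R \<nu>) < x \<bullet> \<nu>}"
    by (elim exE conjE) (rule that; assumption)
  define P where "P x = x - (x \<bullet> \<nu>) *\<^sub>R \<nu>" for x
  have P_diff: "P x - P y = P (x - y)" for x y
    by (simp add: P_def inner_diff_left algebra_simps)
  have P_norm: "norm (P x) \<le> 2 * norm x" for x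
  proof -
    have "norm (P x) \<le> norm x + norm ((x \<bullet> \<nu>) *\<^sub>R \<nu>)"
      unfolding P_def by (rule norm_triangle_ineq4)
    also have "norm ((x \<bullet> \<nu>) *\<^sub>R \<nu>) \<le> norm x"
      using \<nu> Cauchy_Schwarz_ineq2[of x \<nu>] by simp
    finally show ?thesis by simp
  qed
  have P_add: "P (x + t *\<^sub>R \<nu> + w) = P x + P w" for x t w
    using \<nu> by (simp add: P_def inner_add_left algebra_simps dot_square_norm)
  \<comment> \<open>The convex set \<open>S\<close> contains the projections of all points of
    \<open>ball x0 \<rho>0\<close>. There the Lipschitz gradient is bounded by \<open>K\<close>, so
    \<phi> is \<open>K\<close>-Lipschitz on \<open>S\<close>.\<close>
  define S where "S = ball (P x0) (2 * \<rho>0)"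
  define K where "K = norm (g (P x0)) + L * (2 * \<rho>0)"
  have L0: "L \<ge> 0" using g by (rule lipschitz_on_nonneg)
  then have K0: "K \<ge> 0" using \<rho>0 by (simp add: K_def)
  have PS: "P x \<in> S" if "x \<in> ball x0 \<rho>0" for x
  proof -
    have "dist (P x0) (P x) \<le> 2 * dist x0 x"
      using P_norm[of "x0 - x"] by (simp add: dist_norm P_diff)
    then show ?thesis using that by (simp add: S_def)
  qed
  have lip: "norm (\<phi> y - \<phi> z) \<le> K * norm (y - z)" if "y \<in> S" "z \<in> S" for y z
  proof (rule differentiable_bound[of S \<phi> "\<lambda>x h. g x \<bullet> h"])
    fix x assume x: "x \<in> S"
    show "(\<phi> has_derivative (\<lambda>h. g x \<bullet> h)) (at x within S)"
      using d\<phi>[rule_format] by (rule has_derivative_at_withinI)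
    have "norm (g x - g (P x0)) \<le> L * norm (x - P x0)"
      using lipschitz_onD[OF g, of x "P x0"] by (simp add: dist_norm)
    also have "\<dots> \<le> L * (2 * \<rho>0)"
      using x L0 by (intro mult_left_mono) (auto simp: S_def dist_norm norm_minus_commute)
    finally have gK: "norm (g x) \<le> K"
      using norm_triangle_ineq2[of "g x" "g (P x0)"] by (simp add: K_def)
    show "onorm (\<lambda>h. g x \<bullet> h) \<le> K"
    proof (rule onorm_le)
      fix h
      have "norm (g x \<bullet> h) \<le> norm (g x) * norm h" by (simp add: Cauchy_Schwarz_ineq2)
      also have "\<dots> \<le> K * norm h" using gK by (intro mult_right_mono) auto
      finally show "norm (g x \<bullet> h) \<le> K * norm h" .
    qed
  qed (use that in \<open>auto simp: S_def\<close>)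
  \<comment> \<open>A displacement shorter than \<open>\<eta> * \<rho>\<close> raises the graph by
    at most \<open>K * (2 * (\<eta> * \<rho>))\<close>, as \<open>P\<close> at most doubles norms,
    and lowers the point by at most \<open>\<eta> * \<rho>\<close>. This \<eta> makes the two losses
    add up to the gain \<open>\<rho> / 2\<close> of the shift along \<nu>.\<close>
  define \<eta> where "\<eta> = 1 / (2 * (2 * K + 1))"
  have \<eta>: "0 < \<eta>" "\<eta> \<le> 1 / 2" "(2 * K + 1) * \<eta> = 1 / 2"
    using K0 by (auto simp: \<eta>_def field_simps)
  have "\<exists>z. ball z (\<eta> * \<rho>) \<subseteq> \<Omega> \<inter> ball x \<rho>"
    if x: "x \<in> \<Omega> \<inter> ball x0 (\<rho>0 / 2)" and \<rho>: "0 < \<rho>" "\<rho> \<le> \<rho>0 / 2" for x \<rho>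
  proof (rule exI, rule subsetI)
    fix y assume y: "y \<in> ball (x + (\<rho> / 2) *\<^sub>R \<nu>) (\<eta> * \<rho>)"
    define w where "w = y - x - (\<rho> / 2) *\<^sub>R \<nu>"
    have yw: "y = x + (\<rho> / 2) *\<^sub>R \<nu> + w" by (simp add: w_def)
    have w: "norm w < \<eta> * \<rho>"
      using y by (simp add: w_def dist_norm norm_minus_commute algebra_simps)
    have "norm (y - x) \<le> norm ((\<rho> / 2) *\<^sub>R \<nu>) + norm w"
      unfolding yw using norm_triangle_ineq[of "(\<rho> / 2) *\<^sub>R \<nu>" w] by (simp add: algebra_simps)
    also have "\<dots> < \<rho> / 2 + \<eta> * \<rho>" using w \<nu> \<rho> by simp
    also have "\<dots> \<le> \<rho>" using mult_right_mono[OF \<eta>(2), of \<rho>] \<rho> by linarith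
    finally have yx: "dist x y < \<rho>" by (simp add: dist_norm norm_minus_commute)
    moreover have "dist x0 x < \<rho>0 / 2" using x by simp
    ultimately have yB: "y \<in> ball x0 \<rho>0"
      using dist_triangle[of x0 y x] \<rho> by simp
    have xB: "x \<in> ball x0 \<rho>0" using x \<rho>0 by auto
    have "\<phi> (P x) < x \<bullet> \<nu>"
      using x xB eq unfolding P_def by blast
    moreover have "\<phi> (P y) - \<phi> (P x) \<le> K * norm (P y - P x)"
      using lip[OF PS[OF yB] PS[OF xB]] by simp
    moreover have "K * norm (P y - P x) \<le> K * (2 * (\<eta> * \<rho>))"
      using P_norm[of w] w K0 unfolding yw P_add by (intro mult_left_mono) auto
    moreover have "y \<bullet> \<nu> = x \<bullet> \<nu> + \<rho> / 2 + w \<bullet> \<nu>"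
      using \<nu> by (simp add: yw inner_add_left dot_square_norm)
    moreover have "- (\<eta> * \<rho>) \<le> w \<bullet> \<nu>"
      using Cauchy_Schwarz_ineq2[of w \<nu>] w \<nu> by simp
    moreover have "K * (2 * (\<eta> * \<rho>)) + \<eta> * \<rho> = \<rho> / 2"
    proof -
      have "K * (2 * (\<eta> * \<rho>)) + \<eta> * \<rho> = ((2 * K + 1) * \<eta>) * \<rho>" by (simp add: algebra_simps)
      then show ?thesis using \<eta>(3) by simp
    qed
    ultimately have "\<phi> (P y) < y \<bullet> \<nu>" by linarith
    then have "y \<in> \<Omega>" using yB eq unfolding P_def by blast
    then show "y \<in> \<Omega> \<inter> ball x \<rho>" using yx by simp
  qed
  then show ?thesis
    using \<rho>0 \<eta>(1) by (intro exI[of _ "\<rho>0 / 2"] exI[of _ \<eta>] conjI ballI allI impI) auto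
qed

text \<open>Every point of the closure has a neighbourhood in which balls contain proportional balls
  of \<Omega>: trivially at interior points, by the graph property at boundary points. Compactness
  makes radius and proportion uniform, and the volume of the inner ball is the density
  bound.\<close>

lemma C11_measure_density:
  fixes \<Omega> :: "(real ^ 'n) set"
  assumes "bounded_C11_domain \<Omega>"
  obtains c \<rho>0 where "c > 0" "\<rho>0 > 0"
    "\<And>x \<rho>. x \<in> \<Omega> \<Longrightarrow> 0 < \<rho> \<Longrightarrow> \<rho> \<le> \<rho>0 \<Longrightarrow> c * \<rho> ^ CARD('n) \<le> measure lebesgue (\<Omega> \<inter> ball x \<rho>)"
proof -
  have O: "\<Omega> \<noteq> {}" "open \<Omega>" "bounded \<Omega>" "C11_boundary \<Omega>"
    using assms by (auto simp: bounded_C11_domain_def)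
  have loc: "\<forall>x0\<in>closure \<Omega>. \<exists>R. R > 0 \<and> (\<exists>\<eta>>0. \<forall>x\<in>\<Omega> \<inter> ball x0 R. \<forall>\<rho>. 0 < \<rho> \<longrightarrow> \<rho> \<le> R \<longrightarrow> (\<exists>z. ball z (\<eta> * \<rho>) \<subseteq> \<Omega> \<inter> ball x \<rho>))"
  proof
    fix x0 assume x0: "x0 \<in> closure \<Omega>"
    show "\<exists>R. R > 0 \<and> (\<exists>\<eta>>0. \<forall>x\<in>\<Omega> \<inter> ball x0 R. \<forall>\<rho>. 0 < \<rho> \<longrightarrow> \<rho> \<le> R \<longrightarrow> (\<exists>z. ball z (\<eta> * \<rho>) \<subseteq> \<Omega> \<inter> ball x \<rho>))"
    proof (cases "x0 \<in> \<Omega>")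
      case True
      then obtain e where e: "e > 0" "ball x0 e \<subseteq> \<Omega>"
        using O(2) openE by blast
      have "ball x (1 * \<rho>) \<subseteq> \<Omega> \<inter> ball x \<rho>" if "x \<in> \<Omega> \<inter> ball x0 (e / 2)" "0 < \<rho>" "\<rho> \<le> e / 2" for x \<rho>
      proof -
        have "ball x \<rho> \<subseteq> ball x0 e"
        proof
          fix y assume "y \<in> ball x \<rho>"
          then show "y \<in> ball x0 e" using that dist_triangle[of x0 y x] by simp
        qed
        then show ?thesis using e by auto
      qed
      then have "\<forall>x\<in>\<Omega> \<inter> ball x0 (e / 2). \<forall>\<rho>. 0 < \<rho> \<longrightarrow> \<rho> \<le> e / 2 \<longrightarrow> (\<exists>z. ball z (1 * \<rho>) \<subseteq> \<Omega> \<inter> ball x \<rho>)"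
        by blast
      then show ?thesis
        using e(1) half_gt_zero zero_less_one by blast
    next
      case False
      then have "x0 \<in> frontier \<Omega>" using x0 O(2) by (simp add: frontier_def interior_open)
      from C11_inner_ball_at_boundary[OF O(4) this] show ?thesis by blast
    qed
  qed
  then obtain R where R: "\<And>x0. x0 \<in> closure \<Omega> \<Longrightarrow> R x0 > 0"
    and "\<forall>x0\<in>closure \<Omega>. \<exists>\<eta>>0. \<forall>x\<in>\<Omega> \<inter> ball x0 (R x0). \<forall>\<rho>. 0 < \<rho> \<longrightarrow> \<rho> \<le> R x0 \<longrightarrow> (\<exists>z. ball z (\<eta> * \<rho>) \<subseteq> \<Omega> \<inter> ball x \<rho>)"
    by metis
  then obtain \<eta> where \<eta>: "\<And>x0. x0 \<in> closure \<Omega> \<Longrightarrow> \<eta> x0 > 0"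
    and z: "\<And>x0 x \<rho>. x0 \<in> closure \<Omega> \<Longrightarrow> x \<in> \<Omega> \<inter> ball x0 (R x0) \<Longrightarrow> 0 < \<rho> \<Longrightarrow> \<rho> \<le> R x0 \<Longrightarrow> \<exists>z. ball z (\<eta> x0 * \<rho>) \<subseteq> \<Omega> \<inter> ball x \<rho>"
    by metis
  have "compact (closure \<Omega>)" using O(3) by (simp add: compact_closure)
  then obtain C where C: "C \<subseteq> closure \<Omega>" "finite C" "closure \<Omega> \<subseteq> (\<Union>x\<in>C. ball x (R x))"
  proof (rule compactE_image[of _ "closure \<Omega>" "\<lambda>x. ball x (R x)"])
    show "closure \<Omega> \<subseteq> (\<Union>x\<in>closure \<Omega>. ball x (R x))" using R by force
  qed auto
  have Cne: "C \<noteq> {}" using C(3) O(1) closure_subset[of \<Omega>] by auto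
  define \<rho>0 where "\<rho>0 = Min (R ` C)"
  define \<eta>0 where "\<eta>0 = Min (\<eta> ` C)"
  have \<rho>0: "\<rho>0 > 0" "\<And>x. x \<in> C \<Longrightarrow> \<rho>0 \<le> R x" and \<eta>0: "\<eta>0 > 0" "\<And>x. x \<in> C \<Longrightarrow> \<eta>0 \<le> \<eta> x"
    using C Cne R \<eta> by (auto simp: \<rho>0_def \<eta>0_def)
  define \<omega> where "\<omega> = measure lebesgue (ball (0 :: real ^ 'n) 1)"
  have \<omega>: "\<omega> > 0" unfolding \<omega>_def by (simp add: content_ball_pos)
  show ?thesis
  proof
    show "\<omega> * \<eta>0 ^ CARD('n) > 0" using \<omega> \<eta>0 by simp
    show "\<rho>0 > 0" by fact
    fix x \<rho> assume x: "x \<in> \<Omega>" and \<rho>: "0 < \<rho>" "\<rho> \<le> \<rho>0"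
    obtain x0 where x0: "x0 \<in> C" "x \<in> ball x0 (R x0)"
      using C(3) x closure_subset[of \<Omega>] by auto
    then obtain z where z: "ball z (\<eta> x0 * \<rho>) \<subseteq> \<Omega> \<inter> ball x \<rho>"
      using z[of x0 x \<rho>] x \<rho> \<rho>0(2)[OF x0(1)] C(1) by auto
    have "\<omega> * \<eta>0 ^ CARD('n) * \<rho> ^ CARD('n) = \<omega> * (\<eta>0 * \<rho>) ^ CARD('n)"
      by (simp add: power_mult_distrib)
    also have "\<dots> \<le> \<omega> * (\<eta> x0 * \<rho>) ^ CARD('n)"
      using \<omega> \<eta>0 x0 \<rho> by (intro mult_left_mono power_mono mult_right_mono) auto
    also have "\<dots> = measure lebesgue (ball z (\<eta> x0 * \<rho>))"
      using \<eta>0(1) \<eta>0(2)[OF x0(1)] \<rho> by (simp add: \<omega>_def content_ball_conv_unit_ball[of "\<eta> x0 * \<rho>" z])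
    also have "\<dots> \<le> measure lebesgue (\<Omega> \<inter> ball x \<rho>)"
      using z O by (intro measure_mono_fmeasurable) (auto intro!: lmeasurable_open bounded_Int)
    finally show "\<omega> * \<eta>0 ^ CARD('n) * \<rho> ^ CARD('n) \<le> measure lebesgue (\<Omega> \<inter> ball x \<rho>)" .
  qed
qed

subsection \<open>Nash inequality\<close>

lemma set_lebesgue_integral_nonneg:
  fixes f :: "'a \<Rightarrow> real"
  assumes "\<And>x. x \<in> A \<Longrightarrow> 0 \<le> f x"
  shows "0 \<le> (LINT x:A|M. f x)"
  unfolding set_lebesgue_integral_def
  by (rule Bochner_Integration.integral_nonneg) (auto simp: indicator_def assms)

text \<open>
  Let \<open>\<rho>\<close> be the radius with \<open>c \<rho>\<^sup>n = 8 N / (v x)\<^sup>2\<close>.  By Chebyshev's inequality \<open>\<bar>v\<bar> \<le> \<bar>v x\<bar> / 2\<close> on at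
  least half of the guaranteed part of \<open>\<Omega> \<inter> ball x \<rho>\<close>, which bounds the inner Gagliardo
  integral at \<open>x\<close> from below.  If \<open>\<rho> > l\<close>, then \<open>\<bar>v x\<bar>\<close> is so small that the second term suffices.
\<close>

lemma nash_pointwise:
  fixes \<Omega> :: "(real ^ 'n) set" and v :: "real ^ 'n \<Rightarrow> real"
  assumes s: "0 < s" and O: "open \<Omega>" and v[measurable]: "v \<in> borel_measurable borel"
    and c: "0 < c" and l: "0 < l"
    and dens: "\<And>x \<rho>. x \<in> \<Omega> \<Longrightarrow> 0 < \<rho> \<Longrightarrow> \<rho> \<le> l \<Longrightarrow> c * \<rho> ^ CARD('n) \<le> measure lebesgue (\<Omega> \<inter> ball x \<rho>)"
    and N: "0 < N" "(\<integral>\<^sup>+ y. ennreal ((v y)\<^sup>2) * indicator \<Omega> y \<partial>lborel) \<le> ennreal N"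
    and x: "x \<in> \<Omega>"
    and t: "t = 2 * s / real CARD('n)"
  shows "ennreal (\<bar>v x\<bar> powr (2 + 2 * t)) \<le> ennreal (((8 / c) powr (1 + t) + (8 / c) powr t) * N powr t) *
    ((\<integral>\<^sup>+ y. ennreal ((v x - v y)\<^sup>2 / norm (x - y) powr (real CARD('n) + 2 * s)) * indicator \<Omega> y \<partial>lborel)
      + ennreal (l powr (- 2 * s) * (v x)\<^sup>2))"
proof (cases "v x = 0")
  case True
  then show ?thesis by simp
next
  case False
  let ?n = "real CARD('n)"
  define a where "a = \<bar>v x\<bar>"
  have a: "a > 0" using False by (simp add: a_def)
  have a2: "(v x)\<^sup>2 = a\<^sup>2" by (simp add: a_def)
  have n: "?n > 0" by simp
  have t0: "t > 0" using s by (simp add: t)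
  \<comment> \<open>\<open>X\<close> will be the n-th power of the radius. Chebyshev's inequality at
    level \<open>a / 2\<close> bounds the bad set by \<open>4 * N / a\<^sup>2\<close>; the factor 8
    makes the guaranteed volume \<open>c * X\<close> twice as large.\<close>
  define X where "X = 8 * N / (c * a\<^sup>2)"
  have X: "X > 0" using a c N by (simp add: X_def)
  define \<rho> where "\<rho> = X powr (1 / ?n)"
  have \<rho>: "\<rho> > 0" using X by (simp add: \<rho>_def)
  have \<rho>n: "\<rho> ^ CARD('n) = X" using X n by (simp add: \<rho>_def powr_power powr_powr)
  have aX: "a\<^sup>2 = 8 / c * N * inverse X" using a c N by (simp add: X_def field_simps)
  have aXr: "(a\<^sup>2) powr r = (8 / c) powr r * N powr r * X powr (- r)" for r
  proof -
    have "(8 / c * N * inverse X) powr r = (8 / c * N) powr r * inverse X powr r"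
      by (rule powr_mult)
    also have "(8 / c * N) powr r = (8 / c) powr r * N powr r"
      by (rule powr_mult)
    also have "inverse X powr r = X powr (- r)"
      using X by (simp add: powr_minus_divide powr_divide inverse_eq_divide)
    finally show ?thesis by (simp only: aX)
  qed
  have apow: "a powr (2 + 2 * t) = (a\<^sup>2) powr (1 + t)"
  proof -
    have "a powr (2 + 2 * t) = (a powr 2) powr (1 + t)" by (simp add: powr_powr algebra_simps)
    then show ?thesis using a by (simp add: powr_numeral)
  qed
  let ?I = "\<integral>\<^sup>+ y. ennreal ((v x - v y)\<^sup>2 / norm (x - y) powr (?n + 2 * s)) * indicator \<Omega> y \<partial>lborel"
  let ?C1 = "(8 / c) powr (1 + t)" and ?C2 = "(8 / c) powr t"
  have mO[measurable]: "\<Omega> \<in> sets borel" using O by simp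
  show ?thesis
  proof (cases "\<rho> \<le> l")
    case True
    define E where "E = {y \<in> \<Omega>. a / 2 < \<bar>v y\<bar>}"
    define F where "F = {y \<in> \<Omega> \<inter> ball x \<rho>. \<bar>v y\<bar> \<le> a / 2}"
    have mE[measurable]: "E \<in> sets borel" unfolding E_def by measurable
    have mF[measurable]: "F \<in> sets borel" unfolding F_def by measurable
    have "ennreal (a\<^sup>2 / 4) * emeasure lborel E = (\<integral>\<^sup>+ y. ennreal (a\<^sup>2 / 4) * indicator E y \<partial>lborel)"
      by (simp add: nn_integral_cmult_indicator)
    also have "\<dots> \<le> (\<integral>\<^sup>+ y. ennreal ((v y)\<^sup>2) * indicator \<Omega> y \<partial>lborel)"
    proof (rule nn_integral_mono)
      fix y
      have "a\<^sup>2 / 4 \<le> (v y)\<^sup>2" if "y \<in> E"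
        using power_mono[of "a / 2" "\<bar>v y\<bar>" 2] that a by (simp add: E_def power_divide)
      then show "ennreal (a\<^sup>2 / 4) * indicator E y \<le> ennreal ((v y)\<^sup>2) * indicator \<Omega> y"
        by (auto simp: indicator_def E_def intro: ennreal_leI)
    qed
    also have "\<dots> \<le> ennreal N" by (rule N(2))
    finally have E1: "ennreal (a\<^sup>2 / 4) * emeasure lborel E \<le> ennreal N" .
    have E2: "emeasure lborel E \<le> ennreal (4 * N / a\<^sup>2)"
    proof -
      have "ennreal (4 / a\<^sup>2) * (ennreal (a\<^sup>2 / 4) * emeasure lborel E) \<le> ennreal (4 / a\<^sup>2) * ennreal N"
        using E1 by (intro mult_left_mono) auto
      moreover have "ennreal (4 / a\<^sup>2) * (ennreal (a\<^sup>2 / 4) * emeasure lborel E) = emeasure lborel E"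
        using a by (simp add: mult.assoc[symmetric] ennreal_mult[symmetric])
      moreover have "ennreal (4 / a\<^sup>2) * ennreal N = ennreal (4 * N / a\<^sup>2)"
        using N(1) by (simp add: ennreal_mult[symmetric])
      ultimately show ?thesis by simp
    qed
    have "ennreal (8 * N / a\<^sup>2) = ennreal (c * \<rho> ^ CARD('n))"
      unfolding \<rho>n using c by (simp add: X_def)
    also have "\<dots> \<le> ennreal (measure lebesgue (\<Omega> \<inter> ball x \<rho>))"
      using dens[OF x \<rho> True] by (rule ennreal_leI)
    also have "\<dots> = emeasure lborel (\<Omega> \<inter> ball x \<rho>)"
      using emeasure_bounded_finite[of "\<Omega> \<inter> ball x \<rho>"]
      by (simp add: emeasure_eq_ennreal_measure bounded_Int less_top)
    also have "\<dots> \<le> emeasure lborel (F \<union> E)"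
      by (intro emeasure_mono) (auto simp: E_def F_def)
    also have "\<dots> \<le> emeasure lborel F + emeasure lborel E"
      by (rule emeasure_subadditive) auto
    also have "\<dots> \<le> emeasure lborel F + ennreal (4 * N / a\<^sup>2)"
      using E2 by (rule add_left_mono)
    finally have "ennreal (8 * N / a\<^sup>2) - ennreal (4 * N / a\<^sup>2) \<le> emeasure lborel F"
      by (simp add: ennreal_minus_le_iff add.commute)
    then have F: "ennreal (4 * N / a\<^sup>2) \<le> emeasure lborel F"
      using N(1) by (simp add: ennreal_minus diff_divide_distrib[symmetric])
    have "ennreal (N * \<rho> powr (- (?n + 2 * s))) = ennreal (a\<^sup>2 / 4 * \<rho> powr (- (?n + 2 * s))) * ennreal (4 * N / a\<^sup>2)"
      using a N(1) by (subst ennreal_mult[symmetric]) auto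
    also have "\<dots> \<le> ennreal (a\<^sup>2 / 4 * \<rho> powr (- (?n + 2 * s))) * emeasure lborel F"
      using F by (rule mult_left_mono) simp
    also have "\<dots> = (\<integral>\<^sup>+ y. ennreal (a\<^sup>2 / 4 * \<rho> powr (- (?n + 2 * s))) * indicator F y \<partial>lborel)"
      by (simp add: nn_integral_cmult_indicator)
    also have "\<dots> \<le> ?I"
    proof (rule nn_integral_mono)
      fix y
      have "a\<^sup>2 / 4 * \<rho> powr (- (?n + 2 * s)) \<le> (v x - v y)\<^sup>2 / norm (x - y) powr (?n + 2 * s)" if y: "y \<in> F"
      proof -
        have vy: "\<bar>v y\<bar> \<le> a / 2" using y by (simp add: F_def)
        have d: "a / 2 \<le> \<bar>v x - v y\<bar>"
          using vy abs_triangle_ineq2[of "v x" "v y"] unfolding a_def by linarith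
        \<comment> \<open>Keeps \<open>y\<close> off the diagonal, where the quotient would take its
          default value 0.\<close>
        have "x \<noteq> y" using vy a by (auto simp: a_def)
        then have nz: "norm (x - y) > 0" by simp
        have "norm (x - y) \<le> \<rho>" using y by (simp add: F_def dist_norm)
        then have "\<rho> powr (- (?n + 2 * s)) \<le> norm (x - y) powr (- (?n + 2 * s))"
          using nz s by (intro powr_mono2') auto
        moreover have "a\<^sup>2 / 4 \<le> (v x - v y)\<^sup>2"
          using power_mono[OF d, of 2] a by (simp add: power_divide)
        ultimately have "a\<^sup>2 / 4 * \<rho> powr (- (?n + 2 * s)) \<le> (v x - v y)\<^sup>2 * norm (x - y) powr (- (?n + 2 * s))"
          by (intro mult_mono) auto
        then show ?thesis unfolding powr_minus_divide by simp
      qed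
      then show "ennreal (a\<^sup>2 / 4 * \<rho> powr (- (?n + 2 * s))) * indicator F y
          \<le> ennreal ((v x - v y)\<^sup>2 / norm (x - y) powr (?n + 2 * s)) * indicator \<Omega> y"
        by (auto simp: indicator_def F_def intro!: ennreal_leI)
    qed
    finally have I: "ennreal (N * \<rho> powr (- (?n + 2 * s))) \<le> ?I" .
    \<comment> \<open>The kernel exponent \<open>n + 2 s\<close> equals \<open>n (1 + t)\<close>, so
      the lower bound for the inner integral is \<open>N * X powr (- (1 + t))\<close>. By the choice
      of \<open>X\<close> this is a multiple of \<open>a powr (2 + 2 * t)\<close> divided by
      \<open>N powr t\<close>: the origin of the exponent in the statement.\<close>
    have e: "1 / ?n * (- (?n + 2 * s)) = - (1 + t)"
      using n by (simp add: t field_simps)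
    have "\<rho> powr (- (?n + 2 * s)) = X powr (- (1 + t))"
      unfolding \<rho>_def powr_powr e ..
    moreover have "a powr (2 + 2 * t) = ?C1 * N powr (1 + t) * X powr (- (1 + t))"
      unfolding apow by (rule aXr)
    moreover have "N powr (1 + t) = N powr t * N" using N by (simp add: powr_add)
    ultimately have "a powr (2 + 2 * t) = ?C1 * N powr t * (N * \<rho> powr (- (?n + 2 * s)))"
      by simp
    also have "ennreal \<dots> = ennreal (?C1 * N powr t) * ennreal (N * \<rho> powr (- (?n + 2 * s)))"
      using N by (intro ennreal_mult) auto
    also have "\<dots> \<le> ennreal ((?C1 + ?C2) * N powr t) * (?I + ennreal (l powr (- 2 * s) * (v x)\<^sup>2))"
      by (intro mult_mono ennreal_leI mult_right_mono order.trans[OF I add_increasing2]) auto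
    finally show ?thesis by (simp add: a_def)
  next
    case False
    \<comment> \<open>As \<open>n t = 2 s\<close>, a radius beyond \<open>l\<close> means
      \<open>X powr (- t) \<le> l powr (- 2 * s)\<close>, which is exactly the weight of the second
      term.\<close>
    then have "l ^ CARD('n) < X" using l by (simp flip: \<rho>n add: power_strict_mono)
    then have "X powr (- t) \<le> (l powr ?n) powr (- t)"
      using X l t0 by (intro powr_mono2') (auto simp: powr_realpow)
    also have "\<dots> = l powr (- 2 * s)" by (simp add: powr_powr t)
    finally have Xt: "X powr (- t) \<le> l powr (- 2 * s)" .
    have "a powr (2 + 2 * t) = (a\<^sup>2) powr t * a\<^sup>2"
      unfolding apow using a by (simp add: powr_add)
    also have "(a\<^sup>2) powr t = ?C2 * N powr t * X powr (- t)"
      by (rule aXr)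
    also have "?C2 * N powr t * X powr (- t) * a\<^sup>2 \<le> ?C2 * N powr t * (l powr (- 2 * s) * a\<^sup>2)"
      using Xt by (auto intro!: mult_left_mono mult_right_mono simp: mult.assoc)
    finally have "ennreal (a powr (2 + 2 * t)) \<le> ennreal (?C2 * N powr t) * ennreal (l powr (- 2 * s) * a\<^sup>2)"
      by (subst ennreal_mult[symmetric]) (auto intro: ennreal_leI)
    also have "\<dots> \<le> ennreal ((?C1 + ?C2) * N powr t) * (?I + ennreal (l powr (- 2 * s) * a\<^sup>2))"
      by (intro mult_mono ennreal_leI mult_right_mono) auto
    finally show ?thesis by (simp add: a_def)
  qed
qed

text \<open>Integrate \<open>nash_pointwise\<close> over \<Omega>; the double integral that arises
  runs over pairs of points of \<Omega> and is thus part of the Gagliardo form. Since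
  \<open>v\<close> is only Lebesgue measurable, the iterated integrals are formed with a Borel
  representative \<open>w\<close>.\<close>

lemma nash_inequality:
  fixes \<Omega> :: "(real ^ 'n) set" and v :: "real ^ 'n \<Rightarrow> real"
  assumes s: "0 < s" and O: "open \<Omega>" and v: "v \<in> Hs_space s \<Omega>"
    and c: "0 < c" and l: "0 < l"
    and dens: "\<And>x \<rho>. x \<in> \<Omega> \<Longrightarrow> 0 < \<rho> \<Longrightarrow> \<rho> \<le> l \<Longrightarrow> c * \<rho> ^ CARD('n) \<le> measure lebesgue (\<Omega> \<inter> ball x \<rho>)"
    and t: "t = 2 * s / real CARD('n)"
  defines "N \<equiv> LINT x:\<Omega>|lebesgue. (v x)\<^sup>2"
  shows "set_integrable lebesgue \<Omega> (\<lambda>x. \<bar>v x\<bar> powr (2 + 2 * t))"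
    and "(LINT x:\<Omega>|lebesgue. \<bar>v x\<bar> powr (2 + 2 * t)) \<le> ((8 / c) powr (1 + t) + (8 / c) powr t) * N powr t *
      (gagliardo_form s \<Omega> v v + l powr (- 2 * s) * N)"
proof -
  let ?a = "real CARD('n) + 2 * s"
  define C where "C = ((8 / c) powr (1 + t) + (8 / c) powr t) * N powr t"
  have C0: "C \<ge> 0" by (simp add: C_def)
  define R where "R = C * (gagliardo_form s \<Omega> v v + l powr (- 2 * s) * N)"
  have mO[measurable]: "\<Omega> \<in> sets borel" using O by simp
  have mO': "\<Omega> \<in> sets lebesgue" using O by simp
  note vD = Hs_spaceD[OF v]
  have N0: "N \<ge> 0" unfolding N_def by (intro set_lebesgue_integral_nonneg) auto
  have R0: "R \<ge> 0" unfolding R_def by (intro mult_nonneg_nonneg add_nonneg_nonneg C0 N0 gagliardo_form_nonneg) auto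
  obtain w where w[measurable]: "w \<in> borel_measurable borel" and vw: "AE x in lborel. v x = w x"
    using completion_ex_borel_measurable_real[OF vD(1)] by auto
  have Nw: "(\<integral>\<^sup>+ y. ennreal ((w y)\<^sup>2) * indicator \<Omega> y \<partial>lborel) = ennreal N"
  proof -
    have "(\<integral>\<^sup>+ y. ennreal ((w y)\<^sup>2) * indicator \<Omega> y \<partial>lborel) = (\<integral>\<^sup>+ y. ennreal (indicator \<Omega> y *\<^sub>R (v y)\<^sup>2) \<partial>lborel)"
      using vw by (intro nn_integral_cong_AE) (auto elim!: eventually_mono simp: indicator_def)
    also have "\<dots> = (\<integral>\<^sup>+ y. ennreal (indicator \<Omega> y *\<^sub>R (v y)\<^sup>2) \<partial>lebesgue)"
      by (simp add: nn_integral_completion)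
    also have "\<dots> = ennreal N"
      using vD(2) unfolding N_def set_lebesgue_integral_def set_integrable_def
      by (intro nn_integral_eq_integral) auto
    finally show ?thesis .
  qed
  have Gw: "(\<integral>\<^sup>+ x. (\<integral>\<^sup>+ y. ennreal ((w x - w y)\<^sup>2 / norm (x - y) powr ?a) * indicator \<Omega> y \<partial>lborel) * indicator \<Omega> x \<partial>lborel)
      \<le> ennreal (gagliardo_form s \<Omega> v v)"
  proof -
    let ?f = "\<lambda>z. ennreal ((w (fst z) - w (snd z))\<^sup>2 / norm (fst z - snd z) powr ?a) * indicator \<Omega> (snd z) * indicator \<Omega> (fst z)"
    have mf: "?f \<in> borel_measurable (lborel \<Otimes>\<^sub>M lborel)" by measurable
    have "(\<integral>\<^sup>+ x. (\<integral>\<^sup>+ y. ennreal ((w x - w y)\<^sup>2 / norm (x - y) powr ?a) * indicator \<Omega> y \<partial>lborel) * indicator \<Omega> x \<partial>lborel)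
       = (\<integral>\<^sup>+ x. (\<integral>\<^sup>+ y. ?f (x, y) \<partial>lborel) \<partial>lborel)"
      by (intro nn_integral_cong) (simp add: nn_integral_multc)
    also have "\<dots> = (\<integral>\<^sup>+ z. ?f z \<partial>(lborel \<Otimes>\<^sub>M lborel))"
      using lborel.nn_integral_fst[OF mf] by simp
    also have "\<dots> = (\<integral>\<^sup>+ z. ?f z \<partial>lborel)" by (simp add: lborel_prod)
    also have "\<dots> \<le> (\<integral>\<^sup>+ z. ennreal (indicator (cross_domain \<Omega>) z *\<^sub>R gagliardo_integrand s v v z) \<partial>lborel)"
    proof (rule nn_integral_mono_AE, rule eventually_mono[OF AE_lborel_pair[OF vw]])
      fix z assume "v (fst z) = w (fst z) \<and> v (snd z) = w (snd z)"
      then show "?f z \<le> ennreal (indicator (cross_domain \<Omega>) z *\<^sub>R gagliardo_integrand s v v z)"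
        by (auto simp: indicator_def cross_domain_def gagliardo_integrand_def split_beta power2_eq_square)
    qed
    also have "\<dots> = (\<integral>\<^sup>+ z. ennreal (indicator (cross_domain \<Omega>) z *\<^sub>R gagliardo_integrand s v v z) \<partial>lebesgue)"
      by (simp add: nn_integral_completion)
    also have "\<dots> = ennreal (gagliardo_form s \<Omega> v v)"
      using vD(3) unfolding gagliardo_form_def set_lebesgue_integral_def set_integrable_def
      by (intro nn_integral_eq_integral) (auto simp: gagliardo_integrand_nonneg)
    finally show ?thesis .
  qed
  have main: "(\<integral>\<^sup>+ x. ennreal (\<bar>w x\<bar> powr (2 + 2 * t)) * indicator \<Omega> x \<partial>lborel) \<le> ennreal R"
  \<comment> \<open>For \<open>N = 0\<close> the radius in the pointwise estimate degenerates, but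
    then \<open>w\<close> vanishes almost everywhere on \<Omega>.\<close>
  proof (cases "N = 0")
    case True
    then have "(\<integral>\<^sup>+ y. ennreal ((w y)\<^sup>2) * indicator \<Omega> y \<partial>lborel) = 0" using Nw by simp
    then have "AE y in lborel. ennreal ((w y)\<^sup>2) * indicator \<Omega> y = 0"
      by (subst (asm) nn_integral_0_iff_AE) auto
    then have "AE y in lborel. ennreal (\<bar>w y\<bar> powr (2 + 2 * t)) * indicator \<Omega> y = 0"
      by (auto elim!: eventually_mono simp: indicator_def split: if_splits)
    then have "(\<integral>\<^sup>+ x. ennreal (\<bar>w x\<bar> powr (2 + 2 * t)) * indicator \<Omega> x \<partial>lborel) = 0"
      by (subst nn_integral_0_iff_AE) auto
    then show ?thesis by simp
  next
    case False
    then have Np: "N > 0" using N0 by simp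
    let ?J = "\<lambda>x. (\<integral>\<^sup>+ y. ennreal ((w x - w y)\<^sup>2 / norm (x - y) powr ?a) * indicator \<Omega> y \<partial>lborel)"
    have [measurable]: "?J \<in> borel_measurable borel"
    proof -
      have "(\<lambda>x. \<integral>\<^sup>+ y. (\<lambda>(x, y). ennreal ((w x - w y)\<^sup>2 / norm (x - y) powr ?a) * indicator \<Omega> y) (x, y) \<partial>lborel) \<in> borel_measurable lborel"
        by (rule lborel.borel_measurable_nn_integral_fst) measurable
      then show ?thesis by simp
    qed
    have "(\<integral>\<^sup>+ x. ennreal (\<bar>w x\<bar> powr (2 + 2 * t)) * indicator \<Omega> x \<partial>lborel)
      \<le> (\<integral>\<^sup>+ x. ennreal C * (?J x * indicator \<Omega> x + ennreal (l powr (- 2 * s)) * (ennreal ((w x)\<^sup>2) * indicator \<Omega> x)) \<partial>lborel)"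
    proof (rule nn_integral_mono)
      fix x
      show "ennreal (\<bar>w x\<bar> powr (2 + 2 * t)) * indicator \<Omega> x
        \<le> ennreal C * (?J x * indicator \<Omega> x + ennreal (l powr (- 2 * s)) * (ennreal ((w x)\<^sup>2) * indicator \<Omega> x))"
      proof (cases "x \<in> \<Omega>")
        case x: True
        have Nle: "(\<integral>\<^sup>+ y. ennreal ((w y)\<^sup>2) * indicator \<Omega> y \<partial>lborel) \<le> ennreal N" using Nw by simp
        show ?thesis
          using nash_pointwise[OF s O w c l dens Np Nle x t] x by (simp add: C_def ennreal_mult)
      qed simp
    qed
    also have "\<dots> = ennreal C * ((\<integral>\<^sup>+ x. ?J x * indicator \<Omega> x \<partial>lborel) + ennreal (l powr (- 2 * s)) * (\<integral>\<^sup>+ x. ennreal ((w x)\<^sup>2) * indicator \<Omega> x \<partial>lborel))"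
      by (simp add: nn_integral_cmult nn_integral_add)
    also have "\<dots> \<le> ennreal C * (ennreal (gagliardo_form s \<Omega> v v) + ennreal (l powr (- 2 * s)) * ennreal N)"
      unfolding Nw by (intro mult_left_mono add_right_mono Gw) auto
    also have "\<dots> = ennreal R"
      using C0 N0 gagliardo_form_nonneg[of s \<Omega> v] by (simp add: R_def ennreal_mult[symmetric] ennreal_plus[symmetric] del: ennreal_plus)
    finally show ?thesis .
  qed
  have nn: "(\<integral>\<^sup>+ x. ennreal (indicator \<Omega> x *\<^sub>R \<bar>v x\<bar> powr (2 + 2 * t)) \<partial>lebesgue) \<le> ennreal R"
  proof -
    have "(\<integral>\<^sup>+ x. ennreal (indicator \<Omega> x *\<^sub>R \<bar>v x\<bar> powr (2 + 2 * t)) \<partial>lebesgue)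
      = (\<integral>\<^sup>+ x. ennreal (indicator \<Omega> x *\<^sub>R \<bar>v x\<bar> powr (2 + 2 * t)) \<partial>lborel)"
      by (simp add: nn_integral_completion)
    also have "\<dots> = (\<integral>\<^sup>+ x. ennreal (\<bar>w x\<bar> powr (2 + 2 * t)) * indicator \<Omega> x \<partial>lborel)"
      using vw by (intro nn_integral_cong_AE) (auto elim!: eventually_mono simp: indicator_def)
    finally show ?thesis using main by simp
  qed
  have m: "(\<lambda>x. indicator \<Omega> x *\<^sub>R \<bar>v x\<bar> powr (2 + 2 * t)) \<in> borel_measurable lebesgue"
    using vD(1) mO' by measurable
  show i: "set_integrable lebesgue \<Omega> (\<lambda>x. \<bar>v x\<bar> powr (2 + 2 * t))"
    unfolding set_integrable_def using m nn by (intro integrableI_nonneg) (auto intro: le_less_trans)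
  have "ennreal (LINT x:\<Omega>|lebesgue. \<bar>v x\<bar> powr (2 + 2 * t)) \<le> ennreal R"
    using nn i unfolding set_lebesgue_integral_def set_integrable_def
    by (subst nn_integral_eq_integral[symmetric]) auto
  then have "(LINT x:\<Omega>|lebesgue. \<bar>v x\<bar> powr (2 + 2 * t)) \<le> R" using R0 by simp
  then show "(LINT x:\<Omega>|lebesgue. \<bar>v x\<bar> powr (2 + 2 * t)) \<le> ((8 / c) powr (1 + t) + (8 / c) powr t) * N powr t *
      (gagliardo_form s \<Omega> v v + l powr (- 2 * s) * N)"
    by (simp add: R_def C_def)
qed

subsection \<open>Mountain-pass value\<close>

lemma gagliardo_form_scale:
  "gagliardo_form s \<Omega> (\<lambda>x. c * u x) (\<lambda>x. c * u x) = c\<^sup>2 * gagliardo_form s \<Omega> u u"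
proof -
  have "gagliardo_integrand s (\<lambda>x. c * u x) (\<lambda>x. c * u x) = (\<lambda>z. c\<^sup>2 * gagliardo_integrand s u u z)"
    by (rule ext) (simp add: gagliardo_integrand_def split_beta power2_eq_square right_diff_distrib[symmetric] mult_ac)
  then show ?thesis
    unfolding gagliardo_form_def by simp
qed

lemma energy_scale:
  fixes u :: "real ^ 'n \<Rightarrow> real"
  assumes "0 \<le> t"
  shows "energy s p \<Omega> d (\<lambda>x. t * u x) =
    t\<^sup>2 / 2 * (d * frac_const TYPE('n) s / 2 * gagliardo_form s \<Omega> u u + (LINT x:\<Omega>|lebesgue. (u x)\<^sup>2))
     - t powr (p + 1) / (p + 1) * (LINT x:\<Omega>|lebesgue. \<bar>u x\<bar> powr (p + 1))"
  using assms unfolding energy_def gagliardo_form_scale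
  by (simp add: power_mult_distrib abs_mult powr_mult algebra_simps add_divide_distrib)

lemma set_integral_pos:
  fixes f :: "'a::euclidean_space \<Rightarrow> real"
  assumes O: "open \<Omega>" "\<Omega> \<noteq> {}" and i: "set_integrable lebesgue \<Omega> f"
    and pos: "AE x in lebesgue. x \<in> \<Omega> \<longrightarrow> 0 < f x"
  shows "0 < (LINT x:\<Omega>|lebesgue. f x)"
proof -
  have nn: "AE x in lebesgue. 0 \<le> indicator \<Omega> x *\<^sub>R f x"
    using pos by eventually_elim (auto simp: indicator_def)
  then have ge: "0 \<le> (LINT x:\<Omega>|lebesgue. f x)"
    unfolding set_lebesgue_integral_def by (rule integral_nonneg_AE)
  have "(LINT x:\<Omega>|lebesgue. f x) \<noteq> 0"
  proof
    assume "(LINT x:\<Omega>|lebesgue. f x) = 0"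
    then have "AE x in lebesgue. indicator \<Omega> x *\<^sub>R f x = 0"
      using integral_nonneg_eq_0_iff_AE[OF i[unfolded set_integrable_def] nn]
      by (simp add: set_lebesgue_integral_def)
    with pos have "AE x in lebesgue. x \<notin> \<Omega>"
      by eventually_elim (auto simp: indicator_def)
    then have "\<Omega> \<in> null_sets lebesgue"
      using O(1) by (subst AE_iff_null_sets) auto
    then have "negligible \<Omega>" by (simp add: negligible_iff_null_sets)
    then show False using open_not_negligible[OF O] by simp
  qed
  with ge show ?thesis by simp
qed

lemma quadratic_minus_power_bound:
  fixes A B t p :: real
  assumes "0 < A" "0 < B" "0 \<le> t" "1 < p"
  shows "A * t\<^sup>2 - B * t powr (p + 1) \<le> A * (A / B) powr (2 / (p - 1))"
proof (cases "t = 0 \<or> A / B \<le> t powr (p - 1)")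
  case True
  have "A * t\<^sup>2 - B * t powr (p + 1) \<le> 0"
  proof (cases "t = 0")
    case False
    then have t: "t > 0" and "A \<le> B * t powr (p - 1)" using True assms by (auto simp: field_simps)
    then have "A * t\<^sup>2 \<le> B * t powr (p - 1) * t\<^sup>2" by (intro mult_right_mono) auto
    also have "\<dots> = B * t powr (p + 1)"
      using t by (simp add: mult.assoc powr_add[symmetric] add.commute flip: powr_numeral)
    finally show ?thesis by simp
  qed (use assms in simp)
  also have "0 \<le> A * (A / B) powr (2 / (p - 1))" using assms by simp
  finally show ?thesis .
next
  case False
  then have t: "t > 0" and lt: "t powr (p - 1) < A / B" using assms by auto
  have "t\<^sup>2 = (t powr (p - 1)) powr (2 / (p - 1))"
  proof -
    have "(p - 1) * (2 / (p - 1)) = 2" using assms(4) by (simp add: field_simps)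
    then show ?thesis using t by (simp only: powr_powr) simp
  qed
  also have "\<dots> \<le> (A / B) powr (2 / (p - 1))"
    using lt assms by (intro powr_mono2) auto
  finally have "A * t\<^sup>2 \<le> A * (A / B) powr (2 / (p - 1))" using assms by (intro mult_left_mono) auto
  moreover have "0 \<le> B * t powr (p + 1)" using assms by simp
  ultimately show ?thesis by linarith
qed

text \<open>
  The path-wise suprema are bounded below by the energy \<open>0\<close> at the start of the path, except on
  paths along which the energy is unbounded above, where \<open>Sup\<close> has the junk value
  \<open>LEAST z. False\<close>.
\<close>

lemma mountain_pass_value_bdd_below:
  "bdd_below ((\<lambda>\<gamma>. SUP t\<in>{0..1}. energy s p \<Omega> d (\<gamma> t)) ` Hs_paths s \<Omega> e)"
proof (rule bdd_belowI2)
  fix \<gamma> assume \<gamma>: "\<gamma> \<in> Hs_paths s \<Omega> e"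
  let ?S = "(\<lambda>t. energy s p \<Omega> d (\<gamma> t)) ` {0..1}"
  have z: "energy s p \<Omega> d (\<gamma> 0) = 0"
    using \<gamma> by (simp add: Hs_paths_def energy_def gagliardo_form_const)
  show "min 0 (LEAST z :: real. False) \<le> (SUP t\<in>{0..1}. energy s p \<Omega> d (\<gamma> t))"
  proof (cases "bdd_above ?S")
    case True
    have "energy s p \<Omega> d (\<gamma> 0) \<le> (SUP t\<in>{0..1}. energy s p \<Omega> d (\<gamma> t))"
      by (rule cSUP_upper[OF _ True]) simp
    then show ?thesis using z by simp
  next
    case False
    then have "(\<lambda>z. \<forall>x\<in>?S. x \<le> z) = (\<lambda>z. False)"
      by (auto simp: bdd_above_def fun_eq_iff)
    then have "Sup ?S = (LEAST z :: real. False)"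
      unfolding Sup_real_def by simp
    then show ?thesis by simp
  qed
qed

text \<open>
  The competing path consists of the segments from \<open>0\<close> to \<open>T \<phi>\<close>, from \<open>T \<phi>\<close> to \<open>T e\<close> and from
  \<open>T e\<close> to \<open>e\<close>.  For large \<open>T\<close> the energy is nonpositive on the second one, and it is
  nonpositive on the ray beyond \<open>e\<close>.
\<close>

lemma mountain_pass_value_le:
  fixes \<Omega> :: "(real ^ 'n) set"
  assumes O: "open \<Omega>" "\<Omega> \<noteq> {}" and p: "1 < p" and d: "0 \<le> d" and fc: "0 \<le> frac_const TYPE('n) s"
    and int: "\<And>w. w \<in> Hs_space s \<Omega> \<Longrightarrow> set_integrable lebesgue \<Omega> (\<lambda>x. \<bar>w x\<bar> powr (p + 1))"
    and \<phi>: "\<phi> \<in> Hs_space s \<Omega>" "\<And>x. 0 \<le> \<phi> x" "0 < (LINT x:\<Omega>|lebesgue. \<bar>\<phi> x\<bar> powr (p + 1))"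
    and e: "mountain_pass_endpoint s p \<Omega> d e"
    and M: "0 \<le> M" "\<And>t. 0 \<le> t \<Longrightarrow> energy s p \<Omega> d (\<lambda>x. t * \<phi> x) \<le> M"
  shows "mountain_pass_value s p \<Omega> d e \<le> M"
proof -
  have OL: "\<Omega> \<in> sets lebesgue" using O by simp
  have eH: "e \<in> Hs_space s \<Omega>" and epos: "AE x in lebesgue. 0 < e x" and e0: "energy s p \<Omega> d e = 0"
    using e by (auto simp: mountain_pass_endpoint_def)
  define c where "c = d * frac_const TYPE('n) s / 2"
  have c: "0 \<le> c" using d fc by (simp add: c_def)
  define Q where "Q w = c * gagliardo_form s \<Omega> w w + (LINT x:\<Omega>|lebesgue. (w x)\<^sup>2)" for w
  define P where "P w = (LINT x:\<Omega>|lebesgue. \<bar>w x\<bar> powr (p + 1))" for w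
  have energy: "energy s p \<Omega> d w = Q w / 2 - P w / (p + 1)" for w
    by (simp add: energy_def Q_def P_def c_def)
  have energy_sc: "energy s p \<Omega> d (\<lambda>x. t * w x) = t\<^sup>2 / 2 * Q w - t powr (p + 1) / (p + 1) * P w" if "0 \<le> t" for t w
    using energy_scale[OF that] by (simp add: Q_def P_def c_def)
  have Q0: "0 \<le> Q w" for w
    unfolding Q_def by (intro add_nonneg_nonneg mult_nonneg_nonneg c gagliardo_form_nonneg set_lebesgue_integral_nonneg) auto
  have Qcomb: "Q (\<lambda>x. a * \<phi> x + b * e x) \<le> 2 * a\<^sup>2 * Q \<phi> + 2 * b\<^sup>2 * Q e" for a b
  proof -
    have "c * gagliardo_form s \<Omega> (\<lambda>x. a * \<phi> x + b * e x) (\<lambda>x. a * \<phi> x + b * e x)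
        \<le> c * (2 * a\<^sup>2 * gagliardo_form s \<Omega> \<phi> \<phi> + 2 * b\<^sup>2 * gagliardo_form s \<Omega> e e)"
      using Hs_lincomb(3)[OF OL \<phi>(1) eH] c by (rule mult_left_mono)
    then show ?thesis
      unfolding Q_def using Hs_lincomb(2)[OF OL \<phi>(1) eH, of a b] by (simp add: algebra_simps)
  qed
  have Pe: "0 < P e"
    unfolding P_def using epos by (intro set_integral_pos O int eH) (auto elim!: eventually_mono)
  have P\<phi>: "0 < P \<phi>" using \<phi>(3) by (simp add: P_def)
  define m where "m = min (P \<phi>) (P e)"
  have m: "0 < m" using Pe P\<phi> by (simp add: m_def)
  \<comment> \<open>One of \<open>a\<close> and \<open>b\<close> is at least \<open>T / 2\<close>.
    As \<open>\<phi>\<close> and \<open>e\<close> are nonnegative, the combination dominates that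
    single multiple, so no cancellation can make its power integral small.\<close>
  have Pcomb: "(T / 2) powr (p + 1) * m \<le> P (\<lambda>x. a * \<phi> x + b * e x)"
    if ab: "0 \<le> a" "0 \<le> b" "a + b = T" for a b T
  proof -
    have mono: "c powr (p + 1) * P w \<le> P (\<lambda>x. a * \<phi> x + b * e x)"
      if w: "w \<in> Hs_space s \<Omega>" and cw: "0 \<le> c" "AE x in lebesgue. 0 \<le> w x \<and> c * w x \<le> a * \<phi> x + b * e x" for c w
    proof -
      have "c powr (p + 1) * P w = (LINT x:\<Omega>|lebesgue. c powr (p + 1) * \<bar>w x\<bar> powr (p + 1))"
        unfolding P_def by simp
      also have "\<dots> \<le> P (\<lambda>x. a * \<phi> x + b * e x)"
        unfolding P_def
      proof (rule set_integral_mono_AE)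
        show "set_integrable lebesgue \<Omega> (\<lambda>x. c powr (p + 1) * \<bar>w x\<bar> powr (p + 1))"
          using int[OF w] by (intro set_integrable_mult_right) auto
        show "set_integrable lebesgue \<Omega> (\<lambda>x. \<bar>a * \<phi> x + b * e x\<bar> powr (p + 1))"
          by (intro int Hs_lincomb OL \<phi>(1) eH)
        show "AE x\<in>\<Omega> in lebesgue. c powr (p + 1) * \<bar>w x\<bar> powr (p + 1) \<le> \<bar>a * \<phi> x + b * e x\<bar> powr (p + 1)"
          using cw(2)
        proof eventually_elim
          case (elim x)
          have "c powr (p + 1) * \<bar>w x\<bar> powr (p + 1) = (c * w x) powr (p + 1)"
            using elim by (simp add: powr_mult)
          also have "\<dots> \<le> \<bar>a * \<phi> x + b * e x\<bar> powr (p + 1)"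
            using elim cw(1) p by (intro powr_mono2) auto
          finally show ?case by simp
        qed
      qed
      finally show ?thesis .
    qed
    show ?thesis
    proof (cases "T / 2 \<le> a")
      case True
      have "(T / 2) powr (p + 1) * m \<le> a powr (p + 1) * P \<phi>"
        using True ab p m by (intro mult_mono powr_mono2) (auto simp: m_def)
      also have "\<dots> \<le> P (\<lambda>x. a * \<phi> x + b * e x)"
        using epos ab \<phi>(2) by (intro mono \<phi>(1)) (auto elim!: eventually_mono)
      finally show ?thesis .
    next
      case False
      have "(T / 2) powr (p + 1) * m \<le> b powr (p + 1) * P e"
        using False ab p m by (intro mult_mono powr_mono2) (auto simp: m_def)
      also have "\<dots> \<le> P (\<lambda>x. a * \<phi> x + b * e x)"
        using epos ab \<phi>(2) by (intro mono eH) (auto elim!: eventually_mono)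
      finally show ?thesis .
    qed
  qed
  \<comment> \<open>Solves the requirement that the bound
    \<open>2 * T\<^sup>2 * (Q \<phi> + Q e)\<close> for the quadratic part not exceed
    \<open>2 / (p + 1)\<close> times the bound \<open>(T / 2) powr (p + 1) * m\<close> for the power
    part: this says \<open>K \<le> T powr (p - 1)\<close>. Taking also \<open>1 \<le> T\<close>
    keeps the last segment on the ray beyond \<open>e\<close>.\<close>
  define K where "K = (Q \<phi> + Q e) * (p + 1) * 2 powr (p + 1) / m"
  define T where "T = max 1 (K powr (1 / (p - 1)))"
  have T1: "1 \<le> T" by (simp add: T_def)
  have K0: "0 \<le> K" using Q0[of \<phi>] Q0[of e] p m by (simp add: K_def)
  have KT: "K \<le> T powr (p - 1)"
  proof -
    have "K = (K powr (1 / (p - 1))) powr (p - 1)" using p K0 by (simp add: powr_powr)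
    also have "\<dots> \<le> T powr (p - 1)" using p by (intro powr_mono2) (auto simp: T_def)
    finally show ?thesis .
  qed
  have middle: "energy s p \<Omega> d (\<lambda>x. a * \<phi> x + b * e x) \<le> 0"
    if ab: "0 \<le> a" "0 \<le> b" "a + b = T" for a b
  proof -
    have sq: "a\<^sup>2 \<le> T\<^sup>2" "b\<^sup>2 \<le> T\<^sup>2" using ab by (auto intro!: power_mono)
    have "Q (\<lambda>x. a * \<phi> x + b * e x) \<le> 2 * a\<^sup>2 * Q \<phi> + 2 * b\<^sup>2 * Q e" by (rule Qcomb)
    also have "\<dots> \<le> 2 * T\<^sup>2 * Q \<phi> + 2 * T\<^sup>2 * Q e"
      using sq Q0[of \<phi>] Q0[of e] by (intro add_mono mult_right_mono) auto
    also have "\<dots> = 2 * T\<^sup>2 * (K * m / ((p + 1) * 2 powr (p + 1)))"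
    proof -
      have "K * m / ((p + 1) * 2 powr (p + 1)) = Q \<phi> + Q e"
        using m p by (simp add: K_def)
      then show ?thesis by (simp add: algebra_simps)
    qed
    also have "\<dots> \<le> 2 * T\<^sup>2 * (T powr (p - 1) * m / ((p + 1) * 2 powr (p + 1)))"
      using KT m p by (intro mult_left_mono divide_right_mono mult_right_mono) auto
    also have "\<dots> = 2 / (p + 1) * ((T powr 2 * T powr (p - 1)) / 2 powr (p + 1) * m)"
      using T1 by (simp add: field_simps)
    also have "T powr 2 * T powr (p - 1) / 2 powr (p + 1) = (T / 2) powr (p + 1)"
    proof -
      have "T powr 2 * T powr (p - 1) = T powr (p + 1)"
        by (subst powr_add[symmetric]) (simp add: algebra_simps)
      then show ?thesis by (simp only: powr_divide)
    qed
    also have "2 / (p + 1) * ((T / 2) powr (p + 1) * m) \<le> 2 / (p + 1) * P (\<lambda>x. a * \<phi> x + b * e x)"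
      using Pcomb[OF ab] p by (intro mult_left_mono) auto
    finally show ?thesis by (simp add: energy mult.commute)
  qed
  \<comment> \<open>Zero energy means that the quadratic and the power part of \<open>e\<close> are
    equal; scaling by \<open>b \<ge> 1\<close> increases the power part at least as much.\<close>
  have last: "energy s p \<Omega> d (\<lambda>x. b * e x) \<le> 0" if b: "1 \<le> b" for b
  proof -
    have "b\<^sup>2 \<le> b powr (p + 1)" using b p powr_mono[of 2 "p + 1" b] by simp
    moreover have "0 \<le> Q e / 2" using Q0[of e] by simp
    ultimately have "b\<^sup>2 * (Q e / 2) \<le> b powr (p + 1) * (Q e / 2)" by (rule mult_right_mono)
    moreover have Qe: "Q e / 2 = P e / (p + 1)" using e0 unfolding energy by linarith
    ultimately have "b\<^sup>2 * (Q e / 2) \<le> b powr (p + 1) * (P e / (p + 1))" by (simp only: Qe)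
    then show ?thesis using b by (simp add: energy_sc)
  qed
  \<comment> \<open>Each segment takes a third of the unit interval. Writing the coefficients as
    maxima and minima of affine functions makes continuity immediate, without gluing.\<close>
  define \<alpha> where "\<alpha> t = T * max 0 (min (3 * t) (2 - 3 * t))" for t :: real
  define \<beta> where "\<beta> t = max 0 (min (T * (3 * t - 1)) (T + (1 - T) * (3 * t - 2)))" for t :: real
  define \<gamma> where "\<gamma> t = (\<lambda>x. \<alpha> t * \<phi> x + \<beta> t * e x)" for t
  have \<gamma>H: "\<gamma> t \<in> Hs_space s \<Omega>" for t
    unfolding \<gamma>_def by (intro Hs_lincomb OL \<phi>(1) eH)
  have \<alpha>lim: "(\<alpha> \<longlongrightarrow> \<alpha> t) (at t within S)" and \<beta>lim: "(\<beta> \<longlongrightarrow> \<beta> t) (at t within S)" for t S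
    unfolding \<alpha>_def \<beta>_def by (intro tendsto_intros)+
  define n2 where "n2 w = (LINT x:\<Omega>|lebesgue. (w x)\<^sup>2) + gagliardo_form s \<Omega> w w" for w
  have path_lim: "((\<lambda>t'. Hs_norm s \<Omega> (\<lambda>x. \<gamma> t' x - \<gamma> t x)) \<longlongrightarrow> 0) (at t within S)" for t S
  proof -
    let ?u = "\<lambda>t'. sqrt (2 * (\<alpha> t' - \<alpha> t)\<^sup>2 * n2 \<phi> + 2 * (\<beta> t' - \<beta> t)\<^sup>2 * n2 e)"
    show ?thesis
    proof (rule tendsto_sandwich[of "\<lambda>_. 0" _ _ ?u])
      have "(?u \<longlongrightarrow> sqrt (2 * (\<alpha> t - \<alpha> t)\<^sup>2 * n2 \<phi> + 2 * (\<beta> t - \<beta> t)\<^sup>2 * n2 e)) (at t within S)"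
        by (intro tendsto_intros \<alpha>lim \<beta>lim)
      then show "(?u \<longlongrightarrow> 0) (at t within S)" by simp
      show "((\<lambda>_. 0) \<longlongrightarrow> (0::real)) (at t within S)" by simp
      show "\<forall>\<^sub>F t' in at t within S. 0 \<le> Hs_norm s \<Omega> (\<lambda>x. \<gamma> t' x - \<gamma> t x)"
        unfolding Hs_norm_def
        by (intro always_eventually allI real_sqrt_ge_zero add_nonneg_nonneg gagliardo_form_nonneg set_lebesgue_integral_nonneg) auto
      show "\<forall>\<^sub>F t' in at t within S. Hs_norm s \<Omega> (\<lambda>x. \<gamma> t' x - \<gamma> t x) \<le> ?u t'"
      proof (intro always_eventually allI)
        fix t'
        have eq: "(\<lambda>x. \<gamma> t' x - \<gamma> t x) = (\<lambda>x. (\<alpha> t' - \<alpha> t) * \<phi> x + (\<beta> t' - \<beta> t) * e x)"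
          by (simp add: \<gamma>_def algebra_simps)
        show "Hs_norm s \<Omega> (\<lambda>x. \<gamma> t' x - \<gamma> t x) \<le> ?u t'"
          unfolding eq Hs_norm_def n2_def
          using Hs_lincomb(2,3)[OF OL \<phi>(1) eH, of "\<alpha> t' - \<alpha> t" "\<beta> t' - \<beta> t"]
          by (intro real_sqrt_le_mono) (simp add: algebra_simps)
      qed
    qed
  qed
  have "\<gamma> 0 = (\<lambda>x. 0)" "\<gamma> 1 = e"
    using T1 by (auto simp: \<gamma>_def \<alpha>_def \<beta>_def)
  then have path: "\<gamma> \<in> Hs_paths s \<Omega> e"
    using \<gamma>H path_lim by (simp add: Hs_paths_def)
  have le: "energy s p \<Omega> d (\<gamma> t) \<le> M" if t: "t \<in> {0..1}" for t
  proof -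
    consider "t \<le> 1 / 3" | "1 / 3 \<le> t" "t \<le> 2 / 3" | "2 / 3 \<le> t" by linarith
    then show ?thesis
    proof cases
      case 1
      have "T * (3 * t - 1) \<le> 0" using 1 T1 by (intro mult_nonneg_nonpos) auto
      then have "\<beta> t = 0" by (simp add: \<beta>_def)
      moreover have "0 \<le> \<alpha> t" using T1 by (simp add: \<alpha>_def)
      ultimately show ?thesis using M(2) by (simp add: \<gamma>_def)
    next
      case 2
      have "0 \<le> T * (3 * t - 1)" using 2 T1 by (intro mult_nonneg_nonneg) auto
      moreover have "T * (3 * t - 1) \<le> T * 1" using 2 T1 by (intro mult_left_mono) auto
      moreover have "0 \<le> (1 - T) * (3 * t - 2)" using 2 T1 by (intro mult_nonpos_nonpos) auto
      ultimately have b: "\<beta> t = T * (3 * t - 1)" by (simp add: \<beta>_def)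
      have a: "\<alpha> t = T * (2 - 3 * t)" using 2 by (simp add: \<alpha>_def min_def)
      have "energy s p \<Omega> d (\<gamma> t) \<le> 0"
        unfolding \<gamma>_def using 2 T1 by (intro middle) (auto simp: a b algebra_simps)
      then show ?thesis using M(1) by simp
    next
      case 3
      have "T * 1 \<le> T * (3 * t - 1)" using 3 T1 by (intro mult_left_mono) auto
      then have "1 \<le> T * (3 * t - 1)" using T1 by linarith
      moreover have "(1 - T) * 1 \<le> (1 - T) * (3 * t - 2)" using t T1 by (intro mult_left_mono_neg) auto
      then have "1 \<le> T + (1 - T) * (3 * t - 2)" unfolding mult_1_right by linarith
      ultimately have b: "1 \<le> \<beta> t" by (simp add: \<beta>_def le_max_iff_disj)
      have "\<alpha> t = 0" using 3 by (simp add: \<alpha>_def)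
      then show ?thesis using last[OF b] M(1) by (simp add: \<gamma>_def)
    qed
  qed
  have "mountain_pass_value s p \<Omega> d e \<le> (SUP t\<in>{0..1}. energy s p \<Omega> d (\<gamma> t))"
    unfolding mountain_pass_value_def by (rule cINF_lower[OF mountain_pass_value_bdd_below path])
  also have "\<dots> \<le> M" using le by (intro cSUP_least) auto
  finally show ?thesis .
qed

subsection \<open>Truncated powers\<close>

text \<open>The cut at \<open>M\<close> makes powers of order at least 1 Lipschitz, so that they map
  the energy space into itself and yield admissible test functions. The cut at 0 covers points
  outside \<Omega>, where the sign of a solution is not prescribed.\<close>

definition trunc_powr :: "real \<Rightarrow> real \<Rightarrow> real \<Rightarrow> real" where
  "trunc_powr M r a = (max 0 (min a M)) powr r"

lemma powr_diff_le:
  fixes \<alpha> \<beta> r :: real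
  assumes "1 \<le> r" "0 \<le> \<beta>" "\<beta> \<le> \<alpha>"
  shows "\<alpha> powr r - \<beta> powr r \<le> r * \<alpha> powr (r - 1) * (\<alpha> - \<beta>)"
proof -
  \<comment> \<open>The derivative of \<open>powr\<close> is available at positive arguments, so the
    mean value theorem is applied for \<open>\<beta> > 0\<close> and the endpoint 0 is treated
    apart.\<close>
  consider "\<beta> = \<alpha>" | "\<beta> = 0" "0 < \<alpha>" | "0 < \<beta>" "\<beta> < \<alpha>" using assms by linarith
  then show ?thesis
  proof cases
    case 2
    have "\<alpha> powr r = \<alpha> powr (r - 1) * \<alpha>"
      using 2 powr_add[of \<alpha> "r - 1" 1] by simp
    also have "\<dots> \<le> r * (\<alpha> powr (r - 1) * \<alpha>)"
      using mult_right_mono[OF assms(1), of "\<alpha> powr (r - 1) * \<alpha>"] 2 by simp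
    finally show ?thesis using 2 by simp
  next
    case 3
    have "\<exists>z>\<beta>. z < \<alpha> \<and> \<alpha> powr r - \<beta> powr r = (\<alpha> - \<beta>) * (r * z powr (r - 1))"
      using 3 by (intro MVT2 has_real_derivative_powr) auto
    then obtain z where z: "\<beta> < z" "z < \<alpha>" "\<alpha> powr r - \<beta> powr r = (\<alpha> - \<beta>) * (r * z powr (r - 1))" by blast
    have "z powr (r - 1) \<le> \<alpha> powr (r - 1)" using z 3 assms by (intro powr_mono2) auto
    then have "(\<alpha> - \<beta>) * (r * z powr (r - 1)) \<le> (\<alpha> - \<beta>) * (r * \<alpha> powr (r - 1))"
      using assms by (intro mult_left_mono) auto
    then show ?thesis using z(3) by (simp add: mult_ac)
  qed simp
qed

lemma trunc_powr_mono: "0 \<le> r \<Longrightarrow> b \<le> a \<Longrightarrow> trunc_powr M r b \<le> trunc_powr M r a"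
  unfolding trunc_powr_def by (intro powr_mono2) auto

lemma trunc_powr_nonneg: "0 \<le> trunc_powr M r a"
  by (simp add: trunc_powr_def)

lemma trunc_powr_lipschitz:
  assumes "1 \<le> r" "0 \<le> M"
  shows "\<bar>trunc_powr M r a - trunc_powr M r b\<bar> \<le> r * M powr (r - 1) * \<bar>a - b\<bar>"
proof -
  have *: "\<bar>trunc_powr M r a - trunc_powr M r b\<bar> \<le> r * M powr (r - 1) * \<bar>a - b\<bar>" if "b \<le> a" for a b
  proof -
    let ?\<alpha> = "max 0 (min a M)" and ?\<beta> = "max 0 (min b M)"
    have "trunc_powr M r a - trunc_powr M r b \<le> r * ?\<alpha> powr (r - 1) * (?\<alpha> - ?\<beta>)"
      unfolding trunc_powr_def using assms that by (intro powr_diff_le) auto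
    also have "\<dots> \<le> r * M powr (r - 1) * (a - b)"
      using assms that by (intro mult_mono powr_mono2) auto
    finally show ?thesis using that trunc_powr_mono[of r b a M] assms by simp
  qed
  show ?thesis
    using *[of a b] *[of b a] by (cases "b \<le> a") (auto simp: abs_minus_commute)
qed

text \<open>Replaces the chain rule when the equation is tested with a power of the truncated solution.\<close>

lemma trunc_powr_square_diff_le:
  assumes k: "1 \<le> k"
  shows "(trunc_powr M k a - trunc_powr M k b)\<^sup>2 \<le> k * ((a - b) * (trunc_powr M (2 * k - 1) a - trunc_powr M (2 * k - 1) b))"
proof -
  have *: "(trunc_powr M k a - trunc_powr M k b)\<^sup>2 \<le> k * ((a - b) * (trunc_powr M (2 * k - 1) a - trunc_powr M (2 * k - 1) b))"
    if "b \<le> a" for a b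
  proof -
    define \<alpha> where "\<alpha> = max 0 (min a M)"
    define \<beta> where "\<beta> = max 0 (min b M)"
    have \<alpha>\<beta>: "0 \<le> \<beta>" "\<beta> \<le> \<alpha>" "\<alpha> - \<beta> \<le> a - b" using that by (auto simp: \<alpha>_def \<beta>_def)
    have "\<beta> powr k \<le> \<alpha> powr k" using \<alpha>\<beta> k by (intro powr_mono2) auto
    \<comment> \<open>Only one of the two equal factors is estimated by the mean value bound. The
      other absorbs the weight \<open>\<alpha> powr (k - 1)\<close> and becomes a difference of
      powers of order \<open>2 * k - 1\<close>, because
      \<open>\<beta> powr (k - 1) \<le> \<alpha> powr (k - 1)\<close>.\<close>
    then have "(\<alpha> powr k - \<beta> powr k)\<^sup>2 \<le> (k * \<alpha> powr (k - 1) * (\<alpha> - \<beta>)) * (\<alpha> powr k - \<beta> powr k)"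
      unfolding power2_eq_square using powr_diff_le[OF k \<alpha>\<beta>(1,2)] by (intro mult_right_mono) auto
    also have "\<dots> = k * (\<alpha> - \<beta>) * (\<alpha> powr (k - 1) * \<alpha> powr k - \<alpha> powr (k - 1) * \<beta> powr k)"
      by (simp add: algebra_simps)
    also have "\<dots> \<le> k * (\<alpha> - \<beta>) * (\<alpha> powr (2 * k - 1) - \<beta> powr (2 * k - 1))"
    proof (intro mult_left_mono)
      have "\<beta> powr (k - 1) * \<beta> powr k \<le> \<alpha> powr (k - 1) * \<beta> powr k"
        using \<alpha>\<beta> k by (intro mult_right_mono powr_mono2) auto
      then show "\<alpha> powr (k - 1) * \<alpha> powr k - \<alpha> powr (k - 1) * \<beta> powr k \<le> \<alpha> powr (2 * k - 1) - \<beta> powr (2 * k - 1)"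
        by (simp add: powr_add[symmetric])
    qed (use \<alpha>\<beta> k in simp)
    also have "\<dots> \<le> k * (a - b) * (\<alpha> powr (2 * k - 1) - \<beta> powr (2 * k - 1))"
      using \<alpha>\<beta> k by (intro mult_right_mono mult_left_mono) (auto intro!: powr_mono2)
    finally show ?thesis by (simp add: trunc_powr_def \<alpha>_def \<beta>_def mult.assoc)
  qed
  show ?thesis
  proof (cases "b \<le> a")
    case False
    then show ?thesis using *[of a b] by (simp add: power2_commute algebra_simps)
  qed (rule *)
qed

lemma trunc_powr_measurable:
  assumes "u \<in> borel_measurable M"
  shows "(\<lambda>x. trunc_powr K r (u x)) \<in> borel_measurable M"
  using assms unfolding trunc_powr_def by measurable

lemma trunc_powr_Hs_space:
  assumes O: "\<Omega> \<in> sets lebesgue" and u: "u \<in> Hs_space s \<Omega>" and r: "1 \<le> r" and M: "0 \<le> M"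
  shows "(\<lambda>x. trunc_powr M r (u x)) \<in> Hs_space s \<Omega>"
proof -
  have 0: "trunc_powr M r 0 = 0" by (simp add: trunc_powr_def)
  have lip: "(trunc_powr M r a - trunc_powr M r b)\<^sup>2 \<le> (r * M powr (r - 1))\<^sup>2 * (a - b)\<^sup>2" for a b
    using power_mono[OF trunc_powr_lipschitz[OF r M, of a b], of 2] by (simp add: power_mult_distrib)
  show ?thesis
  proof (rule Hs_space_dominated[OF O u u, where b = 0])
    show "(\<lambda>x. trunc_powr M r (u x)) \<in> borel_measurable lebesgue"
      by (intro trunc_powr_measurable Hs_spaceD[OF u])
  qed (use lip[of _ 0] lip 0 in auto)
qed

section \<open>Embedding of the energy space in scaled form\<close>

lemma powr_le_add_powr:
  fixes x :: real
  assumes "0 \<le> x" "a \<le> r" "r \<le> b"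
  shows "x powr r \<le> x powr a + x powr b"
proof (cases "x \<le> 1")
  case True
  then have "x powr r \<le> x powr a" using assms by (cases "x = 0") (auto intro: powr_mono')
  then show ?thesis by (simp add: add_increasing2)
next
  case False
  then have "x powr r \<le> x powr b" using assms by (intro powr_mono) auto
  then show ?thesis by (simp add: add_increasing)
qed

lemma Hs_powr_integrable:
  fixes \<Omega> :: "(real ^ 'n) set"
  assumes s: "0 < s" and O: "open \<Omega>" and v: "v \<in> Hs_space s \<Omega>"
    and c: "0 < c" and l: "0 < l"
    and dens: "\<And>x \<rho>. x \<in> \<Omega> \<Longrightarrow> 0 < \<rho> \<Longrightarrow> \<rho> \<le> l \<Longrightarrow> c * \<rho> ^ CARD('n) \<le> measure lebesgue (\<Omega> \<inter> ball x \<rho>)"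
    and t: "t = 2 * s / real CARD('n)" and r: "2 \<le> r" "r \<le> 2 + 2 * t"
  shows "set_integrable lebesgue \<Omega> (\<lambda>x. \<bar>v x\<bar> powr r)"
proof (rule set_integrable_bound)
  show "set_integrable lebesgue \<Omega> (\<lambda>x. (v x)\<^sup>2 + \<bar>v x\<bar> powr (2 + 2 * t))"
    by (intro set_integral_add Hs_spaceD[OF v] nash_inequality(1)[OF s O v c l dens t])
  show "set_borel_measurable lebesgue \<Omega> (\<lambda>x. \<bar>v x\<bar> powr r)"
    using O Hs_spaceD(1)[OF v] by (intro set_borel_measurableI) auto
  have "\<bar>v x\<bar> powr r \<le> (v x)\<^sup>2 + \<bar>v x\<bar> powr (2 + 2 * t)" for x
    using powr_le_add_powr[of "\<bar>v x\<bar>" 2 r "2 + 2 * t"] r by (cases "v x = 0") auto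
  then show "AE x in lebesgue. x \<in> \<Omega> \<longrightarrow> norm (\<bar>v x\<bar> powr r) \<le> norm ((v x)\<^sup>2 + \<bar>v x\<bar> powr (2 + 2 * t))"
    by (auto intro!: AE_I2 order.trans[OF _ abs_ge_self])
qed

text \<open>With \<open>L = l ^ n\<close> one has \<open>l powr (2 * s) = L powr t\<close>, so the
  Nash bound reads \<open>N powr t * L powr (- t)\<close> times the scaled energy, up to the
  constant. Both \<open>N\<close> and the scaled energy are at most \<open>E * L\<close>, and all
  powers of \<open>L\<close> but one cancel.\<close>

lemma scaled_sobolev_inequality:
  fixes \<Omega> :: "(real ^ 'n) set"
  assumes s: "0 < s" and O: "open \<Omega>" and v: "v \<in> Hs_space s \<Omega>"
    and c: "0 < c" and l: "0 < l"
    and dens: "\<And>x \<rho>. x \<in> \<Omega> \<Longrightarrow> 0 < \<rho> \<Longrightarrow> \<rho> \<le> l \<Longrightarrow> c * \<rho> ^ CARD('n) \<le> measure lebesgue (\<Omega> \<inter> ball x \<rho>)"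
    and t: "t = 2 * s / real CARD('n)"
    and E: "l powr (2 * s) * gagliardo_form s \<Omega> v v + (LINT x:\<Omega>|lebesgue. (v x)\<^sup>2) \<le> E * l ^ CARD('n)"
  shows "(LINT x:\<Omega>|lebesgue. \<bar>v x\<bar> powr (2 + 2 * t)) \<le> ((8 / c) powr (1 + t) + (8 / c) powr t) * E powr (1 + t) * l ^ CARD('n)"
proof -
  define N where "N = (LINT x:\<Omega>|lebesgue. (v x)\<^sup>2)"
  define G where "G = gagliardo_form s \<Omega> v v"
  define L where "L = l ^ CARD('n)"
  define S where "S = (8 / c) powr (1 + t) + (8 / c) powr t"
  have S: "0 \<le> S" by (simp add: S_def)
  have L: "L > 0" using l by (simp add: L_def)
  have t0: "t > 0" using s by (simp add: t)
  have N0: "0 \<le> N" unfolding N_def by (intro set_lebesgue_integral_nonneg) auto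
  have G0: "0 \<le> G" unfolding G_def by (rule gagliardo_form_nonneg)
  have lL: "l powr (2 * s) = L powr t"
    using l by (simp add: L_def powr_realpow[symmetric] powr_powr t)
  have EL: "L powr t * G + N \<le> E * L" using E by (simp add: lL G_def N_def L_def)
  have E0: "0 \<le> E"
  proof -
    have "0 \<le> E * L" using order.trans[OF _ EL] G0 N0 by simp
    then show ?thesis using L by (simp add: zero_le_mult_iff)
  qed
  have "(LINT x:\<Omega>|lebesgue. \<bar>v x\<bar> powr (2 + 2 * t)) \<le> S * N powr t * (G + l powr (- 2 * s) * N)"
    using nash_inequality(2)[OF s O v c l dens t] by (simp add: S_def N_def G_def)
  also have "G + l powr (- 2 * s) * N = L powr (- t) * (L powr t * G + N)"
  proof -
    have "l powr (- 2 * s) = L powr (- t)" using lL by (simp add: powr_minus)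
    moreover have "L powr (- t) * L powr t = 1" using L by (simp add: powr_add[symmetric])
    ultimately show ?thesis by (simp add: algebra_simps)
  qed
  also have "S * N powr t * (L powr (- t) * (L powr t * G + N)) \<le> S * (E * L) powr t * (L powr (- t) * (E * L))"
  proof -
    have "N \<le> E * L" using EL G0 by (meson add_increasing le_add_same_cancel2 mult_nonneg_nonneg order.trans powr_ge_zero)
    then show ?thesis
      using S N0 G0 t0 EL by (intro mult_mono mult_left_mono powr_mono2) auto
  qed
  also have "\<dots> = S * (E powr t * E) * (L powr t * L powr (- t)) * L"
    by (simp add: powr_mult mult_ac)
  also have "\<dots> = S * E powr (1 + t) * L"
    using L E0 by (simp add: powr_add[symmetric]) (simp add: powr_add mult.commute)
  finally show ?thesis by (simp add: S_def L_def)
qed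

subsection \<open>Moser iteration\<close>

text \<open>Takes the place of Hoelder's inequality between moments. The free scale \<open>R\<close>
  decides which of the two terms is made small enough to be absorbed.\<close>

lemma powr_interpolation:
  fixes x R :: real
  assumes "0 \<le> x" "0 < R" "a \<le> r" "r \<le> b"
  shows "x powr r \<le> R powr (r - a) * x powr a + R powr (r - b) * x powr b"
proof -
  have "(x / R) powr r \<le> (x / R) powr a + (x / R) powr b"
    using assms by (intro powr_le_add_powr) auto
  then have "R powr r * (x / R) powr r \<le> R powr r * ((x / R) powr a + (x / R) powr b)"
    by (intro mult_left_mono) auto
  then show ?thesis
    using assms by (simp add: powr_divide powr_diff algebra_simps)
qed

text \<open>Fixes the data on which constants may depend. The diffusion coefficient is not among
  them: it enters each statement through \<open>l\<close>, so a constant obtained here before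
  \<open>l\<close> is quantified is independent of it.\<close>

locale neumann_problem =
  fixes \<Omega> :: "(real ^ 'n) set" and s p t c l0 :: real
  assumes s: "0 < s" "s < 1" and p: "1 < p" "p < 1 + 2 * t" and t: "t = 2 * s / real CARD('n)"
    and O: "open \<Omega>" "\<Omega> \<noteq> {}" "bounded \<Omega>" and c: "0 < c" and l0: "0 < l0"
    and dens: "\<And>x \<rho>. x \<in> \<Omega> \<Longrightarrow> 0 < \<rho> \<Longrightarrow> \<rho> \<le> l0 \<Longrightarrow> c * \<rho> ^ CARD('n) \<le> measure lebesgue (\<Omega> \<inter> ball x \<rho>)"
begin

definition sobolev_const :: real where "sobolev_const = (8 / c) powr (1 + t) + (8 / c) powr t"

definition \<kappa> :: real where "\<kappa> = frac_const TYPE('n) s / 2"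

text \<open>The factor by which \<open>d * \<kappa> * G + N\<close>, the left side of the tested
  equation, has to be multiplied to control \<open>d * G + N\<close>, the energy in the
  embedding.\<close>

definition energy_const :: real where "energy_const = max 1 (1 / \<kappa>)"

lemma \<kappa>: "0 < \<kappa>"
  using frac_const_pos[OF s, where 'n='n] by (simp add: \<kappa>_def)

lemma energy_const: "1 \<le> energy_const" "1 \<le> energy_const * \<kappa>"
proof -
  show "1 \<le> energy_const" by (simp add: energy_const_def)
  have "1 / \<kappa> * \<kappa> \<le> energy_const * \<kappa>" using \<kappa> by (intro mult_right_mono) (auto simp: energy_const_def)
  then show "1 \<le> energy_const * \<kappa>" using \<kappa> by simp
qed

lemma sobolev_const: "0 < sobolev_const" using c by (simp add: sobolev_const_def add_pos_pos)

lemma t_pos: "0 < t" using s by (simp add: t)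

lemma OL: "\<Omega> \<in> sets lebesgue" using O by simp

lemma Om: "\<Omega> \<in> lmeasurable" using O by (intro lmeasurable_open) auto

text \<open>Test with \<open>?F\<close>, the truncation to the power \<open>2 * k - 1\<close>. The
  left side controls the energy of \<open>?G\<close>, the truncation to the power \<open>k\<close>;
  the right side is at most the moment of order \<open>p - 1 + 2 * k\<close>. The embedding applied
  to \<open>?G\<close> then raises the order to \<open>k * (2 + 2 * t)\<close>, with a bound free of
  \<open>M\<close>.\<close>

lemma moser_truncated:
  assumes l: "0 < l" "l \<le> l0" and w: "weak_solution s p \<Omega> (l powr (2 * s)) u"
    and pos: "AE x in lebesgue. x \<in> \<Omega> \<longrightarrow> 0 < u x" and k: "1 \<le> k"
    and int: "set_integrable lebesgue \<Omega> (\<lambda>x. u x powr (p - 1 + 2 * k))"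
    and X: "(LINT x:\<Omega>|lebesgue. u x powr (p - 1 + 2 * k)) \<le> X * l ^ CARD('n)"
    and M: "0 \<le> M"
  shows "set_integrable lebesgue \<Omega> (\<lambda>x. trunc_powr M (k * (2 + 2 * t)) (u x))"
    and "(LINT x:\<Omega>|lebesgue. trunc_powr M (k * (2 + 2 * t)) (u x)) \<le> sobolev_const * (energy_const * k * X) powr (1 + t) * l ^ CARD('n)"
proof -
  let ?d = "l powr (2 * s)"
  let ?F = "\<lambda>x. trunc_powr M (2 * k - 1) (u x)" and ?G = "\<lambda>x. trunc_powr M k (u x)"
  have u: "u \<in> Hs_space s \<Omega>" using w by (simp add: weak_solution_def)
  have F: "?F \<in> Hs_space s \<Omega>" and G: "?G \<in> Hs_space s \<Omega>"
    using k M by (auto intro!: trunc_powr_Hs_space OL u)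
  have weak: "?d * \<kappa> * gagliardo_form s \<Omega> u ?F + (LINT x:\<Omega>|lebesgue. u x * ?F x)
      = (LINT x:\<Omega>|lebesgue. \<bar>u x\<bar> powr (p - 1) * u x * ?F x)"
    using w F by (simp add: weak_solution_def \<kappa>_def)
  have a: "gagliardo_form s \<Omega> ?G ?G \<le> k * gagliardo_form s \<Omega> u ?F"
  proof -
    have "gagliardo_form s \<Omega> ?G ?G \<le> (LINT z:cross_domain \<Omega>|lebesgue. k * gagliardo_integrand s u ?F z)"
      unfolding gagliardo_form_def
    proof (rule set_integral_mono)
      show "set_integrable lebesgue (cross_domain \<Omega>) (gagliardo_integrand s ?G ?G)"
        by (rule Hs_form_integrable[OF OL G G])
      show "set_integrable lebesgue (cross_domain \<Omega>) (\<lambda>z. k * gagliardo_integrand s u ?F z)"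
        by (intro set_integrable_mult_right Hs_form_integrable[OF OL u F])
      fix z
      show "gagliardo_integrand s ?G ?G z \<le> k * gagliardo_integrand s u ?F z"
        using divide_right_mono[OF trunc_powr_square_diff_le[OF k, of M "u (fst z)" "u (snd z)"],
            of "norm (fst z - snd z) powr (real CARD('n) + 2 * s)"]
        by (simp add: gagliardo_integrand_def split_beta power2_eq_square)
    qed
    then show ?thesis by (simp add: gagliardo_form_def)
  qed
  have b: "(LINT x:\<Omega>|lebesgue. (?G x)\<^sup>2) \<le> (LINT x:\<Omega>|lebesgue. u x * ?F x)"
  proof (rule set_integral_mono_AE)
    show "AE x\<in>\<Omega> in lebesgue. (?G x)\<^sup>2 \<le> u x * ?F x"
      using pos
    proof eventually_elim
      case (elim x)
      show ?case
      proof
        assume "x \<in> \<Omega>"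
        then have ux: "0 < u x" using elim by simp
        define \<tau> where "\<tau> = max 0 (min (u x) M)"
        have \<tau>: "0 \<le> \<tau>" "\<tau> \<le> u x" using ux M by (auto simp: \<tau>_def)
        have "(\<tau> powr k)\<^sup>2 = \<tau> powr (2 * k - 1) * \<tau>"
        proof (cases "\<tau> = 0")
          case False
          then have "\<tau> powr (2 * k - 1) * \<tau> powr 1 = \<tau> powr (2 * k)"
            by (simp only: powr_add[symmetric]) simp
          also have "\<dots> = (\<tau> powr k)\<^sup>2"
            by (simp add: power2_eq_square powr_add[symmetric])
          finally show ?thesis using \<tau> by simp
        qed simp
        also have "\<dots> \<le> \<tau> powr (2 * k - 1) * u x" using \<tau> by (intro mult_left_mono) auto
        finally show "(?G x)\<^sup>2 \<le> u x * ?F x" by (simp add: trunc_powr_def \<tau>_def mult.commute)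
      qed
    qed
  qed (use Hs_spaceD(2)[OF G] Hs_product_integrable[OF OL u F] in auto)
  have rhs: "(LINT x:\<Omega>|lebesgue. \<bar>u x\<bar> powr (p - 1) * u x * ?F x) \<le> X * l ^ CARD('n)"
  proof -
    have le: "AE x in lebesgue. x \<in> \<Omega> \<longrightarrow> 0 \<le> \<bar>u x\<bar> powr (p - 1) * u x * ?F x \<and>
        \<bar>u x\<bar> powr (p - 1) * u x * ?F x \<le> u x powr (p - 1 + 2 * k)"
      using pos
    proof eventually_elim
      case (elim x)
      show ?case
      proof
        assume "x \<in> \<Omega>"
        then have ux: "0 < u x" using elim by simp
        have "?F x \<le> u x powr (2 * k - 1)"
          unfolding trunc_powr_def using ux M k by (intro powr_mono2) auto
        then have "\<bar>u x\<bar> powr (p - 1) * u x * ?F x \<le> u x powr (p - 1) * u x powr 1 * u x powr (2 * k - 1)"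
          using ux by (simp add: mult_left_mono)
        also have "\<dots> = u x powr (p - 1 + 2 * k)"
          by (simp only: powr_add[symmetric]) (simp add: algebra_simps)
        finally show "0 \<le> \<bar>u x\<bar> powr (p - 1) * u x * ?F x \<and>
          \<bar>u x\<bar> powr (p - 1) * u x * ?F x \<le> u x powr (p - 1 + 2 * k)"
          using ux trunc_powr_nonneg by simp
      qed
    qed
    have "(LINT x:\<Omega>|lebesgue. \<bar>u x\<bar> powr (p - 1) * u x * ?F x) \<le> (LINT x:\<Omega>|lebesgue. u x powr (p - 1 + 2 * k))"
    proof (rule set_integral_mono_AE)
      show "set_integrable lebesgue \<Omega> (\<lambda>x. \<bar>u x\<bar> powr (p - 1) * u x * ?F x)"
      proof (rule set_integrable_bound[OF int])
        show "set_borel_measurable lebesgue \<Omega> (\<lambda>x. \<bar>u x\<bar> powr (p - 1) * u x * ?F x)"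
          using Hs_spaceD(1)[OF u] Hs_spaceD(1)[OF F] by (intro set_borel_measurableI OL) auto
        show "AE x in lebesgue. x \<in> \<Omega> \<longrightarrow> norm (\<bar>u x\<bar> powr (p - 1) * u x * ?F x) \<le> norm (u x powr (p - 1 + 2 * k))"
          using le by eventually_elim auto
      qed
      show "AE x\<in>\<Omega> in lebesgue. \<bar>u x\<bar> powr (p - 1) * u x * ?F x \<le> u x powr (p - 1 + 2 * k)"
        using le by eventually_elim auto
    qed (rule int)
    with X show ?thesis by simp
  qed
  have E: "?d * gagliardo_form s \<Omega> ?G ?G + (LINT x:\<Omega>|lebesgue. (?G x)\<^sup>2) \<le> (energy_const * k * X) * l ^ CARD('n)"
  proof -
    let ?f = "gagliardo_form s \<Omega> u ?F" and ?i = "LINT x:\<Omega>|lebesgue. u x * ?F x"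
    \<comment> \<open>Nonnegativity of both terms, read off from \<open>a\<close> and
      \<open>b\<close>, permits enlarging their coefficients until \<open>energy_const * k\<close>
      times the left side of the weak equation appears.\<close>
    have "0 \<le> k * ?f" using a gagliardo_form_nonneg[of s \<Omega> ?G] by linarith
    then have f0: "0 \<le> ?f" using k by (simp add: zero_le_mult_iff)
    have i0: "0 \<le> ?i" using b set_lebesgue_integral_nonneg[of \<Omega> "\<lambda>x. (?G x)\<^sup>2" lebesgue] by simp
    have "?d * gagliardo_form s \<Omega> ?G ?G \<le> ?d * (k * ?f)" using a by (intro mult_left_mono) auto
    moreover have "1 * (?d * (k * ?f)) \<le> (energy_const * \<kappa>) * (?d * (k * ?f))"
      using energy_const(2) f0 k by (intro mult_right_mono) auto
    moreover have "1 * ?i \<le> (energy_const * k) * ?i"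
      using energy_const(1) k i0 mult_mono[of 1 energy_const 1 k] by (intro mult_right_mono) auto
    moreover have "(energy_const * \<kappa>) * (?d * (k * ?f)) + (energy_const * k) * ?i = energy_const * k * (?d * \<kappa> * ?f + ?i)"
      by (simp add: algebra_simps)
    moreover have "energy_const * k * (?d * \<kappa> * ?f + ?i) \<le> energy_const * k * (X * l ^ CARD('n))"
      using weak rhs energy_const(1) k by (intro mult_left_mono) auto
    ultimately show ?thesis using b by (simp add: mult.assoc)
  qed
  have dl: "\<And>x \<rho>. x \<in> \<Omega> \<Longrightarrow> 0 < \<rho> \<Longrightarrow> \<rho> \<le> l \<Longrightarrow> c * \<rho> ^ CARD('n) \<le> measure lebesgue (\<Omega> \<inter> ball x \<rho>)"
    using dens l by auto
  have Gq: "\<bar>?G x\<bar> powr (2 + 2 * t) = trunc_powr M (k * (2 + 2 * t)) (u x)" for x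
    by (simp add: trunc_powr_def powr_powr)
  show "set_integrable lebesgue \<Omega> (\<lambda>x. trunc_powr M (k * (2 + 2 * t)) (u x))"
    using nash_inequality(1)[OF s(1) O(1) G c l(1) dl t] by (simp only: Gq)
  show "(LINT x:\<Omega>|lebesgue. trunc_powr M (k * (2 + 2 * t)) (u x)) \<le> sobolev_const * (energy_const * k * X) powr (1 + t) * l ^ CARD('n)"
    using scaled_sobolev_inequality[OF s(1) O(1) G c l(1) dl t E] by (simp only: Gq sobolev_const_def)
qed

text \<open>Fatou's lemma removes the truncation: at almost every point the truncated powers are
  eventually equal to the full power, and their integrals share one bound.\<close>

lemma moser_step:
  assumes l: "0 < l" "l \<le> l0" and w: "weak_solution s p \<Omega> (l powr (2 * s)) u"
    and pos: "AE x in lebesgue. x \<in> \<Omega> \<longrightarrow> 0 < u x" and k: "1 \<le> k"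
    and int: "set_integrable lebesgue \<Omega> (\<lambda>x. u x powr (p - 1 + 2 * k))"
    and X: "(LINT x:\<Omega>|lebesgue. u x powr (p - 1 + 2 * k)) \<le> X * l ^ CARD('n)"
  shows "set_integrable lebesgue \<Omega> (\<lambda>x. u x powr (k * (2 + 2 * t)))"
    and "(LINT x:\<Omega>|lebesgue. u x powr (k * (2 + 2 * t))) \<le> sobolev_const * (energy_const * k * X) powr (1 + t) * l ^ CARD('n)"
proof -
  let ?r = "k * (2 + 2 * t)"
  define R where "R = sobolev_const * (energy_const * k * X) powr (1 + t) * l ^ CARD('n)"
  have R0: "0 \<le> R" using sobolev_const l by (simp add: R_def)
  have um: "u \<in> borel_measurable lebesgue" using w by (auto simp: weak_solution_def intro: Hs_spaceD)
  define f where "f m x = indicator \<Omega> x *\<^sub>R trunc_powr (real m) ?r (u x)" for m x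
  have fm: "f m \<in> borel_measurable lebesgue" for m
    unfolding f_def[abs_def]
    by (intro borel_measurable_scaleR borel_measurable_indicator OL trunc_powr_measurable um)
  have f_le: "(\<integral>\<^sup>+ x. ennreal (f m x) \<partial>lebesgue) \<le> ennreal R" for m
  proof -
    note * = moser_truncated[OF l w pos k int X, of "real m"]
    have "(\<integral>\<^sup>+ x. ennreal (f m x) \<partial>lebesgue) = ennreal (LINT x:\<Omega>|lebesgue. trunc_powr (real m) ?r (u x))"
      unfolding f_def set_lebesgue_integral_def using *(1)
      by (intro nn_integral_eq_integral) (auto simp: set_integrable_def trunc_powr_nonneg)
    also have "\<dots> \<le> ennreal R" using *(2) by (intro ennreal_leI) (simp add: R_def)
    finally show ?thesis .
  qed
  have g: "(\<integral>\<^sup>+ x. ennreal (indicator \<Omega> x *\<^sub>R u x powr ?r) \<partial>lebesgue) \<le> ennreal R"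
  proof -
    have "(\<integral>\<^sup>+ x. ennreal (indicator \<Omega> x *\<^sub>R u x powr ?r) \<partial>lebesgue) \<le> (\<integral>\<^sup>+ x. liminf (\<lambda>m. ennreal (f m x)) \<partial>lebesgue)"
    proof (rule nn_integral_mono_AE, use pos in eventually_elim)
      case (elim x)
      obtain m0 :: nat where m0: "u x \<le> real m0" using real_arch_simple by blast
      have "f m x = indicator \<Omega> x *\<^sub>R u x powr ?r" if "m0 \<le> m" for m
      proof (cases "x \<in> \<Omega>")
        case True
        then have "max 0 (min (u x) (real m)) = u x" using elim m0 that by simp
        then show ?thesis by (simp add: f_def trunc_powr_def)
      qed (simp add: f_def)
      then have "\<forall>\<^sub>F m in sequentially. ennreal (indicator \<Omega> x *\<^sub>R u x powr ?r) \<le> ennreal (f m x)"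
        by (intro eventually_sequentiallyI[of m0]) simp
      then show ?case by (rule Liminf_bounded)
    qed
    also have "\<dots> \<le> liminf (\<lambda>m. \<integral>\<^sup>+ x. ennreal (f m x) \<partial>lebesgue)"
      using fm by (intro nn_integral_liminf) auto
    also have "\<dots> \<le> limsup (\<lambda>m. \<integral>\<^sup>+ x. ennreal (f m x) \<partial>lebesgue)"
      by (rule Liminf_le_Limsup) simp
    also have "\<dots> \<le> ennreal R"
      by (rule Limsup_bounded) (simp add: f_le)
    finally show ?thesis .
  qed
  show i: "set_integrable lebesgue \<Omega> (\<lambda>x. u x powr ?r)"
    unfolding set_integrable_def
  proof (rule integrableI_nonneg)
    show "(\<lambda>x. indicator \<Omega> x *\<^sub>R u x powr ?r) \<in> borel_measurable lebesgue"
      using um by (intro borel_measurable_scaleR borel_measurable_indicator OL) auto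
  qed (use g in \<open>auto intro: le_less_trans\<close>)
  have "ennreal (LINT x:\<Omega>|lebesgue. u x powr ?r) \<le> ennreal R"
    using g i unfolding set_lebesgue_integral_def set_integrable_def
    by (subst nn_integral_eq_integral[symmetric]) auto
  then show "(LINT x:\<Omega>|lebesgue. u x powr ?r) \<le> sobolev_const * (energy_const * k * X) powr (1 + t) * l ^ CARD('n)"
    using R0 by (simp add: R_def)
qed

end

subsection \<open>Moments of least energy solutions\<close>

context neumann_problem
begin

text \<open>Isolates the information from which all moment estimates follow. The least energy
  property enters as the bound \<open>B\<close>, common to all scales \<open>l\<close>.\<close>

definition moderate_solution :: "real \<Rightarrow> real \<Rightarrow> (real ^ 'n \<Rightarrow> real) \<Rightarrow> bool" where
  "moderate_solution B l u \<longleftrightarrow> 0 < l \<and> l \<le> l0 \<and> weak_solution s p \<Omega> (l powr (2 * s)) u \<and>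
     (AE x in lebesgue. x \<in> \<Omega> \<longrightarrow> 0 < u x) \<and>
     (LINT x:\<Omega>|lebesgue. \<bar>u x\<bar> powr (p + 1)) \<le> B * l ^ CARD('n)"

abbreviation moment :: "(real ^ 'n \<Rightarrow> real) \<Rightarrow> real \<Rightarrow> real" where
  "moment u r \<equiv> (LINT x:\<Omega>|lebesgue. u x powr r)"

abbreviation moment_finite :: "(real ^ 'n \<Rightarrow> real) \<Rightarrow> real \<Rightarrow> bool" where
  "moment_finite u r \<equiv> set_integrable lebesgue \<Omega> (\<lambda>x. u x powr r)"

lemma moderate_solutionD:
  assumes "moderate_solution B l u"
  shows "0 < l" "l \<le> l0" "weak_solution s p \<Omega> (l powr (2 * s)) u"
    "AE x in lebesgue. x \<in> \<Omega> \<longrightarrow> 0 < u x" "u \<in> Hs_space s \<Omega>" "u \<in> borel_measurable lebesgue"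
  using assms by (auto simp: moderate_solution_def weak_solution_def dest: Hs_spaceD)

section \<open>Finiteness and interpolation of moments\<close>

lemma powr_p1_integrable:
  assumes w: "w \<in> Hs_space s \<Omega>"
  shows "set_integrable lebesgue \<Omega> (\<lambda>x. \<bar>w x\<bar> powr (p + 1))"
  using p by (intro Hs_powr_integrable[OF s(1) O(1) w c l0 dens t]) auto

lemma moment_abs:
  assumes "u \<in> borel_measurable lebesgue" "AE x in lebesgue. x \<in> \<Omega> \<longrightarrow> 0 < u x"
  shows "(LINT x:\<Omega>|lebesgue. \<bar>u x\<bar> powr r) = moment u r"
    and "set_integrable lebesgue \<Omega> (\<lambda>x. \<bar>u x\<bar> powr r) \<longleftrightarrow> moment_finite u r"
proof -
  have m: "(\<lambda>x. indicator \<Omega> x *\<^sub>R \<bar>u x\<bar> powr r) \<in> borel_measurable lebesgue"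
    "(\<lambda>x. indicator \<Omega> x *\<^sub>R u x powr r) \<in> borel_measurable lebesgue"
    using assms(1) by (intro borel_measurable_scaleR borel_measurable_indicator OL; simp)+
  have ae: "AE x in lebesgue. indicator \<Omega> x *\<^sub>R \<bar>u x\<bar> powr r = indicator \<Omega> x *\<^sub>R u x powr r"
    using assms(2) by eventually_elim (auto simp: indicator_def)
  show "(LINT x:\<Omega>|lebesgue. \<bar>u x\<bar> powr r) = moment u r"
    unfolding set_lebesgue_integral_def by (rule integral_cong_AE[OF m ae])
  show "set_integrable lebesgue \<Omega> (\<lambda>x. \<bar>u x\<bar> powr r) \<longleftrightarrow> moment_finite u r"
    unfolding set_integrable_def by (rule integrable_cong_AE[OF m ae])
qed

lemma moment_finite_p1: "moderate_solution B l u \<Longrightarrow> moment_finite u (p + 1)"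
  using moment_abs(2)[OF moderate_solutionD(6,4)] powr_p1_integrable[OF moderate_solutionD(5)] by blast

lemma moment_p1_le:
  assumes u: "moderate_solution B l u"
  shows "moment u (p + 1) \<le> B * l ^ CARD('n)"
  using u moment_abs(1)[OF moderate_solutionD(6,4)[OF u], of "p + 1"] by (simp add: moderate_solution_def)

lemma moment_pos:
  assumes u: "moderate_solution B l u" and f: "moment_finite u r"
  shows "0 < moment u r"
  using moderate_solutionD(4)[OF u] by (intro set_integral_pos O f) (auto elim!: eventually_mono)

lemma moment_interpolation:
  assumes u: "moderate_solution B l u" and f: "moment_finite u a" "moment_finite u b" and r: "a \<le> r" "r \<le> b" and R: "0 < R"
  shows "moment_finite u r" and "moment u r \<le> R powr (r - a) * moment u a + R powr (r - b) * moment u b"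
proof -
  have i: "set_integrable lebesgue \<Omega> (\<lambda>x. R powr (r - a) * u x powr a + R powr (r - b) * u x powr b)"
    using f by (intro set_integral_add set_integrable_mult_right) auto
  have le: "AE x\<in>\<Omega> in lebesgue. u x powr r \<le> R powr (r - a) * u x powr a + R powr (r - b) * u x powr b"
    using moderate_solutionD(4)[OF u] by eventually_elim (auto intro!: powr_interpolation R r)
  show fr: "moment_finite u r"
  proof (rule set_integrable_bound[OF i])
    show "set_borel_measurable lebesgue \<Omega> (\<lambda>x. u x powr r)"
      using moderate_solutionD(6)[OF u] by (intro set_borel_measurableI OL) auto
    show "AE x in lebesgue. x \<in> \<Omega> \<longrightarrow> norm (u x powr r) \<le> norm (R powr (r - a) * u x powr a + R powr (r - b) * u x powr b)"
      using le by eventually_elim auto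
  qed
  have "moment u r \<le> (LINT x:\<Omega>|lebesgue. R powr (r - a) * u x powr a + R powr (r - b) * u x powr b)"
    by (rule set_integral_mono_AE[OF fr i le])
  also have "\<dots> = R powr (r - a) * moment u a + R powr (r - b) * moment u b"
    using f by (subst set_integral_add) auto
  finally show "moment u r \<le> R powr (r - a) * moment u a + R powr (r - b) * moment u b" .
qed

lemma abs_powr_square: "\<bar>x\<bar> powr (p - 1) * x * x = \<bar>x\<bar> powr (p + 1)" for x :: real
proof (cases "x = 0")
  case False
  have "\<bar>x\<bar> powr (p - 1) * \<bar>x\<bar> powr 2 = \<bar>x\<bar> powr (p + 1)"
    by (simp only: powr_add[symmetric]) (simp add: algebra_simps)
  then show ?thesis using False by (simp add: power2_eq_square mult.assoc)
qed simp

lemma nehari_identity: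
  assumes "weak_solution s p \<Omega> d u"
  shows "d * \<kappa> * gagliardo_form s \<Omega> u u + (LINT x:\<Omega>|lebesgue. (u x)\<^sup>2) = (LINT x:\<Omega>|lebesgue. \<bar>u x\<bar> powr (p + 1))"
  using assms by (simp add: weak_solution_def \<kappa>_def power2_eq_square abs_powr_square)

lemma moment_2_le:
  assumes u: "moderate_solution B l u"
  shows "moment_finite u 2" "moment u 2 \<le> moment u (p + 1)"
proof -
  have eq: "\<bar>u x\<bar> powr 2 = (u x)\<^sup>2" for x by (cases "u x = 0") auto
  show "moment_finite u 2"
    using moment_abs(2)[OF moderate_solutionD(6,4)[OF u], of 2] Hs_spaceD(2)[OF moderate_solutionD(5)[OF u]] by (simp add: eq)
  have "moment u 2 = (LINT x:\<Omega>|lebesgue. (u x)\<^sup>2)"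
    using moment_abs(1)[OF moderate_solutionD(6,4)[OF u], of 2] by (simp add: eq)
  also have "\<dots> \<le> (LINT x:\<Omega>|lebesgue. \<bar>u x\<bar> powr (p + 1))"
  proof -
    have "0 \<le> l powr (2 * s) * \<kappa> * gagliardo_form s \<Omega> u u"
      using \<kappa> gagliardo_form_nonneg by (intro mult_nonneg_nonneg) auto
    then show ?thesis using nehari_identity[OF moderate_solutionD(3)[OF u]] by linarith
  qed
  also have "\<dots> = moment u (p + 1)" using moment_abs(1)[OF moderate_solutionD(6,4)[OF u]] by simp
  finally show "moment u 2 \<le> moment u (p + 1)" .
qed

text \<open>Boundedness of \<Omega> supplies order 0 as a lower endpoint for interpolation. The
  moment of order 0 is bounded by the measure rather than identified with it, as
  \<open>0 powr 0\<close> is 0.\<close>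

lemma moment_finite_1:
  assumes u: "moderate_solution B l u"
  shows "moment_finite u 0" "moment u 0 \<le> measure lebesgue \<Omega>" "moment_finite u 1"
proof -
  have o: "set_integrable lebesgue \<Omega> (\<lambda>x. 1 :: real)"
    using Om by (auto simp: set_integrable_def fmeasurable_def intro: integrable_real_indicator)
  show f0: "moment_finite u 0"
  proof (rule set_integrable_bound[OF o])
    show "set_borel_measurable lebesgue \<Omega> (\<lambda>x. u x powr 0)"
      using moderate_solutionD(6)[OF u] by (intro set_borel_measurableI OL) auto
  qed auto
  have "moment u 0 \<le> (LINT x:\<Omega>|lebesgue. 1)"
    by (rule set_integral_mono[OF f0 o]) auto
  also have "\<dots> = measure lebesgue \<Omega>"
    using OL by (simp add: set_lebesgue_integral_def)
  finally show "moment u 0 \<le> measure lebesgue \<Omega>" .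
  show "moment_finite u 1"
    by (rule moment_interpolation(1)[OF u f0 moment_2_le(1)[OF u], of 1 1]) auto
qed

text \<open>Testing with 1 shows that the moments of orders 1 and \<open>p\<close> coincide.
  Interpolating order \<open>p\<close> between 1 and \<open>p + 1\<close>, with \<open>R\<close>
  chosen so that \<open>R powr (p - 1) = 1 / 2\<close>, lets half of the first moment be
  absorbed.\<close>

lemma moment_1_le:
  assumes u: "moderate_solution B l u"
  shows "moment u 1 \<le> 2 * 2 powr (1 / (p - 1)) * moment u (p + 1)"
proof -
  define R where "R = (1 / 2 :: real) powr (1 / (p - 1))"
  have R: "R > 0" by (simp add: R_def)
  have R1: "R powr (p - 1) = 1 / 2" using p by (simp add: R_def powr_powr)
  have R2: "R powr (- 1) = 2 powr (1 / (p - 1))"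
    by (simp add: R_def powr_powr powr_divide powr_minus_divide)
  have one: "(\<lambda>x. 1) \<in> Hs_space s \<Omega>" by (rule Hs_space_const[OF Om])
  have w: "(LINT x:\<Omega>|lebesgue. u x) = (LINT x:\<Omega>|lebesgue. \<bar>u x\<bar> powr (p - 1) * u x)"
    using bspec[OF conjunct2[OF moderate_solutionD(3)[OF u, unfolded weak_solution_def]] one]
    by (simp add: gagliardo_form_const)
  have e1: "moment u 1 = (LINT x:\<Omega>|lebesgue. u x)"
    unfolding set_lebesgue_integral_def
  proof (rule integral_cong_AE)
    show "AE x in lebesgue. indicator \<Omega> x *\<^sub>R u x powr 1 = indicator \<Omega> x *\<^sub>R u x"
      using moderate_solutionD(4)[OF u] by eventually_elim (auto simp: indicator_def)
  qed (use moderate_solutionD(6)[OF u] in \<open>intro borel_measurable_scaleR borel_measurable_indicator OL; simp\<close>)+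
  have e2: "moment u p = (LINT x:\<Omega>|lebesgue. \<bar>u x\<bar> powr (p - 1) * u x)"
    unfolding set_lebesgue_integral_def
  proof (rule integral_cong_AE)
    show "AE x in lebesgue. indicator \<Omega> x *\<^sub>R u x powr p = indicator \<Omega> x *\<^sub>R (\<bar>u x\<bar> powr (p - 1) * u x)"
      using moderate_solutionD(4)[OF u]
    proof eventually_elim
      case (elim x)
      have "u x powr (p - 1) * u x powr 1 = u x powr p" by (simp only: powr_add[symmetric]) simp
      then show ?case using elim by (auto simp: indicator_def)
    qed
  qed (use moderate_solutionD(6)[OF u] in \<open>intro borel_measurable_scaleR borel_measurable_indicator OL; simp\<close>)+
  have "moment u p \<le> R powr (p - 1) * moment u 1 + R powr (p - (p + 1)) * moment u (p + 1)"
    using p by (intro moment_interpolation(2)[OF u moment_finite_1(3)[OF u] moment_finite_p1[OF u] _ _ R]) auto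
  moreover have "p - (p + 1) = - 1" by simp
  ultimately have "moment u p \<le> 1 / 2 * moment u 1 + 2 powr (1 / (p - 1)) * moment u (p + 1)"
    by (simp only: R1 R2)
  moreover have "moment u p = moment u 1" using w e1 e2 by simp
  ultimately show ?thesis by simp
qed

section \<open>Uniform upper bounds for moments\<close>

definition moments_bounded :: "real \<Rightarrow> real \<Rightarrow> bool" where
  "moments_bounded B r \<longleftrightarrow> (\<exists>K. \<forall>l u. moderate_solution B l u \<longrightarrow> moment_finite u r \<and> moment u r \<le> K * l ^ CARD('n))"

lemma moments_bounded_p1: "moments_bounded B (p + 1)"
  unfolding moments_bounded_def using moment_finite_p1 moment_p1_le by blast

lemma moments_bounded_1: "moments_bounded B 1"
proof -
  have "moment_finite u 1 \<and> moment u 1 \<le> 2 * 2 powr (1 / (p - 1)) * B * l ^ CARD('n)" if u: "moderate_solution B l u" for l u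
  proof -
    have "moment u 1 \<le> 2 * 2 powr (1 / (p - 1)) * moment u (p + 1)" by (rule moment_1_le[OF u])
    also have "\<dots> \<le> 2 * 2 powr (1 / (p - 1)) * (B * l ^ CARD('n))"
      using moment_p1_le[OF u] by (intro mult_left_mono) auto
    finally show ?thesis using moment_finite_1(3)[OF u] by (simp add: mult.assoc)
  qed
  then show ?thesis unfolding moments_bounded_def by blast
qed

lemma moments_bounded_step:
  assumes k: "1 \<le> k" and b: "moments_bounded B (p - 1 + 2 * k)"
  shows "moments_bounded B (k * (2 + 2 * t))"
proof -
  obtain K where K: "\<And>l u. moderate_solution B l u \<Longrightarrow> moment_finite u (p - 1 + 2 * k) \<and> moment u (p - 1 + 2 * k) \<le> K * l ^ CARD('n)"
    using b unfolding moments_bounded_def by blast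
  have "moment_finite u (k * (2 + 2 * t)) \<and> moment u (k * (2 + 2 * t)) \<le> sobolev_const * (energy_const * k * K) powr (1 + t) * l ^ CARD('n)"
    if u: "moderate_solution B l u" for l u
    using moser_step[OF moderate_solutionD(1-4)[OF u] k, of K] K[OF u] by blast
  then show ?thesis unfolding moments_bounded_def by blast
qed

lemma moments_bounded_interpolation:
  assumes "moments_bounded B a" "moments_bounded B b" "a \<le> r" "r \<le> b"
  shows "moments_bounded B r"
proof -
  obtain Ka Kb where K: "\<And>l u. moderate_solution B l u \<Longrightarrow> moment_finite u a \<and> moment u a \<le> Ka * l ^ CARD('n)"
    "\<And>l u. moderate_solution B l u \<Longrightarrow> moment_finite u b \<and> moment u b \<le> Kb * l ^ CARD('n)"
    using assms(1,2) unfolding moments_bounded_def by blast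
  have "moment_finite u r \<and> moment u r \<le> (Ka + Kb) * l ^ CARD('n)" if u: "moderate_solution B l u" for l u
    using moment_interpolation[OF u _ _ assms(3,4), of 1] K[OF u] by (auto simp: distrib_right)
  then show ?thesis unfolding moments_bounded_def by blast
qed

text \<open>From \<open>m = p - 1 + 2 * k\<close> one step leads to \<open>k * (2 + 2 * t)\<close>,
  a gain of \<open>2 * k * t + 1 - p\<close>. Since \<open>m \<ge> p + 1\<close> means
  \<open>k \<ge> 1\<close>, the gain never falls below the positive number
  \<open>1 + 2 * t - p\<close>.\<close>

lemma moments_bounded_arithmetic: "\<exists>m. p + 1 + real j * (1 + 2 * t - p) \<le> m \<and> moments_bounded B m"
proof (induction j)
  case 0
  then show ?case using moments_bounded_p1 by (intro exI[of _ "p + 1"]) simp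
next
  case (Suc j)
  then obtain m where m: "p + 1 + real j * (1 + 2 * t - p) \<le> m" "moments_bounded B m" by blast
  define k where "k = (m - p + 1) / 2"
  have "0 \<le> real j * (1 + 2 * t - p)" using p by simp
  then have k1: "1 \<le> k" using m(1) by (simp add: k_def)
  have "2 * k = m - p + 1" by (simp add: k_def)
  then have mk: "m = p - 1 + 2 * k" by linarith
  have "t * 1 \<le> t * k" using k1 t_pos by (intro mult_left_mono) auto
  then have "p + 1 + real (Suc j) * (1 + 2 * t - p) \<le> k * (2 + 2 * t)"
    using m(1) by (simp add: mk algebra_simps)
  moreover have "moments_bounded B (k * (2 + 2 * t))" using moments_bounded_step[OF k1] m(2) by (simp add: mk)
  ultimately show ?case by blast
qed

lemma moments_bounded_above: "\<exists>m>y. moments_bounded B m"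
proof -
  have d: "0 < 1 + 2 * t - p" using p by simp
  obtain j :: nat where j: "(y - p - 1) / (1 + 2 * t - p) < real j" using reals_Archimedean2 by blast
  then have "y < p + 1 + real j * (1 + 2 * t - p)" using d by (simp add: field_simps)
  then show ?thesis using moments_bounded_arithmetic[of j B] by (meson order.strict_trans2)
qed

lemma moments_bounded_ge_1: "1 \<le> r \<Longrightarrow> moments_bounded B r"
  using moments_bounded_above[of r B] moments_bounded_interpolation[OF moments_bounded_1] by (meson less_imp_le)

lemma moment_finite_pos:
  assumes u: "moderate_solution B l u" and r: "0 < r"
  shows "moment_finite u r"
proof (cases "r \<le> 1")
  case True
  then show ?thesis using moment_interpolation(1)[OF u moment_finite_1(1,3)[OF u], of r 1] r by simp
next
  case False
  then show ?thesis using moments_bounded_ge_1[of r B] u unfolding moments_bounded_def by auto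
qed

text \<open>Let \<open>a\<close> be the moment of order \<open>p + 1\<close> divided by
  \<open>l ^ n\<close>. The Moser step with \<open>k = 1\<close> and \<open>X = a\<close> bounds the
  moment of order \<open>2 + 2 * t\<close> by a multiple of \<open>a powr (1 + t)\<close>.
  Interpolating order \<open>p + 1\<close> between 2 and \<open>2 + 2 * t\<close> and absorbing the
  moment of order 2 gives \<open>a / 2 \<le> W * a powr (1 + t)\<close>; as \<open>a > 0\<close> and
  \<open>t > 0\<close>, this keeps \<open>a\<close> away from 0.\<close>

lemma moment_p1_lower: "\<exists>b>0. \<forall>l u. moderate_solution B l u \<longrightarrow> b * l ^ CARD('n) \<le> moment u (p + 1)"
proof -
  define R where "R = (1 / 2 :: real) powr (1 / (p - 1))"
  have R: "R > 0" by (simp add: R_def)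
  have R1: "R powr (p - 1) = 1 / 2" using p by (simp add: R_def powr_powr)
  define W where "W = R powr (p + 1 - (2 + 2 * t)) * (sobolev_const * energy_const powr (1 + t))"
  have W: "W > 0" using R sobolev_const energy_const by (simp add: W_def)
  define b where "b = (1 / (2 * W)) powr (1 / t)"
  have "b * l ^ CARD('n) \<le> moment u (p + 1)" if u: "moderate_solution B l u" for l u
  proof -
    define L where "L = l ^ CARD('n)"
    have L: "L > 0" using moderate_solutionD(1)[OF u] by (simp add: L_def)
    define a where "a = moment u (p + 1) / L"
    have mp: "moment u (p + 1) = a * L" using L by (simp add: a_def)
    have a: "a > 0" using moment_pos[OF u moment_finite_p1[OF u]] L by (simp add: a_def)
    have q: "moment_finite u (2 + 2 * t)" "moment u (2 + 2 * t) \<le> sobolev_const * (energy_const * a) powr (1 + t) * L"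
      using moser_step[OF moderate_solutionD(1-4)[OF u], of 1 a] moment_finite_p1[OF u] mp by (auto simp: L_def add.commute)
    have "moment u (p + 1) \<le> R powr (p + 1 - 2) * moment u 2 + R powr (p + 1 - (2 + 2 * t)) * moment u (2 + 2 * t)"
      using p by (intro moment_interpolation(2)[OF u moment_2_le(1)[OF u] q(1) _ _ R]) auto
    also have "\<dots> \<le> 1 / 2 * moment u (p + 1) + R powr (p + 1 - (2 + 2 * t)) * (sobolev_const * (energy_const * a) powr (1 + t) * L)"
    proof -
      have "R powr (p + 1 - 2) = 1 / 2" using R1 by simp
      then show ?thesis
        using moment_2_le(2)[OF u] q(2) by (simp only:) (intro add_mono mult_left_mono; simp)
    qed
    also have "R powr (p + 1 - (2 + 2 * t)) * (sobolev_const * (energy_const * a) powr (1 + t) * L) = W * (a powr t * a) * L"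
    proof -
      have "(energy_const * a) powr (1 + t) = energy_const powr (1 + t) * (a powr 1 * a powr t)"
        by (simp only: powr_mult powr_add mult_ac)
      then show ?thesis using a by (simp add: W_def mult_ac)
    qed
    finally have "1 / 2 * a * L \<le> W * a powr t * a * L" by (simp add: mp mult_ac)
    then have "1 / 2 \<le> W * a powr t" using a L by simp
    then have "1 / (2 * W) \<le> a powr t" using W by (simp add: field_simps)
    then have "b \<le> (a powr t) powr (1 / t)"
      unfolding b_def using W t_pos by (intro powr_mono2) auto
    also have "\<dots> = a" using a t_pos by (simp add: powr_powr)
    finally show ?thesis using L mp by (simp add: L_def)
  qed
  moreover have "b > 0" using W by (simp add: b_def)
  ultimately show ?thesis by blast
qed

text \<open>Order \<open>p + 1\<close>, already bounded below, is placed between \<open>r\<close>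
  and an order \<open>m\<close> bounded above. With a suitable \<open>R\<close> the term of order
  \<open>m\<close> takes at most half of the lower bound and the rest falls to order
  \<open>r\<close>. For \<open>r < p + 1\<close> the order \<open>m\<close> is large and the
  exponent of \<open>R\<close> negative; for \<open>r > p + 1\<close> one takes \<open>m = 1\<close>
  and the exponent is positive.\<close>

lemma moment_lower:
  assumes r: "0 < r"
  shows "\<exists>b>0. \<forall>l u. moderate_solution B l u \<longrightarrow> b * l ^ CARD('n) \<le> moment u r"
proof -
  obtain b0 where b0: "b0 > 0" "\<And>l u. moderate_solution B l u \<Longrightarrow> b0 * l ^ CARD('n) \<le> moment u (p + 1)"
    using moment_p1_lower by blast
  have *: ?thesis
    if R: "R > 0" and K: "K * R powr (p + 1 - m) \<le> b0 / 2"
      and Km: "\<And>l u. moderate_solution B l u \<Longrightarrow> moment u m \<le> K * l ^ CARD('n)"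
      and int: "\<And>l u. moderate_solution B l u \<Longrightarrow> moment u (p + 1) \<le> R powr (p + 1 - r) * moment u r + R powr (p + 1 - m) * moment u m"
    for R K m
  proof -
    have "b0 / (2 * R powr (p + 1 - r)) * l ^ CARD('n) \<le> moment u r" if u: "moderate_solution B l u" for l u
    proof -
      have L: "0 < l ^ CARD('n)" using moderate_solutionD(1)[OF u] by simp
      have "R powr (p + 1 - m) * moment u m \<le> R powr (p + 1 - m) * (K * l ^ CARD('n))"
        using Km[OF u] by (intro mult_left_mono) auto
      also have "\<dots> \<le> b0 / 2 * l ^ CARD('n)"
        using mult_right_mono[OF K, of "l ^ CARD('n)"] L by (simp add: mult_ac)
      finally have "b0 / 2 * l ^ CARD('n) \<le> R powr (p + 1 - r) * moment u r"
        using int[OF u] b0(2)[OF u] by simp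
      then show ?thesis using R by (simp add: field_simps)
    qed
    moreover have "b0 / (2 * R powr (p + 1 - r)) > 0" using b0 R by simp
    ultimately show ?thesis by blast
  qed
  have R_ex: "\<exists>R>0. K * R powr e \<le> b0 / 2" if "e \<noteq> 0" "0 < K" for K e :: real
  proof (intro exI conjI)
    show "(b0 / (2 * K)) powr (1 / e) > 0" using b0 that by simp
    show "K * ((b0 / (2 * K)) powr (1 / e)) powr e \<le> b0 / 2"
      using b0 that by (simp add: powr_powr)
  qed
  have ub: "\<exists>K>0. \<forall>l u. moderate_solution B l u \<longrightarrow> moment u m \<le> K * l ^ CARD('n)" if m: "moments_bounded B m" for m
  proof -
    obtain K where K: "\<And>l u. moderate_solution B l u \<Longrightarrow> moment u m \<le> K * l ^ CARD('n)"
      using m unfolding moments_bounded_def by blast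
    have "moment u m \<le> max K 1 * l ^ CARD('n)" if u: "moderate_solution B l u" for l u
    proof -
      have "K * l ^ CARD('n) \<le> max K 1 * l ^ CARD('n)"
        using moderate_solutionD(1)[OF u] by (intro mult_right_mono) auto
      with K[OF u] show ?thesis by linarith
    qed
    then show ?thesis by (intro exI[of _ "max K 1"]) auto
  qed
  consider "r < p + 1" | "r = p + 1" | "p + 1 < r" by linarith
  then show ?thesis
  proof cases
    case 1
    obtain m where m: "m > p + 1" "moments_bounded B m" using moments_bounded_above by blast
    obtain K where K: "K > 0" "\<And>l u. moderate_solution B l u \<Longrightarrow> moment u m \<le> K * l ^ CARD('n)"
      using ub[OF m(2)] by blast
    obtain R where R: "R > 0" "K * R powr (p + 1 - m) \<le> b0 / 2" using R_ex[of "p + 1 - m" K] m K by auto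
    show ?thesis
    proof (rule *[OF R K(2)])
      fix l u assume u: "moderate_solution B l u"
      show "moment u (p + 1) \<le> R powr (p + 1 - r) * moment u r + R powr (p + 1 - m) * moment u m"
        using 1 m(1) p r by (intro moment_interpolation(2)[OF u moment_finite_pos[OF u] moment_finite_pos[OF u] _ _ R(1)]) auto
    qed
  next
    case 2
    then show ?thesis using b0 by blast
  next
    case 3
    obtain K where K: "K > 0" "\<And>l u. moderate_solution B l u \<Longrightarrow> moment u 1 \<le> K * l ^ CARD('n)"
      using ub[OF moments_bounded_1] by blast
    obtain R where R: "R > 0" "K * R powr (p + 1 - 1) \<le> b0 / 2" using R_ex[of "p + 1 - 1" K] p K by auto
    show ?thesis
    proof (rule *[OF R K(2)])
      fix l u assume u: "moderate_solution B l u"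
      have "moment u (p + 1) \<le> R powr (p + 1 - 1) * moment u 1 + R powr (p + 1 - r) * moment u r"
        using 3 p r by (intro moment_interpolation(2)[OF u moment_finite_pos[OF u] moment_finite_pos[OF u] _ _ R(1)]) auto
      then show "moment u (p + 1) \<le> R powr (p + 1 - r) * moment u r + R powr (p + 1 - 1) * moment u 1" by simp
    qed
  qed
qed

text \<open>Interpolation between orders 0 and 1 at the scale \<open>R = l ^ n\<close>, which
  balances the two terms. Order 0 is bounded only by the measure of \<Omega> and not by a multiple
  of \<open>l ^ n\<close>, hence the factor \<open>(l ^ n) powr r\<close>.\<close>

lemma moment_upper_small:
  assumes r: "0 < r" "r < 1"
  shows "\<exists>K. \<forall>l u. moderate_solution B l u \<longrightarrow> moment u r \<le> K * (l ^ CARD('n)) powr r"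
proof -
  obtain K where K: "\<And>l u. moderate_solution B l u \<Longrightarrow> moment u 1 \<le> K * l ^ CARD('n)"
    using moments_bounded_1 unfolding moments_bounded_def by blast
  have "moment u r \<le> (measure lebesgue \<Omega> + K) * (l ^ CARD('n)) powr r" if u: "moderate_solution B l u" for l u
  proof -
    define L where "L = l ^ CARD('n)"
    have L: "L > 0" using moderate_solutionD(1)[OF u] by (simp add: L_def)
    have "moment u r \<le> L powr (r - 0) * moment u 0 + L powr (r - 1) * moment u 1"
      using r by (intro moment_interpolation(2)[OF u moment_finite_1(1,3)[OF u] _ _ L]) auto
    also have "\<dots> \<le> L powr (r - 0) * measure lebesgue \<Omega> + L powr (r - 1) * (K * L)"
      using K[OF u] moment_finite_1(2)[OF u] by (intro add_mono mult_left_mono) (auto simp: L_def)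
    also have "L powr (r - 1) * (K * L) = K * L powr r"
    proof -
      have "L powr (r - 1) * L powr 1 = L powr r" by (simp only: powr_add[symmetric]) simp
      then show ?thesis using L by simp
    qed
    finally show ?thesis by (simp add: L_def algebra_simps)
  qed
  then show ?thesis by blast
qed

text \<open>For a tent of radius \<open>l\<close> the factor \<open>l powr (- 2 * s)\<close> of its
  form cancels the coefficient \<open>l powr (2 * s)\<close>. Both parts of the energy along the ray
  through it are then compared with multiples of \<open>l ^ n\<close>, and so is the maximum on the
  ray.\<close>

lemma least_energy_bound:
  assumes B: "ball x0 l0 \<subseteq> \<Omega>"
  shows "\<exists>K. \<forall>l u. 0 < l \<longrightarrow> l \<le> l0 \<longrightarrow> least_energy_solution s p \<Omega> (l powr (2 * s)) u \<longrightarrow>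
    energy s p \<Omega> (l powr (2 * s)) u \<le> K * l ^ CARD('n)"
proof -
  obtain C where C: "C > 0" and tentC: "\<forall>\<Omega>\<in>sets lebesgue. \<forall>(x0 :: real ^ 'n) l. 0 < l \<longrightarrow> tent x0 l \<in> Hs_space s \<Omega> \<and>
    gagliardo_form s \<Omega> (tent x0 l) (tent x0 l) \<le> C * l powr (- 2 * s) * l ^ CARD('n) \<and>
    (LINT x:\<Omega>|lebesgue. (tent x0 l x)\<^sup>2) \<le> C * l ^ CARD('n)"
    using tent_Hs_space[OF s, where 'n='n] by (elim exE conjE) (rule that; assumption)
  define c1 where "c1 = (1 / 2) powr (p + 1) * (measure lborel (ball (0 :: real ^ 'n) 1) * (1 / 2) ^ CARD('n))"
  have c1: "c1 > 0" unfolding c1_def by (simp add: content_ball_pos)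
  \<comment> \<open>\<open>A1\<close> bounds from above the coefficient of
    \<open>\<tau>\<^sup>2\<close>, and \<open>A2\<close> from below that of
    \<open>\<tau> powr (p + 1)\<close>, in the energy of \<open>\<tau>\<close> times the tent
    divided by \<open>l ^ n\<close>.\<close>
  define A1 where "A1 = (\<kappa> + 1) * C / 2"
  define A2 where "A2 = c1 / (p + 1)"
  have A: "A1 > 0" "A2 > 0" using \<kappa> C c1 p by (auto simp: A1_def A2_def)
  define K where "K = A1 * (A1 / A2) powr (2 / (p - 1))"
  have K: "K \<ge> 0" using A by (simp add: K_def)
  have "energy s p \<Omega> (l powr (2 * s)) u \<le> K * l ^ CARD('n)"
    if l: "0 < l" "l \<le> l0" and u: "least_energy_solution s p \<Omega> (l powr (2 * s)) u" for l u
  proof -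
    let ?\<phi> = "tent x0 l" and ?L = "l ^ CARD('n)" and ?d = "l powr (2 * s)"
    have L: "?L > 0" using l by simp
    have \<phi>: "?\<phi> \<in> Hs_space s \<Omega>" "gagliardo_form s \<Omega> ?\<phi> ?\<phi> \<le> C * l powr (- 2 * s) * ?L"
      "(LINT x:\<Omega>|lebesgue. (?\<phi> x)\<^sup>2) \<le> C * ?L"
      using tentC OL l(1) by auto
    have "ball x0 l \<subseteq> \<Omega>" using B subset_ball[OF l(2), of x0] by blast
    then have P: "c1 * ?L \<le> (LINT x:\<Omega>|lebesgue. \<bar>?\<phi> x\<bar> powr (p + 1))"
      unfolding c1_def using p by (intro tent_powr_integral_ge l OL powr_p1_integrable \<phi>(1)) auto
    have Ppos: "0 < (LINT x:\<Omega>|lebesgue. \<bar>?\<phi> x\<bar> powr (p + 1))"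
      using P mult_pos_pos[OF c1 L] by linarith
    have Q: "?d * frac_const TYPE('n) s / 2 * gagliardo_form s \<Omega> ?\<phi> ?\<phi> + (LINT x:\<Omega>|lebesgue. (?\<phi> x)\<^sup>2) \<le> 2 * A1 * ?L"
    proof -
      have "?d * \<kappa> * gagliardo_form s \<Omega> ?\<phi> ?\<phi> \<le> ?d * \<kappa> * (C * l powr (- 2 * s) * ?L)"
        using \<phi>(2) \<kappa> by (intro mult_left_mono) auto
      also have "\<dots> = \<kappa> * C * ?L * (?d * l powr (- 2 * s))" by (simp add: mult_ac)
      also have "?d * l powr (- 2 * s) = 1" using l by (simp add: powr_add[symmetric])
      finally show ?thesis using \<phi>(3) by (simp add: A1_def \<kappa>_def algebra_simps)
    qed
    have en: "energy s p \<Omega> ?d (\<lambda>x. \<tau> * ?\<phi> x) \<le> K * ?L" if \<tau>: "0 \<le> \<tau>" for \<tau>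
    proof -
      have "energy s p \<Omega> ?d (\<lambda>x. \<tau> * ?\<phi> x) \<le> \<tau>\<^sup>2 / 2 * (2 * A1 * ?L) - \<tau> powr (p + 1) / (p + 1) * (c1 * ?L)"
        unfolding energy_scale[OF \<tau>] using Q P p by (intro diff_mono mult_left_mono) auto
      also have "\<dots> = (A1 * \<tau>\<^sup>2 - A2 * \<tau> powr (p + 1)) * ?L"
        by (simp add: A2_def algebra_simps)
      also have "\<dots> \<le> K * ?L"
        unfolding K_def using A \<tau> p L by (intro mult_right_mono quadratic_minus_power_bound) auto
      finally show ?thesis .
    qed
    obtain e where e: "mountain_pass_endpoint s p \<Omega> ?d e" and eq: "energy s p \<Omega> ?d u = mountain_pass_value s p \<Omega> ?d e"
      using u by (auto simp: least_energy_solution_def)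
    have "mountain_pass_value s p \<Omega> ?d e \<le> K * ?L"
      using p s K L frac_const_pos[OF s, where 'n='n] tent_bounds[OF l(1)]
      by (intro mountain_pass_value_le[OF O(1,2) _ _ _ powr_p1_integrable \<phi>(1) _ Ppos e _ en]) auto
    then show ?thesis by (simp add: eq)
  qed
  then show ?thesis by blast
qed

text \<open>On a weak solution the Nehari identity reduces the energy to
  \<open>1 / 2 - 1 / (p + 1)\<close> times the moment of order \<open>p + 1\<close>. This factor is
  positive because \<open>p > 1\<close>, so the energy bound becomes a moment bound.\<close>

lemma least_energy_solution_moderate:
  assumes B: "ball x0 l0 \<subseteq> \<Omega>"
  shows "\<exists>B. \<forall>l u. 0 < l \<longrightarrow> l \<le> l0 \<longrightarrow> weak_solution s p \<Omega> (l powr (2 * s)) u \<longrightarrow>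
    least_energy_solution s p \<Omega> (l powr (2 * s)) u \<longrightarrow> moderate_solution B l u"
proof -
  obtain K where K: "\<And>l u. 0 < l \<Longrightarrow> l \<le> l0 \<Longrightarrow> least_energy_solution s p \<Omega> (l powr (2 * s)) u \<Longrightarrow>
    energy s p \<Omega> (l powr (2 * s)) u \<le> K * l ^ CARD('n)"
    using least_energy_bound[OF B] by blast
  define e where "e = 1 / 2 - 1 / (p + 1)"
  have e: "e > 0" using p by (simp add: e_def field_simps)
  have "moderate_solution (K / e) l u" if l: "0 < l" "l \<le> l0" and w: "weak_solution s p \<Omega> (l powr (2 * s)) u"
    and u: "least_energy_solution s p \<Omega> (l powr (2 * s)) u" for l u
  proof -
    let ?P = "LINT x:\<Omega>|lebesgue. \<bar>u x\<bar> powr (p + 1)"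
    have "energy s p \<Omega> (l powr (2 * s)) u = 1 / 2 * ?P - 1 / (p + 1) * ?P"
      using nehari_identity[OF w] by (simp add: energy_def \<kappa>_def)
    also have "\<dots> = e * ?P" by (simp add: e_def left_diff_distrib)
    finally have "e * ?P \<le> K * l ^ CARD('n)" using K[OF l u] by simp
    then have "?P \<le> K / e * l ^ CARD('n)" using e by (simp add: field_simps)
    then show ?thesis using l w u by (simp add: moderate_solution_def least_energy_solution_def)
  qed
  then show ?thesis by blast
qed

end

theorem theorem1p3:
  fixes s p :: real and \<Omega> :: "(real ^ 'n) set"
  assumes "0 < s" and "s < 1"
    and "real CARD('n) > max 1 (2 * s)"
    and "1 < p" and "p < (real CARD('n) + s) / (real CARD('n) - s)"
    and "bounded_C11_domain \<Omega>"
  shows "\<exists>d0>0. \<forall>r>0. \<exists>b B. 0 < b \<and> b < B \<and>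
    (\<forall>d u. 0 < d \<longrightarrow> d < d0 \<longrightarrow> weak_solution s p \<Omega> d u \<longrightarrow> least_energy_solution s p \<Omega> d u \<longrightarrow>
      (1 \<le> r \<longrightarrow>
        b * d powr (real CARD('n) / (2 * s)) \<le> (LINT x:\<Omega>|lebesgue. u x powr r) \<and>
        (LINT x:\<Omega>|lebesgue. u x powr r) \<le> B * d powr (real CARD('n) / (2 * s))) \<and>
      (r < 1 \<longrightarrow>
        b * d powr (real CARD('n) / (2 * s)) \<le> (LINT x:\<Omega>|lebesgue. u x powr r) \<and>
        (LINT x:\<Omega>|lebesgue. u x powr r) \<le> B * d powr (real CARD('n) * r / (2 * s))))"
proof -
  let ?n = "real CARD('n)"
  define t where "t = 2 * s / ?n"
  have n: "?n > 1" "?n > 2 * s" using assms(3) by auto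
  have p: "p < 1 + 2 * t"
  proof -
    have "(?n + s) / (?n - s) = 1 + 2 * s / (?n - s)" using n assms(1) by (simp add: field_simps)
    also have "2 * s / (?n - s) \<le> 2 * s / (?n / 2)"
      using n assms(1) by (intro divide_left_mono mult_pos_pos) auto
    also have "2 * s / (?n / 2) = 2 * t" by (simp add: t_def)
    finally show ?thesis using assms(5) by simp
  qed
  have O: "open \<Omega>" "\<Omega> \<noteq> {}" "bounded \<Omega>" using assms(6) by (auto simp: bounded_C11_domain_def)
  obtain c \<rho>0 where c: "c > 0" and \<rho>0: "\<rho>0 > 0"
    and dens: "\<And>x \<rho>. x \<in> \<Omega> \<Longrightarrow> 0 < \<rho> \<Longrightarrow> \<rho> \<le> \<rho>0 \<Longrightarrow> c * \<rho> ^ CARD('n) \<le> measure lebesgue (\<Omega> \<inter> ball x \<rho>)"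
    using C11_measure_density[OF assms(6)] by blast
  obtain x0 \<rho>1 where \<rho>1: "\<rho>1 > 0" "ball x0 \<rho>1 \<subseteq> \<Omega>" using O openE by blast
  \<comment> \<open>Up to this scale both the density bound holds and the tent fits into \<Omega>;
    the threshold for \<open>d\<close> is the corresponding \<open>l0 powr (2 * s)\<close>.\<close>
  define l0 where "l0 = min \<rho>0 \<rho>1"
  have l0: "l0 > 0" "l0 \<le> \<rho>0" using \<rho>0 \<rho>1 by (auto simp: l0_def)
  have B: "ball x0 l0 \<subseteq> \<Omega>" using \<rho>1(2) subset_ball[of l0 \<rho>1 x0] by (auto simp: l0_def)
  interpret neumann_problem \<Omega> s p t c l0
    by unfold_locales (use assms p t_def O c l0 dens in auto)
  obtain K0 where K0: "\<And>l u. 0 < l \<Longrightarrow> l \<le> l0 \<Longrightarrow> weak_solution s p \<Omega> (l powr (2 * s)) u \<Longrightarrow>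
    least_energy_solution s p \<Omega> (l powr (2 * s)) u \<Longrightarrow> moderate_solution K0 l u"
    using least_energy_solution_moderate[OF B] by blast
  have solD: "moderate_solution K0 (d powr (1 / (2 * s))) u"
    "(d powr (1 / (2 * s))) ^ CARD('n) = d powr (?n / (2 * s))"
    "((d powr (1 / (2 * s))) ^ CARD('n)) powr r = d powr (?n * r / (2 * s))"
    if d: "0 < d" "d < l0 powr (2 * s)" and u: "weak_solution s p \<Omega> d u" "least_energy_solution s p \<Omega> d u" for d u r
  proof -
    define l where "l = d powr (1 / (2 * s))"
    have l: "l > 0" using d by (simp add: l_def)
    have ld: "l powr (2 * s) = d" using d assms(1) by (simp add: l_def powr_powr)
    have "l \<le> (l0 powr (2 * s)) powr (1 / (2 * s))"
      unfolding l_def using d assms(1) by (intro powr_mono2) auto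
    then have "l \<le> l0" using l0 assms(1) by (simp add: powr_powr)
    then show "moderate_solution K0 (d powr (1 / (2 * s))) u"
      using K0[OF l, of u] u by (simp add: ld) (simp add: l_def)
    show *: "(d powr (1 / (2 * s))) ^ CARD('n) = d powr (?n / (2 * s))"
      using d by (simp add: powr_power)
    show "((d powr (1 / (2 * s))) ^ CARD('n)) powr r = d powr (?n * r / (2 * s))"
      unfolding * by (simp add: powr_powr)
  qed
  show ?thesis
  proof (rule exI[of _ "l0 powr (2 * s)"], rule conjI[OF _ allI[OF impI]])
    show "l0 powr (2 * s) > 0" using l0 by simp
    fix r :: real assume r: "0 < r"
    obtain b where b: "b > 0" "\<And>l u. moderate_solution K0 l u \<Longrightarrow> b * l ^ CARD('n) \<le> moment u r"
      using moment_lower[OF r, of K0] by blast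
    \<comment> \<open>The range of \<open>r\<close> is a premise inside the bound, so
      \<open>K1\<close> and likewise \<open>K2\<close> exist for every \<open>r\<close>, and a
      single \<open>B\<close> serves both ranges; the entry \<open>b + 1\<close> in it secures
      \<open>b < B\<close>.\<close>
    obtain K1 where K1: "\<And>l u. 1 \<le> r \<Longrightarrow> moderate_solution K0 l u \<Longrightarrow> moment u r \<le> K1 * l ^ CARD('n)"
      using moments_bounded_ge_1[of r K0] unfolding moments_bounded_def by blast
    obtain K2 where K2: "\<And>l u. r < 1 \<Longrightarrow> moderate_solution K0 l u \<Longrightarrow> moment u r \<le> K2 * (l ^ CARD('n)) powr r"
      using moment_upper_small[OF r, of K0] by blast
    define B where "B = max (b + 1) (max K1 K2)"
    have B: "b < B" "K1 \<le> B" "K2 \<le> B" by (auto simp: B_def)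
    have "b * d powr (?n / (2 * s)) \<le> moment u r \<and>
        (1 \<le> r \<longrightarrow> moment u r \<le> B * d powr (?n / (2 * s))) \<and>
        (r < 1 \<longrightarrow> moment u r \<le> B * d powr (?n * r / (2 * s)))"
      if d: "0 < d" "d < l0 powr (2 * s)" and u: "weak_solution s p \<Omega> d u" "least_energy_solution s p \<Omega> d u" for d u
    proof (intro conjI impI)
      note so = solD[OF d u]
      show "b * d powr (?n / (2 * s)) \<le> moment u r" using b(2)[OF so(1)] by (simp only: so(2))
      show "moment u r \<le> B * d powr (?n / (2 * s))" if "1 \<le> r"
        using K1[OF that so(1)] mult_right_mono[OF B(2), of "d powr (?n / (2 * s))"]
        unfolding so(2) by (meson order.trans powr_ge_zero)
      show "moment u r \<le> B * d powr (?n * r / (2 * s))" if "r < 1"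
        using K2[OF that so(1)] mult_right_mono[OF B(3), of "d powr (?n * r / (2 * s))"]
        unfolding so(3) by (meson order.trans powr_ge_zero)
    qed
    then show "\<exists>b B. 0 < b \<and> b < B \<and>
      (\<forall>d u. 0 < d \<longrightarrow> d < l0 powr (2 * s) \<longrightarrow> weak_solution s p \<Omega> d u \<longrightarrow> least_energy_solution s p \<Omega> d u \<longrightarrow>
      (1 \<le> r \<longrightarrow>
        b * d powr (?n / (2 * s)) \<le> moment u r \<and> moment u r \<le> B * d powr (?n / (2 * s))) \<and>
      (r < 1 \<longrightarrow>
        b * d powr (?n / (2 * s)) \<le> moment u r \<and> moment u r \<le> B * d powr (?n * r / (2 * s))))"
      using b(1) B(1) by blast
  qed
qed

end
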